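(* Let $X$ be a $(1|1)$-supercurve over $S$ with dual $\hat X$, and let $\omega$ be an odd, closed (global) one-form on $X$. Let $\mathcal O_X^\omega=(\mathcal O_X,d+\omega)$ be the corresponding $\mathcal D_X$-module. Let $c_\omega$ denote the image of $\omega$ in $H^1(\hat X,\mathcal N_{\hat X})_0$ under the connecting homomorphism of the exact sequence $$0\to(\mathcal N_{\hat X})_0\to(\mathcal N_\Delta)_0\xrightarrow{\ \tilde d\ }(\Omega^1_{X,cl})_1\to0.$$ Regarding $\widehat{\mathcal O_X^\omega}$ simply as a line bundle on $\hat X$, its class in $H^1(\hat X,\mathcal O_{\hat X}^* )$ is $\exp(c_\omega)$.
   Context: Base: $S=\operatorname{Spec}(\Lambda)$, where $\Lambda$ is a fixed supercommutative finite-dimensional nilpotent extension of $\mathbb C$; everything is relative to $S$, in the Zariski or the complex topology. A $(1|1)$-supercurve is a smooth superscheme $X\to S$ of relative dimension $(1|1)$. A $\mathcal D_Z$-module is a ($\mathbb Z_2$-graded) sheaf of $\mathcal O_Z$-modules with a flat connection $\nabla$. Dual curve: $\Omega_X$ is the algebra of differential forms, for local coordinates $(z,\theta)$ equal to $\mathcal O_X[d\theta,dz]$ with $d\theta$ even and $dz$ odd; parity of forms is total parity, so an odd one-form is $dz\,A+d\theta\,B$ with $A$ even, $B$ odd. $\Delta=\operatorname{Proj}(\Omega_X)\xrightarrow{\pi}X$ has the same underlying space as $X$ and local coordinates $(z,\theta,\rho)$, $\rho=d\theta^{-1}dz$ odd. The exterior derivative induces an odd derivation $\tilde d:\mathcal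 O_\Delta\to\mathcal O_\Delta(1)$, locally $\tilde d=d\theta(\rho\,\partial_z+\partial_\theta)$; as sheaves $\mathcal O_\Delta(1)=\Omega^1_X$, and $\tilde d$ takes values in the sheaf $\Omega^1_{X,cl}$ of closed one-forms. The dual supercurve $\hat X$ has the same underlying space and $\mathcal O_{\hat X}=\ker\tilde d\subset\mathcal O_\Delta$, with local coordinates $(z-\theta\rho,\rho)$; the inclusion gives $\hat\pi:\Delta\to\hat X$. Transform: $\hat{\mathcal F}=\hat\pi_+\pi^*(\mathcal F)$, where $\pi^*$ is pullback with connection and $\hat\pi_+(\mathcal G)$ is the subsheaf of $\mathcal G$ killed by $\nabla_v$ for all $v$ tangent to the fibers of $\hat\pi$ (locally generated by $\rho\partial_z+\partial_\theta$), with vector fields on $\hat X$ acting through local lifts. $\widehat{\mathcal O_X^\omega}$ is a line bundle on $\hat X$. $\mathcal N$ denotes the sheaf of nilpotents of the structure sheaf; subscripts $0,1$ denote even and odd parts. The displayed sequence is exact, and $\exp:(\mathcal N_{\hat X})_0\to\mathcal O_{\hat X}^*$ is the (finite) exponential series. Conventions: if $h_i$ are local even nilpotent functions on $\Delta$ with $\tilde dh_i=\omega$, the connecting homomorphism sends $\omega$ to the class of $h_j-h_i$; a line bundle with local trivializations $\phi_i=g_{ij}\phi_j$ has class $[g_{ij}]$. *)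

theory Defs
  imports "HOL-Analysis.Analysis" "HOL-Algebra.Generated_Rings" "HOL-Algebra.Ideal"
begin

section \<open>Supercommutative rings\<close>

text \<open>Parities are Booleans, with \<^term>\<open>True\<close> for odd, so that addition in \<open>\<int>/2\<close> is \<open>\<noteq>\<close> and
  the product of two parities is \<open>\<and>\<close>.\<close>

record 'f super_ring = "'f ring" +
  homog :: "bool \<Rightarrow> 'f set"

definition ssgn :: "('f, 'm) ring_scheme \<Rightarrow> bool \<Rightarrow> 'f \<Rightarrow> 'f" where
  "ssgn R b x = (if b then \<ominus>\<^bsub>R\<^esub> x else x)"

definition supercomm_ring :: "('f, 'm) super_ring_scheme \<Rightarrow> bool" where
  "supercomm_ring R \<longleftrightarrow> ring R \<and>
     (\<forall>p. subgroup (homog R p) (add_monoid R)) \<and>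
     (\<forall>x\<in>carrier R. \<exists>!ab. ab \<in> homog R False \<times> homog R True \<and> x = fst ab \<oplus>\<^bsub>R\<^esub> snd ab) \<and>
     \<one>\<^bsub>R\<^esub> \<in> homog R False \<and>
     (\<forall>p q. \<forall>x\<in>homog R p. \<forall>y\<in>homog R q.
        x \<otimes>\<^bsub>R\<^esub> y \<in> homog R (p \<noteq> q) \<and> x \<otimes>\<^bsub>R\<^esub> y = ssgn R (p \<and> q) (y \<otimes>\<^bsub>R\<^esub> x))"

definition super_hom ::
  "('f, 'm) super_ring_scheme \<Rightarrow> ('g, 'n) super_ring_scheme \<Rightarrow> ('f \<Rightarrow> 'g) set" where
  "super_hom R R' = {f \<in> ring_hom R R'. \<forall>p. f ` homog R p \<subseteq> homog R' p}"

definition sub_super :: "('f, 'm) super_ring_scheme \<Rightarrow> 'f set \<Rightarrow> ('f, 'm) super_ring_scheme" where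
  "sub_super R C = R\<lparr>carrier := C, homog := \<lambda>p. C \<inter> homog R p\<rparr>"

definition super_derivation :: "('f, 'm) super_ring_scheme \<Rightarrow> bool \<Rightarrow> ('f \<Rightarrow> 'f) \<Rightarrow> bool" where
  "super_derivation R p D \<longleftrightarrow>
     (\<forall>q. D ` homog R q \<subseteq> homog R (p \<noteq> q)) \<and>
     (\<forall>x\<in>carrier R. D x \<in> carrier R) \<and>
     (\<forall>x\<in>carrier R. \<forall>y\<in>carrier R. D (x \<oplus>\<^bsub>R\<^esub> y) = D x \<oplus>\<^bsub>R\<^esub> D y) \<and>
     (\<forall>q. \<forall>x\<in>homog R q. \<forall>y\<in>carrier R.
        D (x \<otimes>\<^bsub>R\<^esub> y) = D x \<otimes>\<^bsub>R\<^esub> y \<oplus>\<^bsub>R\<^esub> ssgn R (p \<and> q) (x \<otimes>\<^bsub>R\<^esub> D y))"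

definition nilpotents :: "('f, 'm) ring_scheme \<Rightarrow> 'f set" where
  "nilpotents R = {x \<in> carrier R. \<exists>n::nat. x [^]\<^bsub>R\<^esub> n = \<zero>\<^bsub>R\<^esub>}"


section \<open>The base\<close>

definition basis_over_C :: "('k, 'm) ring_scheme \<Rightarrow> (complex \<Rightarrow> 'k) \<Rightarrow> 'k set \<Rightarrow> bool" where
  "basis_over_C \<Lambda> \<iota> E \<longleftrightarrow> finite E \<and> E \<subseteq> carrier \<Lambda> \<and>
     (\<forall>x\<in>carrier \<Lambda>. \<exists>!c. c \<in> E \<rightarrow>\<^sub>E (UNIV :: complex set) \<and>
        x = finsum \<Lambda> (\<lambda>e. \<iota> (c e) \<otimes>\<^bsub>\<Lambda>\<^esub> e) E)"

definition complex_ring :: "complex ring" where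
  "complex_ring = \<lparr>carrier = UNIV, mult = (*), one = 1, ring.zero = 0, add = (+)\<rparr>"

definition nilpotent_extension :: "('k, 'm) super_ring_scheme \<Rightarrow> (complex \<Rightarrow> 'k) \<Rightarrow> bool" where
  "nilpotent_extension \<Lambda> \<iota> \<longleftrightarrow> supercomm_ring \<Lambda> \<and> \<one>\<^bsub>\<Lambda>\<^esub> \<noteq> \<zero>\<^bsub>\<Lambda>\<^esub> \<and>
     \<iota> \<in> ring_hom complex_ring \<Lambda> \<and> range \<iota> \<subseteq> homog \<Lambda> False \<and>
     (\<exists>E. basis_over_C \<Lambda> \<iota> E) \<and>
     (\<forall>x\<in>carrier \<Lambda>. \<exists>c. \<exists>n\<in>nilpotents \<Lambda>. x = \<iota> c \<oplus>\<^bsub>\<Lambda>\<^esub> n)"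


section \<open>Sheaves of supercommutative rings\<close>

record ('a, 'f) ssheaf =
  topo :: "'a topology"
  sec :: "'a set \<Rightarrow> 'f super_ring"
  restr :: "'a set \<Rightarrow> 'a set \<Rightarrow> 'f \<Rightarrow> 'f"

definition gluing :: "'a topology \<Rightarrow> ('a set \<Rightarrow> 'f set) \<Rightarrow> ('a set \<Rightarrow> 'a set \<Rightarrow> 'f \<Rightarrow> 'f) \<Rightarrow> bool" where
  "gluing T F r \<longleftrightarrow>
     (\<forall>\<U> s. (\<forall>U\<in>\<U>. openin T U \<and> s U \<in> F U) \<longrightarrow>
            (\<forall>U\<in>\<U>. \<forall>V\<in>\<U>. r U (U \<inter> V) (s U) = r V (U \<inter> V) (s V)) \<longrightarrow>
            (\<exists>!t. t \<in> F (\<Union>\<U>) \<and> (\<forall>U\<in>\<U>. r (\<Union>\<U>) U t = s U)))"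

definition super_presheaf :: "('a, 'f, 'm) ssheaf_scheme \<Rightarrow> bool" where
  "super_presheaf A \<longleftrightarrow>
     (\<forall>U. openin (topo A) U \<longrightarrow> supercomm_ring (sec A U) \<and>
        (\<forall>x\<in>carrier (sec A U). restr A U U x = x)) \<and>
     (\<forall>U V. openin (topo A) U \<and> openin (topo A) V \<and> V \<subseteq> U \<longrightarrow>
        restr A U V \<in> super_hom (sec A U) (sec A V)) \<and>
     (\<forall>U V W. openin (topo A) U \<and> openin (topo A) V \<and> openin (topo A) W \<and> W \<subseteq> V \<and> V \<subseteq> U \<longrightarrow>
        (\<forall>x\<in>carrier (sec A U). restr A V W (restr A U V x) = restr A U W x))"

definition super_sheaf :: "('a, 'f, 'm) ssheaf_scheme \<Rightarrow> bool" where
  "super_sheaf A \<longleftrightarrow> super_presheaf A \<and> gluing (topo A) (\<lambda>U. carrier (sec A U)) (restr A)"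

text \<open>A sheaf of \<open>\<int>\<close>-graded rings. Sections over \<open>U\<close> form the direct sum of the \<open>degree_part A U k\<close>, and it
  is each \<open>\<lambda>U. degree_part A U k\<close> that satisfies the gluing condition (an infinite direct sum of sheaves
  does not in general). The \<open>\<int>/2\<close>-grading is the total parity, and alone governs signs.\<close>

record ('a, 'f) gsheaf = "('a, 'f) ssheaf" +
  degree_part :: "'a set \<Rightarrow> int \<Rightarrow> 'f set"

definition graded_super_sheaf :: "('a, 'f, 'm) gsheaf_scheme \<Rightarrow> bool" where
  "graded_super_sheaf A \<longleftrightarrow> super_presheaf A \<and>
     (\<forall>U. openin (topo A) U \<longrightarrow>
        (\<forall>k. subgroup (degree_part A U k) (add_monoid (sec A U))) \<and>
        \<one>\<^bsub>sec A U\<^esub> \<in> degree_part A U 0 \<and>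
        (\<forall>k l. \<forall>x\<in>degree_part A U k. \<forall>y\<in>degree_part A U l. x \<otimes>\<^bsub>sec A U\<^esub> y \<in> degree_part A U (k + l)) \<and>
        (\<forall>x\<in>carrier (sec A U). \<exists>!f. (\<forall>k. f k \<in> degree_part A U k) \<and> finite {k. f k \<noteq> \<zero>\<^bsub>sec A U\<^esub>} \<and>
           x = finsum (sec A U) f {k. f k \<noteq> \<zero>\<^bsub>sec A U\<^esub>}) \<and>
        (\<forall>k. \<forall>a\<in>homog (sec A U) False. \<forall>b\<in>homog (sec A U) True.
           a \<oplus>\<^bsub>sec A U\<^esub> b \<in> degree_part A U k \<longrightarrow> a \<in> degree_part A U k \<and> b \<in> degree_part A U k)) \<and>
     (\<forall>U V k. openin (topo A) U \<and> openin (topo A) V \<and> V \<subseteq> U \<longrightarrow>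
        restr A U V ` degree_part A U k \<subseteq> degree_part A V k) \<and>
     (\<forall>k. gluing (topo A) (\<lambda>U. degree_part A U k) (restr A))"


section \<open>Supercurves over \<open>Spec \<Lambda>\<close>\<close>

record ('a, 'f, 'k) superspace = "('a, 'f) ssheaf" +
  cst :: "'a set \<Rightarrow> 'k \<Rightarrow> 'f"

definition superspace_over ::
  "('k, 'n) super_ring_scheme \<Rightarrow> ('a, 'f, 'k, 'm) superspace_scheme \<Rightarrow> bool" where
  "superspace_over \<Lambda> X \<longleftrightarrow> super_sheaf X \<and>
     (\<forall>U. openin (topo X) U \<longrightarrow> cst X U \<in> super_hom \<Lambda> (sec X U)) \<and>
     (\<forall>U V. openin (topo X) U \<and> openin (topo X) V \<and> V \<subseteq> U \<longrightarrow>
        (\<forall>c\<in>carrier \<Lambda>. restr X U V (cst X U c) = cst X V c))"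

text \<open>\<open>product_over \<Lambda> \<iota> X U B \<theta>\<close> says that \<open>(U, \<O>\<^sub>X|U)\<close> is the product of \<open>(U, B)\<close> with
  \<open>Spec \<Lambda> \<times> \<complex>\<^bsup>0|1\<^esup>\<close>, that is \<open>\<O>\<^sub>X|U = B \<otimes>\<^sub>\<complex> \<Lambda>[\<theta>]\<close> for a sheaf \<open>B\<close> of even
  \<open>\<complex>\<close>-subalgebras. The gluing property of \<open>B\<close> follows from uniqueness of the components.\<close>

definition product_over ::
  "('k, 'n) super_ring_scheme \<Rightarrow> (complex \<Rightarrow> 'k) \<Rightarrow> ('a, 'f, 'k, 'm) superspace_scheme \<Rightarrow>
   'a set \<Rightarrow> ('a set \<Rightarrow> 'f set) \<Rightarrow> 'f \<Rightarrow> bool" where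
  "product_over \<Lambda> \<iota> X U B \<theta> \<longleftrightarrow> openin (topo X) U \<and> \<theta> \<in> homog (sec X U) True \<and>
     (\<forall>V. openin (topo X) V \<and> V \<subseteq> U \<longrightarrow>
        subring (B V) (sec X V) \<and> B V \<subseteq> homog (sec X V) False \<and> (\<forall>c. cst X V (\<iota> c) \<in> B V) \<and>
        (\<forall>W. openin (topo X) W \<and> W \<subseteq> V \<longrightarrow> restr X V W ` B V \<subseteq> B W)) \<and>
     (\<exists>E. basis_over_C \<Lambda> \<iota> E \<and>
        (\<forall>V. openin (topo X) V \<and> V \<subseteq> U \<longrightarrow>
          (\<forall>s\<in>carrier (sec X V). \<exists>!ab. ab \<in> (E \<rightarrow>\<^sub>E B V) \<times> (E \<rightarrow>\<^sub>E B V) \<and>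
             s = finsum (sec X V) (\<lambda>e. cst X V e \<otimes>\<^bsub>sec X V\<^esub> fst ab e) E \<oplus>\<^bsub>sec X V\<^esub>
                 finsum (sec X V) (\<lambda>e. cst X V e \<otimes>\<^bsub>sec X V\<^esub> snd ab e) E \<otimes>\<^bsub>sec X V\<^esub>
                   restr X U V \<theta>)))"

text \<open>In the complex topology the local model is an open subset of \<open>\<complex>\<close> with its sheaf of holomorphic
  functions: \<open>\<kappa>\<close> is the chart, \<open>\<beta> V f\<close> the section over \<open>V\<close> given by the holomorphic function \<open>f\<close> on
  \<open>\<kappa> ` V\<close>.\<close>

definition complex_coordinates ::
  "('k, 'n) super_ring_scheme \<Rightarrow> (complex \<Rightarrow> 'k) \<Rightarrow> ('a, 'f, 'k, 'm) superspace_scheme \<Rightarrow>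
   'a set \<Rightarrow> 'f \<Rightarrow> 'f \<Rightarrow> bool" where
  "complex_coordinates \<Lambda> \<iota> X U z \<theta> \<longleftrightarrow> openin (topo X) U \<and>
     (\<exists>\<kappa> \<beta>. open (\<kappa> ` U) \<and>
        homeomorphic_map (subtopology (topo X) U) (top_of_set (\<kappa> ` U)) \<kappa> \<and>
        (\<forall>V. openin (topo X) V \<and> V \<subseteq> U \<longrightarrow>
           (\<forall>f g. f holomorphic_on \<kappa> ` V \<and> g holomorphic_on \<kappa> ` V \<longrightarrow>
              (\<beta> V f = \<beta> V g \<longleftrightarrow> (\<forall>w\<in>\<kappa> ` V. f w = g w)) \<and>
              \<beta> V (\<lambda>w. f w + g w) = \<beta> V f \<oplus>\<^bsub>sec X V\<^esub> \<beta> V g \<and>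
              \<beta> V (\<lambda>w. f w * g w) = \<beta> V f \<otimes>\<^bsub>sec X V\<^esub> \<beta> V g \<and>
              (\<forall>W. openin (topo X) W \<and> W \<subseteq> V \<longrightarrow> restr X V W (\<beta> V f) = \<beta> W f)) \<and>
           (\<forall>c. \<beta> V (\<lambda>w. c) = cst X V (\<iota> c))) \<and>
        product_over \<Lambda> \<iota> X U (\<lambda>V. \<beta> V ` {f. f holomorphic_on \<kappa> ` V}) \<theta> \<and>
        z = \<beta> U (\<lambda>w. w))"

text \<open>\<open>(U, B)\<close> is an affine scheme of finite type over \<open>\<complex>\<close>: the points of \<open>U\<close> are the primes of
  \<open>B U\<close> (a point \<open>x\<close> giving the prime of functions that are not invertible near \<open>x\<close>), the topology is
  the Zariski topology, and the sections over a basic open set are the localisation.\<close>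

definition vanishing_at ::
  "('a, 'f, 'm) ssheaf_scheme \<Rightarrow> 'a set \<Rightarrow> ('a set \<Rightarrow> 'f set) \<Rightarrow> 'a \<Rightarrow> 'f set" where
  "vanishing_at X U B x = {f \<in> B U. \<forall>V. openin (topo X) V \<and> x \<in> V \<and> V \<subseteq> U \<longrightarrow>
     restr X U V f \<notin> Units (sub_super (sec X V) (B V))}"

definition basic_open ::
  "('a, 'f, 'm) ssheaf_scheme \<Rightarrow> 'a set \<Rightarrow> ('a set \<Rightarrow> 'f set) \<Rightarrow> 'f \<Rightarrow> 'a set" where
  "basic_open X U B f = {x \<in> U. f \<notin> vanishing_at X U B x}"

definition affine_finite_type ::
  "(complex \<Rightarrow> 'k) \<Rightarrow> ('a, 'f, 'k, 'm) superspace_scheme \<Rightarrow> 'a set \<Rightarrow> ('a set \<Rightarrow> 'f set) \<Rightarrow> bool" where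
  "affine_finite_type \<iota> X U B \<longleftrightarrow>
     bij_betw (vanishing_at X U B) U {P. primeideal P (sub_super (sec X U) (B U))} \<and>
     (\<forall>V\<subseteq>U. openin (topo X) V \<longleftrightarrow> (\<exists>S\<subseteq>B U. V = (\<Union>f\<in>S. basic_open X U B f))) \<and>
     (\<forall>f\<in>B U. let V = basic_open X U B f; r = restr X U V in
        r f \<in> Units (sub_super (sec X V) (B V)) \<and>
        (\<forall>s\<in>B V. \<exists>a\<in>B U. \<exists>n::nat. s \<otimes>\<^bsub>sec X V\<^esub> (r f [^]\<^bsub>sec X V\<^esub> n) = r a) \<and>
        (\<forall>a\<in>B U. r a = \<zero>\<^bsub>sec X V\<^esub> \<longrightarrow>
           (\<exists>n::nat. (f [^]\<^bsub>sec X U\<^esub> n) \<otimes>\<^bsub>sec X U\<^esub> a = \<zero>\<^bsub>sec X U\<^esub>))) \<and>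
     (\<exists>G. finite G \<and> G \<subseteq> B U \<and>
        B U = generate_ring (sec X U) (range (\<lambda>c. cst X U (\<iota> c)) \<union> G))"

text \<open>\<open>z\<close> defines an etale morphism from \<open>(U, B)\<close> to the affine line, i.e. one that at each closed
  point is flat (\<open>z - c\<close> is not a zero divisor in the local ring) and unramified (\<open>z - c\<close> generates
  the maximal ideal). Having such a \<open>z\<close> locally is smoothness of relative dimension one.\<close>

definition etale_coordinate ::
  "(complex \<Rightarrow> 'k) \<Rightarrow> ('a, 'f, 'k, 'm) superspace_scheme \<Rightarrow> 'a set \<Rightarrow> ('a set \<Rightarrow> 'f set) \<Rightarrow> 'f \<Rightarrow> bool" where
  "etale_coordinate \<iota> X U B z \<longleftrightarrow> z \<in> B U \<and>
     (\<forall>M. maximalideal M (sub_super (sec X U) (B U)) \<longrightarrow>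
        (\<exists>c. let t = z \<ominus>\<^bsub>sec X U\<^esub> cst X U (\<iota> c) in
           t \<in> M \<and>
           (\<forall>f\<in>M. \<exists>s\<in>B U - M. \<exists>b\<in>B U. s \<otimes>\<^bsub>sec X U\<^esub> f = t \<otimes>\<^bsub>sec X U\<^esub> b) \<and>
           (\<forall>b\<in>B U. t \<otimes>\<^bsub>sec X U\<^esub> b = \<zero>\<^bsub>sec X U\<^esub> \<longrightarrow>
              (\<exists>s\<in>B U - M. s \<otimes>\<^bsub>sec X U\<^esub> b = \<zero>\<^bsub>sec X U\<^esub>))))"

definition zariski_coordinates ::
  "('k, 'n) super_ring_scheme \<Rightarrow> (complex \<Rightarrow> 'k) \<Rightarrow> ('a, 'f, 'k, 'm) superspace_scheme \<Rightarrow>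
   'a set \<Rightarrow> 'f \<Rightarrow> 'f \<Rightarrow> bool" where
  "zariski_coordinates \<Lambda> \<iota> X U z \<theta> \<longleftrightarrow>
     (\<exists>B. product_over \<Lambda> \<iota> X U B \<theta> \<and> affine_finite_type \<iota> X U B \<and> etale_coordinate \<iota> X U B z)"

datatype topology_kind = Zariski | Complex

definition local_coordinates ::
  "topology_kind \<Rightarrow> ('k, 'n) super_ring_scheme \<Rightarrow> (complex \<Rightarrow> 'k) \<Rightarrow>
   ('a, 'f, 'k, 'm) superspace_scheme \<Rightarrow> 'a set \<Rightarrow> 'f \<Rightarrow> 'f \<Rightarrow> bool" where
  "local_coordinates \<tau> \<Lambda> \<iota> X U z \<theta> = (case \<tau> of
     Zariski \<Rightarrow> zariski_coordinates \<Lambda> \<iota> X U z \<theta>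
   | Complex \<Rightarrow> complex_coordinates \<Lambda> \<iota> X U z \<theta>)"

definition supercurve ::
  "topology_kind \<Rightarrow> ('k, 'n) super_ring_scheme \<Rightarrow> (complex \<Rightarrow> 'k) \<Rightarrow>
   ('a, 'f, 'k, 'm) superspace_scheme \<Rightarrow> bool" where
  "supercurve \<tau> \<Lambda> \<iota> X \<longleftrightarrow> superspace_over \<Lambda> X \<and>
     (\<forall>x\<in>topspace (topo X). \<exists>U z \<theta>. x \<in> U \<and> local_coordinates \<tau> \<Lambda> \<iota> X U z \<theta>)"


section \<open>Differential forms\<close>

text \<open>\<open>ext_d\<close> is the exterior derivative, \<open>incl\<close> the identification of \<open>\<O>\<^sub>X\<close> with the forms of
  degree 0. For local coordinates, \<open>\<Omega>\<^sub>X = \<O>\<^sub>X[d\<theta>, dz]\<close>, so the forms of degree \<open>k + 1\<close> are freely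
  generated over functions by \<open>d\<theta>\<^bsup>k+1\<^esup>\<close> and \<open>d\<theta>\<^bsup>k\<^esup> dz\<close>. These conditions determine the sheaf of
  differential algebras up to unique isomorphism.\<close>

record ('a, 'f, 'w) forms = "('a, 'w) gsheaf" +
  incl :: "'a set \<Rightarrow> 'f \<Rightarrow> 'w"
  ext_d :: "'a set \<Rightarrow> 'w \<Rightarrow> 'w"

definition dfun :: "('a, 'f, 'w, 'm) forms_scheme \<Rightarrow> 'a set \<Rightarrow> 'f \<Rightarrow> 'w" where
  "dfun \<Omega> U f = ext_d \<Omega> U (incl \<Omega> U f)"

definition differential_forms ::
  "topology_kind \<Rightarrow> ('k, 'n) super_ring_scheme \<Rightarrow> (complex \<Rightarrow> 'k) \<Rightarrow>
   ('a, 'f, 'k, 'm) superspace_scheme \<Rightarrow> ('a, 'f, 'w, 'p) forms_scheme \<Rightarrow> bool" where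
  "differential_forms \<tau> \<Lambda> \<iota> X \<Omega> \<longleftrightarrow> graded_super_sheaf \<Omega> \<and> topo \<Omega> = topo X \<and>
     (\<forall>U. openin (topo X) U \<longrightarrow>
        incl \<Omega> U \<in> super_hom (sec X U) (sec \<Omega> U) \<and>
        bij_betw (incl \<Omega> U) (carrier (sec X U)) (degree_part \<Omega> U 0) \<and>
        (\<forall>k<0. degree_part \<Omega> U k = {\<zero>\<^bsub>sec \<Omega> U\<^esub>}) \<and>
        super_derivation (sec \<Omega> U) True (ext_d \<Omega> U) \<and>
        (\<forall>k. ext_d \<Omega> U ` degree_part \<Omega> U k \<subseteq> degree_part \<Omega> U (k + 1)) \<and>
        (\<forall>\<alpha>\<in>carrier (sec \<Omega> U). ext_d \<Omega> U (ext_d \<Omega> U \<alpha>) = \<zero>\<^bsub>sec \<Omega> U\<^esub>) \<and>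
        (\<forall>c\<in>carrier \<Lambda>. dfun \<Omega> U (cst X U c) = \<zero>\<^bsub>sec \<Omega> U\<^esub>)) \<and>
     (\<forall>U V. openin (topo X) U \<and> openin (topo X) V \<and> V \<subseteq> U \<longrightarrow>
        (\<forall>f\<in>carrier (sec X U). restr \<Omega> U V (incl \<Omega> U f) = incl \<Omega> V (restr X U V f)) \<and>
        (\<forall>\<alpha>\<in>carrier (sec \<Omega> U). restr \<Omega> U V (ext_d \<Omega> U \<alpha>) = ext_d \<Omega> V (restr \<Omega> U V \<alpha>))) \<and>
     (\<forall>U z \<theta>. local_coordinates \<tau> \<Lambda> \<iota> X U z \<theta> \<longrightarrow>
        (\<forall>V k. openin (topo X) V \<and> V \<subseteq> U \<longrightarrow>
           (let R = sec \<Omega> V; dz = dfun \<Omega> V (restr X U V z); d\<theta> = dfun \<Omega> V (restr X U V \<theta>) in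
            \<forall>\<alpha>\<in>degree_part \<Omega> V (int k + 1). \<exists>!ab. ab \<in> carrier (sec X V) \<times> carrier (sec X V) \<and>
              \<alpha> = (d\<theta> [^]\<^bsub>R\<^esub> (k + 1)) \<otimes>\<^bsub>R\<^esub> incl \<Omega> V (fst ab) \<oplus>\<^bsub>R\<^esub>
                  (d\<theta> [^]\<^bsub>R\<^esub> k) \<otimes>\<^bsub>R\<^esub> dz \<otimes>\<^bsub>R\<^esub> incl \<Omega> V (snd ab))))"


section \<open>The space \<open>\<Delta>\<close> and the dual curve\<close>

text \<open>\<open>\<Delta> = Proj(\<Omega>\<^sub>X)\<close>. Where there are coordinates \<open>(z, \<theta>)\<close>, the chart of \<open>Proj\<close> where \<open>d\<theta>\<close> is
  invertible is everything (\<open>dz\<close> being nilpotent), so \<open>\<O>\<^sub>\<Delta>(k)\<close> is there the part of degree \<open>k\<close> of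
  \<open>\<Omega>\<^sub>X[d\<theta>\<^bsup>-1\<^esup>]\<close>. The record holds the graded sheaf \<open>\<Oplus>\<^sub>k \<O>\<^sub>\<Delta>(k)\<close> with the localisation map and the
  extension \<open>dtilde\<close> of the exterior derivative.\<close>

record ('a, 'w, 'l) proj = "('a, 'l) gsheaf" +
  localize :: "'a set \<Rightarrow> 'w \<Rightarrow> 'l"
  dtilde :: "'a set \<Rightarrow> 'l \<Rightarrow> 'l"

definition is_proj ::
  "topology_kind \<Rightarrow> ('k, 'n) super_ring_scheme \<Rightarrow> (complex \<Rightarrow> 'k) \<Rightarrow>
   ('a, 'f, 'k, 'm) superspace_scheme \<Rightarrow> ('a, 'f, 'w, 'p) forms_scheme \<Rightarrow>
   ('a, 'w, 'l, 'q) proj_scheme \<Rightarrow> bool" where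
  "is_proj \<tau> \<Lambda> \<iota> X \<Omega> \<Delta> \<longleftrightarrow> graded_super_sheaf \<Delta> \<and> topo \<Delta> = topo X \<and>
     (\<forall>U. openin (topo X) U \<longrightarrow>
        localize \<Delta> U \<in> super_hom (sec \<Omega> U) (sec \<Delta> U) \<and>
        (\<forall>k. localize \<Delta> U ` degree_part \<Omega> U k \<subseteq> degree_part \<Delta> U k) \<and>
        super_derivation (sec \<Delta> U) True (dtilde \<Delta> U) \<and>
        (\<forall>k. dtilde \<Delta> U ` degree_part \<Delta> U k \<subseteq> degree_part \<Delta> U (k + 1)) \<and>
        (\<forall>\<alpha>\<in>carrier (sec \<Omega> U). dtilde \<Delta> U (localize \<Delta> U \<alpha>) = localize \<Delta> U (ext_d \<Omega> U \<alpha>))) \<and>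
     (\<forall>U V. openin (topo X) U \<and> openin (topo X) V \<and> V \<subseteq> U \<longrightarrow>
        (\<forall>\<alpha>\<in>carrier (sec \<Omega> U). restr \<Delta> U V (localize \<Delta> U \<alpha>) = localize \<Delta> V (restr \<Omega> U V \<alpha>)) \<and>
        (\<forall>s\<in>carrier (sec \<Delta> U). restr \<Delta> U V (dtilde \<Delta> U s) = dtilde \<Delta> V (restr \<Delta> U V s))) \<and>
     (\<forall>U z \<theta>. local_coordinates \<tau> \<Lambda> \<iota> X U z \<theta> \<longrightarrow>
        (\<forall>V. openin (topo X) V \<and> V \<subseteq> U \<longrightarrow>
           (let R = sec \<Delta> V; d\<theta> = localize \<Delta> V (dfun \<Omega> V (restr X U V \<theta>)) in
            d\<theta> \<in> Units R \<and>
            inj_on (localize \<Delta> V) (carrier (sec \<Omega> V)) \<and>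
            (\<forall>k. \<forall>s\<in>degree_part \<Delta> V k. \<exists>n::nat. \<exists>\<alpha>\<in>degree_part \<Omega> V (k + int n).
               s \<otimes>\<^bsub>R\<^esub> (d\<theta> [^]\<^bsub>R\<^esub> n) = localize \<Delta> V \<alpha>))))"

definition pull_fun ::
  "('a, 'f, 'w, 'p) forms_scheme \<Rightarrow> ('a, 'w, 'l, 'q) proj_scheme \<Rightarrow> 'a set \<Rightarrow> 'f \<Rightarrow> 'l" where
  "pull_fun \<Omega> \<Delta> U f = localize \<Delta> U (incl \<Omega> U f)"

definition O_Delta ::
  "('a, 'f, 'k, 'm) superspace_scheme \<Rightarrow> ('a, 'f, 'w, 'p) forms_scheme \<Rightarrow>
   ('a, 'w, 'l, 'q) proj_scheme \<Rightarrow> ('a, 'l, 'k) superspace" where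
  "O_Delta X \<Omega> \<Delta> = \<lparr>topo = topo X, sec = \<lambda>U. sub_super (sec \<Delta> U) (degree_part \<Delta> U 0),
     restr = restr \<Delta>, cst = \<lambda>U c. pull_fun \<Omega> \<Delta> U (cst X U c)\<rparr>"

definition dual_curve ::
  "('a, 'f, 'k, 'm) superspace_scheme \<Rightarrow> ('a, 'f, 'w, 'p) forms_scheme \<Rightarrow>
   ('a, 'w, 'l, 'q) proj_scheme \<Rightarrow> ('a, 'l, 'k) superspace" where
  "dual_curve X \<Omega> \<Delta> = \<lparr>topo = topo X,
     sec = \<lambda>U. sub_super (sec \<Delta> U) {s \<in> degree_part \<Delta> U 0. dtilde \<Delta> U s = \<zero>\<^bsub>sec \<Delta> U\<^esub>},
     restr = restr \<Delta>, cst = \<lambda>U c. pull_fun \<Omega> \<Delta> U (cst X U c)\<rparr>"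


section \<open>Connections and the transform\<close>

definition twisted_connection ::
  "('a, 'f, 'w, 'p) forms_scheme \<Rightarrow> 'w \<Rightarrow> 'a set \<Rightarrow> 'f \<Rightarrow> 'w" where
  "twisted_connection \<Omega> \<omega> U f =
     dfun \<Omega> U f \<oplus>\<^bsub>sec \<Omega> U\<^esub> restr \<Omega> (topspace (topo \<Omega>)) U \<omega> \<otimes>\<^bsub>sec \<Omega> U\<^esub> incl \<Omega> U f"

definition vector_field ::
  "('k, 'n) super_ring_scheme \<Rightarrow> ('a, 'l, 'k, 'm) superspace_scheme \<Rightarrow> 'a set \<Rightarrow> bool \<Rightarrow>
   ('a set \<Rightarrow> 'l \<Rightarrow> 'l) \<Rightarrow> bool" where
  "vector_field \<Lambda> Y V p v \<longleftrightarrow>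
     (\<forall>W. openin (topo Y) W \<and> W \<subseteq> V \<longrightarrow> super_derivation (sec Y W) p (v W) \<and>
        (\<forall>c\<in>carrier \<Lambda>. v W (cst Y W c) = \<zero>\<^bsub>sec Y W\<^esub>) \<and>
        (\<forall>W'. openin (topo Y) W' \<and> W' \<subseteq> W \<longrightarrow>
           (\<forall>s\<in>carrier (sec Y W). restr Y W W' (v W s) = v W' (restr Y W W' s))))"

definition vertical_field ::
  "('k, 'n) super_ring_scheme \<Rightarrow> ('a, 'f, 'k, 'm) superspace_scheme \<Rightarrow>
   ('a, 'f, 'w, 'p) forms_scheme \<Rightarrow> ('a, 'w, 'l, 'q) proj_scheme \<Rightarrow> 'a set \<Rightarrow> bool \<Rightarrow>
   ('a set \<Rightarrow> 'l \<Rightarrow> 'l) \<Rightarrow> bool" where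
  "vertical_field \<Lambda> X \<Omega> \<Delta> V p v \<longleftrightarrow> vector_field \<Lambda> (O_Delta X \<Omega> \<Delta>) V p v \<and>
     (\<forall>W. openin (topo X) W \<and> W \<subseteq> V \<longrightarrow>
        (\<forall>s\<in>carrier (sec (dual_curve X \<Omega> \<Delta>) W). v W s = \<zero>\<^bsub>sec \<Delta> W\<^esub>))"

text \<open>The contraction \<open>\<langle>v, \<pi>\<^sup>*\<alpha>\<rangle>\<close> of a vector field on \<open>\<Delta>\<close> with the pullback of a one-form on \<open>X\<close>: the
  right \<open>\<O>\<^sub>X\<close>-linear map with \<open>\<langle>v, \<pi>\<^sup>*df\<rangle> = v(\<pi>\<^sup>*f)\<close>, so
  \<open>\<langle>v, dz A + d\<theta> B\<rangle> = v(z) A + v(\<theta>) B\<close>.\<close>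

definition is_contraction ::
  "('a, 'f, 'k, 'm) superspace_scheme \<Rightarrow> ('a, 'f, 'w, 'p) forms_scheme \<Rightarrow>
   ('a, 'w, 'l, 'q) proj_scheme \<Rightarrow> 'a set \<Rightarrow> ('a set \<Rightarrow> 'l \<Rightarrow> 'l) \<Rightarrow> ('a set \<Rightarrow> 'w \<Rightarrow> 'l) \<Rightarrow> bool" where
  "is_contraction X \<Omega> \<Delta> V v c \<longleftrightarrow>
     (\<forall>W. openin (topo X) W \<and> W \<subseteq> V \<longrightarrow>
        (\<forall>\<alpha>\<in>degree_part \<Omega> W 1. c W \<alpha> \<in> degree_part \<Delta> W 0 \<and>
           (\<forall>\<beta>\<in>degree_part \<Omega> W 1. c W (\<alpha> \<oplus>\<^bsub>sec \<Omega> W\<^esub> \<beta>) = c W \<alpha> \<oplus>\<^bsub>sec \<Delta> W\<^esub> c W \<beta>) \<and>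
           (\<forall>f\<in>carrier (sec X W).
              c W (\<alpha> \<otimes>\<^bsub>sec \<Omega> W\<^esub> incl \<Omega> W f) = c W \<alpha> \<otimes>\<^bsub>sec \<Delta> W\<^esub> pull_fun \<Omega> \<Delta> W f) \<and>
           (\<forall>W'. openin (topo X) W' \<and> W' \<subseteq> W \<longrightarrow>
              restr \<Delta> W W' (c W \<alpha>) = c W' (restr \<Omega> W W' \<alpha>))) \<and>
        (\<forall>f\<in>carrier (sec X W). c W (dfun \<Omega> W f) = v W (pull_fun \<Omega> \<Delta> W f)))"

definition contract ::
  "('a, 'f, 'k, 'm) superspace_scheme \<Rightarrow> ('a, 'f, 'w, 'p) forms_scheme \<Rightarrow>
   ('a, 'w, 'l, 'q) proj_scheme \<Rightarrow> 'a set \<Rightarrow> ('a set \<Rightarrow> 'l \<Rightarrow> 'l) \<Rightarrow> 'w \<Rightarrow> 'l" where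
  "contract X \<Omega> \<Delta> V v \<alpha> = (THE t. \<exists>c. is_contraction X \<Omega> \<Delta> V v c \<and> t = c V \<alpha>)"

text \<open>Pullback to \<open>\<Delta>\<close> of a connection \<open>D : \<O>\<^sub>X \<rightarrow> \<Omega>\<^sup>1\<^sub>X\<close>. As \<open>\<pi>\<^sup>*\<O>\<^sub>X = \<O>\<^sub>\<Delta>\<close> is free on \<open>1\<close>, it is determined
  by \<open>\<nabla>\<^sub>v 1 = \<langle>v, \<pi>\<^sup>*(D 1)\<rangle>\<close> and the Leibniz rule \<open>\<nabla>\<^sub>v g = v(g) \<plusminus> g \<nabla>\<^sub>v 1\<close>; as \<open>D 1\<close> is odd,
  \<open>\<nabla>\<^sub>v 1\<close> has the parity of \<open>v\<close>, and the sign is absorbed by writing \<open>(\<nabla>\<^sub>v 1) g\<close>.\<close>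

definition pullback_connection ::
  "('a, 'f, 'k, 'm) superspace_scheme \<Rightarrow> ('a, 'f, 'w, 'p) forms_scheme \<Rightarrow>
   ('a, 'w, 'l, 'q) proj_scheme \<Rightarrow> ('a set \<Rightarrow> 'f \<Rightarrow> 'w) \<Rightarrow>
   'a set \<Rightarrow> ('a set \<Rightarrow> 'l \<Rightarrow> 'l) \<Rightarrow> 'l \<Rightarrow> 'l" where
  "pullback_connection X \<Omega> \<Delta> D V v g =
     v V g \<oplus>\<^bsub>sec \<Delta> V\<^esub> contract X \<Omega> \<Delta> V v (D V \<one>\<^bsub>sec X V\<^esub>) \<otimes>\<^bsub>sec \<Delta> V\<^esub> g"

text \<open>\<open>\<pi>\<^sub>+\<close> along the projection from \<open>\<Delta>\<close> to the dual curve, for a connection \<open>nabla\<close> on \<open>\<O>\<^sub>\<Delta>\<close>.\<close>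

definition pi_hat_plus ::
  "('k, 'n) super_ring_scheme \<Rightarrow> ('a, 'f, 'k, 'm) superspace_scheme \<Rightarrow>
   ('a, 'f, 'w, 'p) forms_scheme \<Rightarrow> ('a, 'w, 'l, 'q) proj_scheme \<Rightarrow>
   ('a set \<Rightarrow> ('a set \<Rightarrow> 'l \<Rightarrow> 'l) \<Rightarrow> 'l \<Rightarrow> 'l) \<Rightarrow> 'a set \<Rightarrow> 'l set" where
  "pi_hat_plus \<Lambda> X \<Omega> \<Delta> nabla V = {g \<in> carrier (sec (O_Delta X \<Omega> \<Delta>) V).
     \<forall>W p v. openin (topo X) W \<and> W \<subseteq> V \<and> vertical_field \<Lambda> X \<Omega> \<Delta> W p v \<longrightarrow>
       nabla W v (restr \<Delta> V W g) = \<zero>\<^bsub>sec \<Delta> W\<^esub>}"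

definition transform_twisted ::
  "('k, 'n) super_ring_scheme \<Rightarrow> ('a, 'f, 'k, 'm) superspace_scheme \<Rightarrow>
   ('a, 'f, 'w, 'p) forms_scheme \<Rightarrow> ('a, 'w, 'l, 'q) proj_scheme \<Rightarrow> 'w \<Rightarrow> 'a set \<Rightarrow> 'l set" where
  "transform_twisted \<Lambda> X \<Omega> \<Delta> \<omega> =
     pi_hat_plus \<Lambda> X \<Omega> \<Delta> (pullback_connection X \<Omega> \<Delta> (twisted_connection \<Omega> \<omega>))"


section \<open>First cohomology\<close>

text \<open>Cech cohomology as the colimit over open covers indexed by the points of the space, which are
  cofinal among all open covers and have canonical refinement maps. Cohomology classes are
  equivalence classes of pairs of a cover and a cocycle.\<close>

definition point_cover :: "'a topology \<Rightarrow> ('a \<Rightarrow> 'a set) \<Rightarrow> bool" where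
  "point_cover T U \<longleftrightarrow> (\<forall>x\<in>topspace T. openin T (U x) \<and> x \<in> U x)"

definition cech_Z1 ::
  "'a topology \<Rightarrow> ('a set \<Rightarrow> 'g monoid) \<Rightarrow> ('a set \<Rightarrow> 'a set \<Rightarrow> 'g \<Rightarrow> 'g) \<Rightarrow>
   (('a \<Rightarrow> 'a set) \<times> ('a \<Rightarrow> 'a \<Rightarrow> 'g)) set" where
  "cech_Z1 T F r = {(U, g). point_cover T U \<and>
     (\<forall>x\<in>topspace T. \<forall>y\<in>topspace T. g x y \<in> carrier (F (U x \<inter> U y))) \<and>
     (\<forall>x\<in>topspace T. \<forall>y\<in>topspace T. \<forall>z\<in>topspace T.
        let V = U x \<inter> U y \<inter> U z in
        r (U x \<inter> U y) V (g x y) \<otimes>\<^bsub>F V\<^esub> r (U y \<inter> U z) V (g y z) = r (U x \<inter> U z) V (g x z))}"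

definition cech_rel ::
  "'a topology \<Rightarrow> ('a set \<Rightarrow> 'g monoid) \<Rightarrow> ('a set \<Rightarrow> 'a set \<Rightarrow> 'g \<Rightarrow> 'g) \<Rightarrow>
   ((('a \<Rightarrow> 'a set) \<times> ('a \<Rightarrow> 'a \<Rightarrow> 'g)) \<times> (('a \<Rightarrow> 'a set) \<times> ('a \<Rightarrow> 'a \<Rightarrow> 'g))) set" where
  "cech_rel T F r = {((U, g), (U', g')). (U, g) \<in> cech_Z1 T F r \<and> (U', g') \<in> cech_Z1 T F r \<and>
     (\<exists>W f. point_cover T W \<and>
        (\<forall>x\<in>topspace T. W x \<subseteq> U x \<inter> U' x \<and> f x \<in> carrier (F (W x))) \<and>
        (\<forall>x\<in>topspace T. \<forall>y\<in>topspace T. let V = W x \<inter> W y in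
           r (U' x \<inter> U' y) V (g' x y) \<otimes>\<^bsub>F V\<^esub> r (W y) V (f y) =
           r (W x) V (f x) \<otimes>\<^bsub>F V\<^esub> r (U x \<inter> U y) V (g x y)))}"

definition cech_H1 ::
  "'a topology \<Rightarrow> ('a set \<Rightarrow> 'g monoid) \<Rightarrow> ('a set \<Rightarrow> 'a set \<Rightarrow> 'g \<Rightarrow> 'g) \<Rightarrow>
   (('a \<Rightarrow> 'a set) \<times> ('a \<Rightarrow> 'a \<Rightarrow> 'g)) set set" where
  "cech_H1 T F r = cech_Z1 T F r // cech_rel T F r"

definition cech_class ::
  "'a topology \<Rightarrow> ('a set \<Rightarrow> 'g monoid) \<Rightarrow> ('a set \<Rightarrow> 'a set \<Rightarrow> 'g \<Rightarrow> 'g) \<Rightarrow>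
   ('a \<Rightarrow> 'a set) \<Rightarrow> ('a \<Rightarrow> 'a \<Rightarrow> 'g) \<Rightarrow> (('a \<Rightarrow> 'a set) \<times> ('a \<Rightarrow> 'a \<Rightarrow> 'g)) set" where
  "cech_class T F r U g = cech_rel T F r `` {(U, g)}"

text \<open>On a supercurve or its dual the order of nilpotency of nilpotent sections is bounded, so the
  nilpotent sections form a sheaf.\<close>

definition even_nilpotents :: "('f, 'm) super_ring_scheme \<Rightarrow> 'f monoid" where
  "even_nilpotents R = \<lparr>carrier = nilpotents R \<inter> homog R False, mult = (\<oplus>\<^bsub>R\<^esub>), one = \<zero>\<^bsub>R\<^esub>\<rparr>"

definition even_units :: "('f, 'm) super_ring_scheme \<Rightarrow> 'f monoid" where
  "even_units R = \<lparr>carrier = Units R \<inter> homog R False, mult = (\<otimes>\<^bsub>R\<^esub>), one = \<one>\<^bsub>R\<^esub>\<rparr>"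

abbreviation nilpotent_class ::
  "('a, 'l, 'k, 'm) superspace_scheme \<Rightarrow> ('a \<Rightarrow> 'a set) \<Rightarrow> ('a \<Rightarrow> 'a \<Rightarrow> 'l) \<Rightarrow>
   (('a \<Rightarrow> 'a set) \<times> ('a \<Rightarrow> 'a \<Rightarrow> 'l)) set" where
  "nilpotent_class Y \<equiv> cech_class (topo Y) (\<lambda>U. even_nilpotents (sec Y U)) (restr Y)"

abbreviation unit_class ::
  "('a, 'l, 'k, 'm) superspace_scheme \<Rightarrow> ('a \<Rightarrow> 'a set) \<Rightarrow> ('a \<Rightarrow> 'a \<Rightarrow> 'l) \<Rightarrow>
   (('a \<Rightarrow> 'a set) \<times> ('a \<Rightarrow> 'a \<Rightarrow> 'l)) set" where
  "unit_class Y \<equiv> cech_class (topo Y) (\<lambda>U. even_units (sec Y U)) (restr Y)"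

definition connecting ::
  "('a, 'f, 'k, 'm) superspace_scheme \<Rightarrow> ('a, 'f, 'w, 'p) forms_scheme \<Rightarrow>
   ('a, 'w, 'l, 'q) proj_scheme \<Rightarrow> 'w \<Rightarrow> (('a \<Rightarrow> 'a set) \<times> ('a \<Rightarrow> 'a \<Rightarrow> 'l)) set" where
  "connecting X \<Omega> \<Delta> \<omega> = (THE c. \<exists>U h. point_cover (topo X) U \<and>
     (\<forall>x\<in>topspace (topo X). h x \<in> carrier (even_nilpotents (sec (O_Delta X \<Omega> \<Delta>) (U x))) \<and>
        dtilde \<Delta> (U x) (h x) = localize \<Delta> (U x) (restr \<Omega> (topspace (topo X)) (U x) \<omega>)) \<and>
     c = nilpotent_class (dual_curve X \<Omega> \<Delta>) U (\<lambda>x y.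
           restr \<Delta> (U y) (U x \<inter> U y) (h y) \<ominus>\<^bsub>sec \<Delta> (U x \<inter> U y)\<^esub>
           restr \<Delta> (U x) (U x \<inter> U y) (h x)))"

definition nil_exp ::
  "(complex \<Rightarrow> 'k) \<Rightarrow> ('a, 'l, 'k, 'm) superspace_scheme \<Rightarrow> 'a set \<Rightarrow> 'l \<Rightarrow> 'l" where
  "nil_exp \<iota> Y U s = finsum (sec Y U)
     (\<lambda>k. cst Y U (\<iota> (1 / fact k)) \<otimes>\<^bsub>sec Y U\<^esub> (s [^]\<^bsub>sec Y U\<^esub> k))
     {..<(LEAST n::nat. s [^]\<^bsub>sec Y U\<^esub> n = \<zero>\<^bsub>sec Y U\<^esub>)}"

definition H1_exp ::
  "(complex \<Rightarrow> 'k) \<Rightarrow> ('a, 'l, 'k, 'm) superspace_scheme \<Rightarrow>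
   (('a \<Rightarrow> 'a set) \<times> ('a \<Rightarrow> 'a \<Rightarrow> 'l)) set \<Rightarrow> (('a \<Rightarrow> 'a set) \<times> ('a \<Rightarrow> 'a \<Rightarrow> 'l)) set" where
  "H1_exp \<iota> Y c = (THE c'. \<exists>U g. (U, g) \<in> c \<and>
     c' = unit_class Y U (\<lambda>x y. nil_exp \<iota> Y (U x \<inter> U y) (g x y)))"


section \<open>Line bundles\<close>

text \<open>Line bundles (of rank \<open>1|0\<close>) given as a subsheaf \<open>M\<close> of modules in a sheaf \<open>A\<close> of rings
  containing the structure sheaf of \<open>Y\<close>, as is the case for the transform of a line bundle.\<close>

definition submodule_sheaf ::
  "('a, 'l, 'k, 'm) superspace_scheme \<Rightarrow> ('a, 'l, 'p) ssheaf_scheme \<Rightarrow> ('a set \<Rightarrow> 'l set) \<Rightarrow> bool" where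
  "submodule_sheaf Y A M \<longleftrightarrow>
     (\<forall>V. openin (topo Y) V \<longrightarrow> subgroup (M V) (add_monoid (sec A V)) \<and>
        (\<forall>a\<in>carrier (sec Y V). \<forall>m\<in>M V. a \<otimes>\<^bsub>sec A V\<^esub> m \<in> M V) \<and>
        (\<forall>a\<in>homog (sec A V) False. \<forall>b\<in>homog (sec A V) True.
           a \<oplus>\<^bsub>sec A V\<^esub> b \<in> M V \<longrightarrow> a \<in> M V \<and> b \<in> M V)) \<and>
     (\<forall>V W. openin (topo Y) V \<and> openin (topo Y) W \<and> W \<subseteq> V \<longrightarrow> restr A V W ` M V \<subseteq> M W) \<and>
     gluing (topo Y) M (restr A)"

definition trivialization ::
  "('a, 'l, 'k, 'm) superspace_scheme \<Rightarrow> ('a, 'l, 'p) ssheaf_scheme \<Rightarrow> ('a set \<Rightarrow> 'l set) \<Rightarrow>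
   'a set \<Rightarrow> 'l \<Rightarrow> bool" where
  "trivialization Y A M U \<phi> \<longleftrightarrow> \<phi> \<in> M U \<inter> homog (sec A U) False \<and>
     (\<forall>V. openin (topo Y) V \<and> V \<subseteq> U \<longrightarrow>
        (\<forall>m\<in>M V. \<exists>!a. a \<in> carrier (sec Y V) \<and> m = a \<otimes>\<^bsub>sec A V\<^esub> restr A U V \<phi>))"

definition line_bundle ::
  "('a, 'l, 'k, 'm) superspace_scheme \<Rightarrow> ('a, 'l, 'p) ssheaf_scheme \<Rightarrow> ('a set \<Rightarrow> 'l set) \<Rightarrow> bool" where
  "line_bundle Y A M \<longleftrightarrow> submodule_sheaf Y A M \<and>
     (\<forall>x\<in>topspace (topo Y). \<exists>U \<phi>. openin (topo Y) U \<and> x \<in> U \<and> trivialization Y A M U \<phi>)"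

definition line_bundle_class ::
  "('a, 'l, 'k, 'm) superspace_scheme \<Rightarrow> ('a, 'l, 'p) ssheaf_scheme \<Rightarrow> ('a set \<Rightarrow> 'l set) \<Rightarrow>
   (('a \<Rightarrow> 'a set) \<times> ('a \<Rightarrow> 'a \<Rightarrow> 'l)) set" where
  "line_bundle_class Y A M = (THE c. \<exists>U \<phi> g. point_cover (topo Y) U \<and>
     (\<forall>x\<in>topspace (topo Y). trivialization Y A M (U x) (\<phi> x)) \<and>
     (\<forall>x\<in>topspace (topo Y). \<forall>y\<in>topspace (topo Y). let V = U x \<inter> U y in
        g x y \<in> carrier (even_units (sec Y V)) \<and>
        restr A (U x) V (\<phi> x) = g x y \<otimes>\<^bsub>sec A V\<^esub> restr A (U y) V (\<phi> y)) \<and>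
     c = unit_class Y U g)"

end

theory Submission
  imports Defs "HOL-Algebra.UnivPoly"
begin

text \<open>Write \<open>d~\<close> for the odd derivation from \<open>\<O>\<^sub>\<Delta>\<close> to \<open>\<O>\<^sub>\<Delta>(1)\<close> and \<open>\<omega>\<close> also for the pullback of the one-form to \<open>\<Delta>\<close>, an
  odd section of \<open>\<O>\<^sub>\<Delta>(1)\<close>. Functions with \<open>d~ s = 0\<close> are called closed; they are the functions on the dual curve.

  Local coordinates \<open>(z, \<theta>)\<close> give an odd function \<open>t = \<theta>\<close> on \<open>\<Delta>\<close> such that \<open>d~ t\<close> is invertible, with inverse
  \<open>u\<close> of degree \<open>-1\<close> (\<open>coordinates_chart\<close>), and \<open>d~\<^sup>2 = 0\<close> there. So \<open>\<partial> = u d~\<close> is an odd derivation of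
  \<open>\<O>\<^sub>\<Delta>\<close> with \<open>\<partial>\<^sup>2 = 0\<close> and \<open>\<partial> t = 1\<close>, and \<open>g = (g - t \<partial> g) + t \<partial> g\<close> shows that \<open>\<O>\<^sub>\<Delta>\<close> is generated by
  \<open>t\<close> over the closed functions. Two things follow.

  First, a vector field \<open>v\<close> that kills the closed functions is determined by \<open>v t\<close>: it is \<open>a d~\<close> for a section
  \<open>a\<close> of \<open>\<O>\<^sub>\<Delta>(-1)\<close> (\<open>vertical_field_factor\<close>). Its contraction with \<open>\<omega>\<close> is \<open>a \<omega>\<close>, so \<open>\<nabla>\<^sub>v g = a (d~ g + \<omega> g)\<close>,
  and the transform is the sheaf of solutions of \<open>d~ g + \<omega> g = 0\<close> (\<open>transform_eq\<close>).

  Second, as \<open>\<omega>\<close> is closed, \<open>h = t u \<omega>\<close> satisfies \<open>d~ h = \<omega>\<close>. It is even, and \<open>h\<^sup>2 = 0\<close> because \<open>t\<close> and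
  \<open>u \<omega>\<close> are odd. Hence \<open>exp (-h) = 1 - h\<close> is an invertible solution, and multiplication by it is an isomorphism from
  the closed functions onto the transform (\<open>primitive_trivialization\<close>).

  Choose such an \<open>h\<^sub>x\<close> near each point \<open>x\<close>. The transition functions of the trivializations \<open>exp (-h\<^sub>x)\<close> are
  \<open>exp (h\<^sub>y - h\<^sub>x)\<close>, and the closed functions \<open>h\<^sub>y - h\<^sub>x\<close> are the cocycle that defines the image of \<open>\<omega>\<close> under the
  connecting homomorphism. This is the theorem (\<open>transform_class\<close>), once the three cohomology classes in it are known
  to be independent of the choices: two families of primitives differ by closed functions
  (\<open>difference_cohomologous\<close>), two trivializations by an even unit of the dual curve
  (\<open>transition_cohomologous\<close>), and the exponential maps sums of even nilpotent functions to products and so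
  respects cohomologous cocycles (\<open>H1_exp_class\<close>).\<close>

section \<open>The exponential series of nilpotent elements\<close>

lemma ex1_eq: "\<exists>!x. P x \<Longrightarrow> P a \<Longrightarrow> P b \<Longrightarrow> a = b"
  by blast

lemma ring_hom_zero_neg:
  assumes "ring R" "ring S" "h \<in> ring_hom R S"
  shows "h \<zero>\<^bsub>R\<^esub> = \<zero>\<^bsub>S\<^esub>" "x \<in> carrier R \<Longrightarrow> h (\<ominus>\<^bsub>R\<^esub> x) = \<ominus>\<^bsub>S\<^esub> h x"
proof -
  interpret R: ring R by fact
  interpret S: ring S by fact
  have "h \<zero>\<^bsub>R\<^esub> \<oplus>\<^bsub>S\<^esub> h \<zero>\<^bsub>R\<^esub> = h \<zero>\<^bsub>R\<^esub>"
    using ring_hom_add[OF assms(3), of "\<zero>\<^bsub>R\<^esub>" "\<zero>\<^bsub>R\<^esub>"] by simp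
  then show z: "h \<zero>\<^bsub>R\<^esub> = \<zero>\<^bsub>S\<^esub>"
    using S.add.l_cancel_one[of "h \<zero>\<^bsub>R\<^esub>" "h \<zero>\<^bsub>R\<^esub>"] ring_hom_closed[OF assms(3)] by simp
  assume x: "x \<in> carrier R"
  have "h (\<ominus>\<^bsub>R\<^esub> x) \<oplus>\<^bsub>S\<^esub> h x = \<zero>\<^bsub>S\<^esub>"
    using ring_hom_add[OF assms(3), of "\<ominus>\<^bsub>R\<^esub> x" x] x z by (simp add: R.l_neg)
  then show "h (\<ominus>\<^bsub>R\<^esub> x) = \<ominus>\<^bsub>S\<^esub> h x"
    using S.minus_equality[of "h (\<ominus>\<^bsub>R\<^esub> x)" "h x"] ring_hom_closed[OF assms(3)] x by simp
qed

lemma (in ring) minus_telescope: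
  assumes "a \<in> carrier R" "b \<in> carrier R" "d \<in> carrier R"
  shows "(b \<ominus> a) \<oplus> (d \<ominus> b) = d \<ominus> a"
proof -
  have "(b \<ominus> a) \<oplus> (d \<ominus> b) = (b \<oplus> \<ominus> b) \<oplus> (d \<oplus> \<ominus> a)"
    using assms by (simp add: minus_eq a_ac)
  then show ?thesis
    using assms by (simp add: r_neg minus_eq)
qed

locale complex_algebra = ring R for R (structure) +
  fixes c :: "complex \<Rightarrow> _"
  assumes scalar_hom: "c \<in> ring_hom complex_ring R"
    and scalar_central: "x \<in> carrier R \<Longrightarrow> c a \<otimes> x = x \<otimes> c a"
begin

lemma scalar_closed [simp, intro]: "c a \<in> carrier R"
  using scalar_hom by (auto simp: ring_hom_def complex_ring_def)

lemma scalar_mult: "c (a * b) = c a \<otimes> c b"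
  using scalar_hom by (auto simp: ring_hom_def complex_ring_def)

lemma scalar_add: "c (a + b) = c a \<oplus> c b"
  using scalar_hom by (auto simp: ring_hom_def complex_ring_def)

lemma scalar_one [simp]: "c 1 = \<one>"
  using scalar_hom by (auto simp: ring_hom_def complex_ring_def)

lemma scalar_zero [simp]: "c 0 = \<zero>"
proof -
  have "c 0 \<oplus> c 0 = c 0"
    using scalar_add[of 0 0] by simp
  then show ?thesis
    using add.l_cancel_one[of "c 0" "c 0"] by simp
qed

lemma scalar_left_commute:
  assumes "x \<in> carrier R" "y \<in> carrier R"
  shows "x \<otimes> (c a \<otimes> y) = c a \<otimes> (x \<otimes> y)"
proof -
  have "x \<otimes> (c a \<otimes> y) = (x \<otimes> c a) \<otimes> y"
    using assms by (simp add: m_assoc)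
  also have "\<dots> = c a \<otimes> (x \<otimes> y)"
    unfolding scalar_central[OF assms(1), symmetric] using assms by (intro m_assoc) auto
  finally show ?thesis .
qed

lemma scalar_cancel:
  assumes "a \<noteq> 0" "c a \<otimes> x = c a \<otimes> y" "x \<in> carrier R" "y \<in> carrier R"
  shows "x = y"
proof -
  have "c (1 / a) \<otimes> (c a \<otimes> z) = z" if "z \<in> carrier R" for z
    unfolding m_assoc[OF scalar_closed scalar_closed that, symmetric] scalar_mult[symmetric]
    using assms(1) that by simp
  then show ?thesis
    using assms(2-4) by metis
qed

text \<open>This is what makes squares of odd elements vanish: anticommutativity alone gives only \<open>2 x\<^sup>2 = 0\<close>.\<close>

lemma eq_neg_self_imp_zero:
  assumes "x = \<ominus> x" "x \<in> carrier R"
  shows "x = \<zero>"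
proof -
  have "c 2 \<otimes> x = x \<oplus> x"
    using scalar_add[of 1 1] assms(2) by (simp add: l_distr)
  also have "x \<oplus> x = x \<oplus> \<ominus> x"
    by (rule arg_cong[OF assms(1), of "\<lambda>y. x \<oplus> y"])
  also have "\<dots> = c 2 \<otimes> \<zero>"
    using assms(2) by (simp add: r_neg)
  finally show ?thesis
    using assms(2) by (auto intro: scalar_cancel[of 2])
qed

definition exp_term :: "nat \<Rightarrow> 'a \<Rightarrow> 'a" where
  "exp_term k s = c (1 / fact k) \<otimes> (s [^] k)"

lemma exp_term_closed [simp, intro]: "s \<in> carrier R \<Longrightarrow> exp_term k s \<in> carrier R"
  by (simp add: exp_term_def)

lemma exp_term_0 [simp]: "exp_term 0 s = \<one>"
  by (simp add: exp_term_def)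

lemma exp_term_Suc:
  assumes "s \<in> carrier R"
  shows "c (of_nat (Suc k)) \<otimes> exp_term (Suc k) s = s \<otimes> exp_term k s"
proof -
  have q: "of_nat (Suc k) * (1 / fact (Suc k)) = (1 / fact k :: complex)"
    by (simp del: of_nat_Suc)
  have "c (of_nat (Suc k)) \<otimes> exp_term (Suc k) s
      = c (of_nat (Suc k) * (1 / fact (Suc k))) \<otimes> (s [^] Suc k)"
    unfolding exp_term_def scalar_mult using assms by (intro m_assoc[symmetric]) auto
  also have "\<dots> = c (1 / fact k) \<otimes> (s \<otimes> s [^] k)"
    unfolding q nat_pow_Suc2[OF assms] ..
  also have "\<dots> = s \<otimes> exp_term k s"
    unfolding exp_term_def using assms by (simp add: scalar_left_commute)
  finally show ?thesis .
qed

lemma exp_term_commute: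
  assumes "a \<in> carrier R" "b \<in> carrier R" "a \<otimes> b = b \<otimes> a"
  shows "exp_term k a \<otimes> b = b \<otimes> exp_term k a"
proof -
  have "(a [^] k) \<otimes> b = b \<otimes> (a [^] k)" for k :: nat
  proof (induction k)
    case (Suc k)
    have "a [^] Suc k \<otimes> b = a [^] k \<otimes> (b \<otimes> a)"
      using assms by (simp add: m_assoc)
    also have "\<dots> = b \<otimes> a [^] Suc k"
      using Suc assms by (simp flip: m_assoc)
    finally show ?case .
  qed (use assms in simp)
  then show ?thesis
    using assms by (simp add: exp_term_def m_assoc scalar_left_commute)
qed

text \<open>The binomial theorem in the form in which the coefficients are absorbed by the factorials. Both
  sides \<open>E\<^sub>n\<close> satisfy \<open>(n + 1) E\<^bsub>n+1\<^esub> = (a + b) E\<^sub>n\<close>: on the right, split the factor \<open>n + 1\<close> of the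
  \<open>i\<close>-th summand as \<open>i + (n + 1 - i)\<close>.\<close>

lemma exp_term_add:
  assumes a: "a \<in> carrier R" and b: "b \<in> carrier R" and comm: "a \<otimes> b = b \<otimes> a"
  shows "exp_term n (a \<oplus> b) = (\<Oplus>i\<in>{..n}. exp_term i a \<otimes> exp_term (n - i) b)"
proof (induction n)
  case 0
  then show ?case by (simp add: a b)
next
  case (Suc n)
  let ?E = "\<lambda>n. \<Oplus>i\<in>{..n}. exp_term i a \<otimes> exp_term (n - i) b"
  let ?F = "\<lambda>i. exp_term i a \<otimes> exp_term (Suc n - i) b"
  let ?L = "\<lambda>i. (c (of_nat i) \<otimes> exp_term i a) \<otimes> exp_term (Suc n - i) b"
  let ?M = "\<lambda>i. exp_term i a \<otimes> (c (of_nat (Suc n - i)) \<otimes> exp_term (Suc n - i) b)"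
  have E: "?E n \<in> carrier R" "?E (Suc n) \<in> carrier R"
    by (auto intro!: finsum_closed simp: a b)
  have split: "c (of_nat (Suc n)) \<otimes> ?F i = ?L i \<oplus> ?M i" if "i \<le> Suc n" for i
  proof -
    have "of_nat (Suc n) = (of_nat i + of_nat (Suc n - i) :: complex)"
      using that by (metis le_add_diff_inverse of_nat_add)
    then have "c (of_nat (Suc n)) \<otimes> ?F i = c (of_nat i) \<otimes> ?F i \<oplus> c (of_nat (Suc n - i)) \<otimes> ?F i"
      by (simp add: scalar_add l_distr a b)
    also have "c (of_nat (Suc n - i)) \<otimes> ?F i = ?M i"
      by (simp add: a b scalar_left_commute)
    finally show ?thesis by (simp add: m_assoc a b)
  qed
  have L: "(\<Oplus>i\<in>{..Suc n}. ?L i) = a \<otimes> ?E n"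
  proof -
    have "(\<Oplus>i\<in>{..Suc n}. ?L i) = (\<Oplus>i\<in>{..n}. ?L (Suc i)) \<oplus> ?L 0"
      by (rule finsum_Suc2) (auto simp: a b)
    also have "?L 0 = \<zero>"
      by (simp add: a b)
    also have "(\<Oplus>i\<in>{..n}. ?L (Suc i)) = (\<Oplus>i\<in>{..n}. a \<otimes> (exp_term i a \<otimes> exp_term (n - i) b))"
      unfolding exp_term_Suc[OF a] by (intro finsum_cong') (auto simp: a b m_assoc)
    finally show ?thesis
      by (simp add: a b finsum_rdistr)
  qed
  have M: "(\<Oplus>i\<in>{..Suc n}. ?M i) = b \<otimes> ?E n"
  proof -
    have *: "?M i = b \<otimes> (exp_term i a \<otimes> exp_term (n - i) b)" if "i \<le> n" for i
    proof -
      have "Suc n - i = Suc (n - i)" using that by simp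
      then have "?M i = exp_term i a \<otimes> (b \<otimes> exp_term (n - i) b)"
        using exp_term_Suc[OF b, of "n - i"] by simp
      also have "\<dots> = b \<otimes> (exp_term i a \<otimes> exp_term (n - i) b)"
        using exp_term_commute[OF a b comm, of i] by (simp add: a b flip: m_assoc)
      finally show ?thesis .
    qed
    have "(\<Oplus>i\<in>{..Suc n}. ?M i) = ?M (Suc n) \<oplus> (\<Oplus>i\<in>{..n}. ?M i)"
      by (rule finsum_Suc) (auto simp: a b)
    also have "?M (Suc n) = \<zero>"
      by (simp add: a b)
    also have "(\<Oplus>i\<in>{..n}. ?M i) = (\<Oplus>i\<in>{..n}. b \<otimes> (exp_term i a \<otimes> exp_term (n - i) b))"
      by (intro finsum_cong') (use * in \<open>auto simp: a b\<close>)
    finally show ?thesis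
      by (simp add: a b finsum_rdistr)
  qed
  have "c (of_nat (Suc n)) \<otimes> ?E (Suc n) = (\<Oplus>i\<in>{..Suc n}. c (of_nat (Suc n)) \<otimes> ?F i)"
    by (rule finsum_rdistr) (auto simp: a b)
  also have "\<dots> = (\<Oplus>i\<in>{..Suc n}. ?L i \<oplus> ?M i)"
    by (intro finsum_cong') (use split in \<open>auto simp: a b\<close>)
  also have "\<dots> = (\<Oplus>i\<in>{..Suc n}. ?L i) \<oplus> (\<Oplus>i\<in>{..Suc n}. ?M i)"
    by (rule finsum_addf) (auto simp: a b)
  also have "\<dots> = (a \<oplus> b) \<otimes> exp_term n (a \<oplus> b)"
    using E by (simp add: L M Suc.IH l_distr a b)
  also have "\<dots> = c (of_nat (Suc n)) \<otimes> exp_term (Suc n) (a \<oplus> b)"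
    by (simp only: exp_term_Suc[OF a_closed[OF a b]])
  finally have "c (of_nat (Suc n)) \<otimes> exp_term (Suc n) (a \<oplus> b) = c (of_nat (Suc n)) \<otimes> ?E (Suc n)" ..
  then show ?case
    using E a b by (auto simp del: of_nat_Suc intro: scalar_cancel[of "of_nat (Suc n)"])
qed

lemma pow_zero_mono:
  assumes "s [^] (n :: nat) = \<zero>" "n \<le> k" "s \<in> carrier R"
  shows "s [^] k = \<zero>"
  using nat_pow_mult[of s n "k - n"] assms by simp

text \<open>With this the order of nilpotency of a sum can be bounded by looking at the terms of its exponential.\<close>

lemma exp_term_eq_zero_iff:
  assumes "s \<in> carrier R"
  shows "exp_term k s = \<zero> \<longleftrightarrow> s [^] k = \<zero>"
  using assms scalar_cancel[of "1 / fact k" "s [^] k" \<zero>] by (auto simp: exp_term_def)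

lemma exp_term_zero_mono: "s [^] (n :: nat) = \<zero> \<Longrightarrow> n \<le> k \<Longrightarrow> s \<in> carrier R \<Longrightarrow> exp_term k s = \<zero>"
  using pow_zero_mono[of s n k] exp_term_eq_zero_iff[of s k] by simp

text \<open>The series is cut off at the least exponent that kills \<open>s\<close>, as in \<^const>\<open>nil_exp\<close>. Any larger range gives the same
  value.\<close>

definition nexp :: "'a \<Rightarrow> 'a" where
  "nexp s = (\<Oplus>k\<in>{..<(LEAST n::nat. s [^] n = \<zero>)}. exp_term k s)"

lemma nexp_eq:
  assumes "s \<in> carrier R" "s [^] (n :: nat) = \<zero>" "n \<le> m"
  shows "nexp s = (\<Oplus>k\<in>{..<m}. exp_term k s)"
proof -
  let ?l = "LEAST n::nat. s [^] n = \<zero>"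
  have l: "s [^] ?l = \<zero>" "?l \<le> n"
    using assms(2) by (auto intro: LeastI Least_le)
  show ?thesis
    unfolding nexp_def using assms l exp_term_zero_mono[OF l(1)]
    by (intro add.finprod_mono_neutral_cong_left) auto
qed

lemma nexp_eq_atMost:
  assumes "s \<in> carrier R" "s [^] (n :: nat) = \<zero>"
  shows "nexp s = (\<Oplus>k\<in>{..n}. exp_term k s)"
  using nexp_eq[OF assms, of "Suc n"] by (simp add: lessThan_Suc_atMost)

text \<open>If \<open>a\<^sup>n = 0\<close> and \<open>b\<^sup>m = 0\<close>, then in each summand of the term of order \<open>n + m\<close> of \<open>exp (a + b)\<close> one of the two
  factors vanishes; so that term is zero and \<open>a + b\<close> is nilpotent. The exponentials multiply by the Cauchy product of
  finite sums.\<close>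

lemma nilpotents_add:
  assumes "a \<in> nilpotents R" "b \<in> nilpotents R" and comm: "a \<otimes> b = b \<otimes> a"
  shows "a \<oplus> b \<in> nilpotents R" "nexp (a \<oplus> b) = nexp a \<otimes> nexp b"
proof -
  from assms obtain n m :: nat where a: "a \<in> carrier R" "a [^] n = \<zero>"
    and b: "b \<in> carrier R" "b [^] m = \<zero>"
    by (auto simp: nilpotents_def)
  have z: "exp_term i a \<otimes> exp_term (n + m - i) b = \<zero>" if "i \<le> n + m" for i
  proof (cases "n \<le> i")
    case True
    then show ?thesis using exp_term_zero_mono[OF a(2) True a(1)] b by simp
  next
    case False
    then show ?thesis using exp_term_zero_mono[OF b(2) _ b(1), of "n + m - i"] a by simp
  qed
  have "exp_term (n + m) (a \<oplus> b) = \<zero>"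
    unfolding exp_term_add[OF a(1) b(1) comm] by (intro add.finprod_one_eqI) (simp add: z)
  then have nm: "(a \<oplus> b) [^] (n + m) = \<zero>"
    using a b exp_term_eq_zero_iff by simp
  then show "a \<oplus> b \<in> nilpotents R"
    using a b unfolding nilpotents_def by blast
  have "nexp (a \<oplus> b) = (\<Oplus>k\<in>{..n + m}. \<Oplus>i\<in>{..k}. exp_term i a \<otimes> exp_term (k - i) b)"
    using a b nm by (simp add: nexp_eq_atMost exp_term_add[OF _ _ comm])
  also have "\<dots> = (\<Oplus>k\<in>{..n}. exp_term k a) \<otimes> (\<Oplus>k\<in>{..m}. exp_term k b)"
    using exp_term_zero_mono[OF a(2) _ a(1)] exp_term_zero_mono[OF b(2) _ b(1)] a b
    by (intro cauchy_product) auto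
  also have "\<dots> = nexp a \<otimes> nexp b"
    using a b by (simp add: nexp_eq_atMost)
  finally show "nexp (a \<oplus> b) = nexp a \<otimes> nexp b" .
qed

lemma nilpotents_neg:
  assumes "a \<in> nilpotents R"
  shows "\<ominus> a \<in> nilpotents R"
proof -
  from assms obtain n :: nat where a: "a \<in> carrier R" "a [^] n = \<zero>"
    by (auto simp: nilpotents_def)
  have "(\<ominus> a) [^] k = a [^] k \<or> (\<ominus> a) [^] k = \<ominus> (a [^] k)" for k :: nat
    by (induction k) (use a in \<open>auto simp: l_minus r_minus\<close>)
  from this[of n] show ?thesis
    using a by (auto simp: nilpotents_def intro: exI[of _ n])
qed

lemma nexp_closed: "s \<in> carrier R \<Longrightarrow> nexp s \<in> carrier R"
  unfolding nexp_def by (auto intro!: finsum_closed)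

lemma nexp_square_zero:
  assumes "s \<in> carrier R" "s \<otimes> s = \<zero>"
  shows "nexp s = \<one> \<oplus> s" "s \<in> nilpotents R"
proof -
  have s2: "s [^] (2::nat) = \<zero>"
    using assms by (simp add: numeral_2_eq_2)
  then show "s \<in> nilpotents R"
    using assms unfolding nilpotents_def by blast
  show "nexp s = \<one> \<oplus> s"
    using nexp_eq[OF assms(1) s2 order_refl] assms
    by (simp add: numeral_2_eq_2 lessThan_Suc a_comm exp_term_def)
qed

lemma nilpotents_zero: "\<zero> \<in> nilpotents R"
  by (rule nexp_square_zero) auto

lemma nexp_zero: "nexp \<zero> = \<one>"
  using nexp_square_zero(1)[of \<zero>] by simp

lemma nexp_mult_neg:
  assumes "a \<in> nilpotents R"
  shows "nexp a \<otimes> nexp (\<ominus> a) = \<one>"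
proof -
  have "a \<in> carrier R" using assms by (simp add: nilpotents_def)
  then show ?thesis
    using nilpotents_add(2)[OF assms nilpotents_neg[OF assms]]
    by (simp add: r_neg nexp_zero l_minus r_minus)
qed

end

lemma ring_hom_finsum:
  assumes "ring R" "ring S" "h \<in> ring_hom R S" "finite A" "f \<in> A \<rightarrow> carrier R"
  shows "h (finsum R f A) = finsum S (\<lambda>i. h (f i)) A"
proof -
  interpret R: ring R by fact
  interpret S: ring S by fact
  show ?thesis
    using assms(4,5)
  proof (induction A)
    case empty
    then show ?case
      using ring_hom_zero_neg(1)[OF assms(1-3)] by simp
  next
    case (insert x A)
    then have "h (finsum R f (insert x A)) = h (f x) \<oplus>\<^bsub>S\<^esub> h (finsum R f A)"
      using ring_hom_add[OF assms(3), of "f x" "finsum R f A"] R.finsum_insert[of A x f] by auto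
    also have "\<dots> = finsum S (\<lambda>i. h (f i)) (insert x A)"
      using insert ring_hom_closed[OF assms(3)] by (subst S.finsum_insert) auto
    finally show ?case .
  qed
qed

lemma ring_hom_nat_pow:
  assumes "ring R" "h \<in> ring_hom R S" "x \<in> carrier R"
  shows "h (x [^]\<^bsub>R\<^esub> (n::nat)) = h x [^]\<^bsub>S\<^esub> n"
proof -
  interpret R: ring R by fact
  show ?thesis
    using ring_hom_mult[OF assms(2)] ring_hom_one[OF assms(2)] assms(3) by (induction n) auto
qed

text \<open>Naturality of the exponential; it is applied to restriction maps.\<close>

lemma ring_hom_nexp:
  assumes "complex_algebra R c" "complex_algebra S c'" and h: "h \<in> ring_hom R S" "\<And>a. h (c a) = c' a"
    and s: "s \<in> nilpotents R"
  shows "h s \<in> nilpotents S" "h (complex_algebra.nexp R c s) = complex_algebra.nexp S c' (h s)"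
proof -
  interpret R: complex_algebra R c by fact
  interpret S: complex_algebra S c' by fact
  obtain n :: nat where n: "s \<in> carrier R" "s [^]\<^bsub>R\<^esub> n = \<zero>\<^bsub>R\<^esub>"
    using s by (auto simp: nilpotents_def)
  have hs: "h s \<in> carrier S"
    using ring_hom_closed[OF h(1) n(1)] .
  have hn: "h s [^]\<^bsub>S\<^esub> n = \<zero>\<^bsub>S\<^esub>"
    using ring_hom_nat_pow[OF R.ring_axioms h(1) n(1), of n] n(2)
      ring_hom_zero_neg(1)[OF R.ring_axioms S.ring_axioms h(1)] by simp
  then show "h s \<in> nilpotents S"
    using hs by (auto simp: nilpotents_def)
  have "h (R.exp_term k s) = S.exp_term k (h s)" for k
    unfolding R.exp_term_def S.exp_term_def
    using ring_hom_mult[OF h(1), of "c (1 / fact k)" "s [^]\<^bsub>R\<^esub> k"] n(1) h(2)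
      ring_hom_nat_pow[OF R.ring_axioms h(1) n(1), of k] by simp
  then show "h (R.nexp s) = S.nexp (h s)"
    unfolding R.nexp_eq[OF n order_refl] S.nexp_eq[OF hs hn order_refl]
    using ring_hom_finsum[OF R.ring_axioms S.ring_axioms h(1), of "{..<n}" "\<lambda>k. R.exp_term k s"] n(1)
    by simp
qed

section \<open>Supercommutative algebras and odd derivations\<close>

locale supercommutative_ring =
  fixes R :: "('a, 'm) super_ring_scheme" (structure)
  assumes supercomm: "supercomm_ring R"
begin

sublocale ring R
  using supercomm by (simp add: supercomm_ring_def)

lemma homog_subgroup: "subgroup (homog R p) (add_monoid R)"
  using supercomm by (simp add: supercomm_ring_def)

lemma homog_closed [simp, intro]: "x \<in> homog R p \<Longrightarrow> x \<in> carrier R"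
  using subgroup.subset[OF homog_subgroup] by auto

lemma homog_add [simp, intro]: "x \<in> homog R p \<Longrightarrow> y \<in> homog R p \<Longrightarrow> x \<oplus> y \<in> homog R p"
  using subgroup.m_closed[OF homog_subgroup] by auto

lemma homog_zero [simp, intro]: "\<zero> \<in> homog R p"
  using subgroup.one_closed[OF homog_subgroup] by auto

lemma homog_neg [simp, intro]: "x \<in> homog R p \<Longrightarrow> \<ominus> x \<in> homog R p"
  using subgroup.m_inv_closed[OF homog_subgroup] by (auto simp: a_inv_def)

lemma homog_minus [simp, intro]: "x \<in> homog R p \<Longrightarrow> y \<in> homog R p \<Longrightarrow> x \<ominus> y \<in> homog R p"
  by (auto simp: minus_eq)

lemma one_even [simp, intro]: "\<one> \<in> homog R False"
  using supercomm by (simp add: supercomm_ring_def)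

lemma homog_mult: "x \<in> homog R p \<Longrightarrow> y \<in> homog R q \<Longrightarrow> x \<otimes> y \<in> homog R (p \<noteq> q)"
  using supercomm unfolding supercomm_ring_def by blast

lemma supercommute: "x \<in> homog R p \<Longrightarrow> y \<in> homog R q \<Longrightarrow> x \<otimes> y = ssgn R (p \<and> q) (y \<otimes> x)"
  using supercomm unfolding supercomm_ring_def by blast

lemma even_mult [simp, intro]: "x \<in> homog R False \<Longrightarrow> y \<in> homog R q \<Longrightarrow> x \<otimes> y \<in> homog R q"
  using homog_mult[of x False y q] by simp

lemma odd_even_mult [simp, intro]: "x \<in> homog R True \<Longrightarrow> y \<in> homog R False \<Longrightarrow> x \<otimes> y \<in> homog R True"
  using homog_mult[of x True y False] by simp

lemma odd_odd_mult [simp, intro]: "x \<in> homog R True \<Longrightarrow> y \<in> homog R True \<Longrightarrow> x \<otimes> y \<in> homog R False"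
  using homog_mult[of x True y True] by simp

lemma odd_anticommute: "x \<in> homog R True \<Longrightarrow> y \<in> homog R True \<Longrightarrow> x \<otimes> y = \<ominus> (y \<otimes> x)"
  using supercommute[of x True y True] by (simp add: ssgn_def)

lemma parity_ex1:
  "x \<in> carrier R \<Longrightarrow> \<exists>!ab. ab \<in> homog R False \<times> homog R True \<and> x = fst ab \<oplus> snd ab"
  using supercomm unfolding supercomm_ring_def by (elim conjE) (drule (1) bspec)

lemma parity_decomposition:
  assumes "x \<in> carrier R"
  obtains a b where "a \<in> homog R False" "b \<in> homog R True" "x = a \<oplus> b"
proof -
  obtain ab where "ab \<in> homog R False \<times> homog R True" "x = fst ab \<oplus> snd ab"
    using parity_ex1[OF assms] by auto
  then show ?thesis
    using that[of "fst ab" "snd ab"] by (simp add: mem_Times_iff)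
qed

lemma parity_unique:
  assumes "a \<in> homog R False" "b \<in> homog R True" "a' \<in> homog R False" "b' \<in> homog R True"
    and "a \<oplus> b = a' \<oplus> b'"
  shows "a = a'" "b = b'"
proof -
  have "\<exists>!ab. ab \<in> homog R False \<times> homog R True \<and> a \<oplus> b = fst ab \<oplus> snd ab"
    using assms(1,2) by (intro parity_ex1) auto
  moreover have "(a, b) \<in> homog R False \<times> homog R True \<and> a \<oplus> b = fst (a, b) \<oplus> snd (a, b)"
    using assms(1,2) by simp
  moreover have "(a', b') \<in> homog R False \<times> homog R True \<and> a \<oplus> b = fst (a', b') \<oplus> snd (a', b')"
    using assms by simp
  ultimately have "(a, b) = (a', b')"
    by blast
  then show "a = a'" "b = b'" by auto
qed

lemma parity_zero:
  assumes "a \<in> homog R p" "b \<in> homog R (\<not> p)" "a \<oplus> b = \<zero>"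
  shows "a = \<zero>" "b = \<zero>"
proof -
  have "a = \<zero> \<and> b = \<zero>"
  proof (cases p)
    case True
    then show ?thesis
      using parity_unique[of b a \<zero> \<zero>] assms a_comm[of b a] by simp
  next
    case False
    then show ?thesis
      using parity_unique[of a b \<zero> \<zero>] assms by simp
  qed
  then show "a = \<zero>" "b = \<zero>" by auto
qed

lemma even_central:
  assumes "x \<in> homog R False" "y \<in> carrier R"
  shows "x \<otimes> y = y \<otimes> x"
proof -
  obtain a b where "a \<in> homog R False" "b \<in> homog R True" "y = a \<oplus> b"
    using parity_decomposition[OF assms(2)] .
  moreover have "x \<otimes> a = a \<otimes> x" "x \<otimes> b = b \<otimes> x"
    using calculation assms supercommute[of x False a False] supercommute[of x False b True]
    by (auto simp: ssgn_def)
  ultimately show ?thesis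
    using assms by (simp add: l_distr r_distr)
qed

lemma even_left_commute:
  assumes "x \<in> homog R False" "y \<in> carrier R" "z \<in> carrier R"
  shows "y \<otimes> (x \<otimes> z) = x \<otimes> (y \<otimes> z)"
  using assms m_assoc[of y x z] m_assoc[of x y z] even_central[OF assms(1,2)] by simp

text \<open>If \<open>a + b\<close> with \<open>a\<close> even and \<open>b\<close> odd is inverse to the even element \<open>x\<close>, then \<open>x b\<close> is the odd part of \<open>1\<close> and
  so vanishes.\<close>

lemma even_inverse:
  assumes "x \<in> homog R False" "y \<in> carrier R" "x \<otimes> y = \<one>"
  shows "y \<in> homog R False" "y \<otimes> x = \<one>" "x \<in> Units R"
proof -
  show yx: "y \<otimes> x = \<one>"
    using assms even_central by metis
  then show "x \<in> Units R"
    using assms by (auto simp: Units_def)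
  obtain a b where ab: "a \<in> homog R False" "b \<in> homog R True" "y = a \<oplus> b"
    using parity_decomposition[OF assms(2)] .
  have "x \<otimes> a \<oplus> x \<otimes> b = \<one> \<oplus> \<zero>"
    using assms ab by (simp add: r_distr)
  then have "x \<otimes> b = \<zero>"
    using assms(1) ab by (intro parity_unique[of "x \<otimes> a" "x \<otimes> b" \<one> \<zero>]) auto
  then have "(y \<otimes> x) \<otimes> b = \<zero>"
    using assms ab by (simp add: m_assoc)
  then show "y \<in> homog R False"
    using yx ab by simp
qed

lemma even_unitsI:
  assumes "x \<in> homog R False" "y \<in> carrier R" "x \<otimes> y = \<one>"
  shows "x \<in> carrier (even_units R)"
  using even_inverse[OF assms] assms(1) by (simp add: even_units_def)

lemma even_unitsE:
  assumes "x \<in> carrier (even_units R)"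
  obtains y where "x \<in> homog R False" "y \<in> homog R False" "x \<otimes> y = \<one>" "y \<otimes> x = \<one>"
proof -
  have x: "x \<in> homog R False" "x \<in> Units R"
    using assms by (auto simp: even_units_def)
  then have "inv x \<in> homog R False"
    using even_inverse(1)[of x "inv x"] by simp
  with x show ?thesis
    using that[of "inv x"] by simp
qed

lemma comm_group_even_units: "comm_group (even_units R)"
proof (rule comm_groupI)
  fix x y assume xy: "x \<in> carrier (even_units R)" "y \<in> carrier (even_units R)"
  then show "x \<otimes>\<^bsub>even_units R\<^esub> y \<in> carrier (even_units R)"
    by (auto simp: even_units_def)
  show "x \<otimes>\<^bsub>even_units R\<^esub> y = y \<otimes>\<^bsub>even_units R\<^esub> x"
    using xy even_central by (auto simp: even_units_def)
next
  fix x assume "x \<in> carrier (even_units R)"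
  then obtain y where y: "x \<in> homog R False" "y \<in> homog R False" "x \<otimes> y = \<one>" "y \<otimes> x = \<one>"
    by (rule even_unitsE)
  then have "y \<in> carrier (even_units R)"
    by (intro even_unitsI[of y x]) auto
  then show "\<exists>y\<in>carrier (even_units R). y \<otimes>\<^bsub>even_units R\<^esub> x = \<one>\<^bsub>even_units R\<^esub>"
    using y by (auto simp: even_units_def)
qed (auto simp: even_units_def m_assoc)

text \<open>It is applied to the functions on \<open>\<Delta>\<close> inside the sum of all \<open>\<O>\<^sub>\<Delta>(k)\<close>, and to the closed functions.\<close>

lemma supercomm_ring_sub_super:
  assumes C: "subring C R"
    and parts: "\<And>a b. a \<in> homog R False \<Longrightarrow> b \<in> homog R True \<Longrightarrow> a \<oplus> b \<in> C \<Longrightarrow> a \<in> C \<and> b \<in> C"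
  shows "supercomm_ring (sub_super R C)"
proof -
  note C_simps = subringE[OF C]
  have subC: "x \<in> C \<Longrightarrow> x \<in> carrier R" for x
    using C_simps(1) by auto
  have ringC: "ring (sub_super R C)"
  proof (rule ringI)
    show "abelian_group (sub_super R C)"
    proof (rule abelian_groupI)
      fix x assume "x \<in> carrier (sub_super R C)"
      then show "\<exists>y\<in>carrier (sub_super R C). y \<oplus>\<^bsub>sub_super R C\<^esub> x = \<zero>\<^bsub>sub_super R C\<^esub>"
        using C_simps(5) subC by (intro bexI[of _ "\<ominus> x"]) (auto simp: sub_super_def l_neg)
    qed (auto simp: sub_super_def C_simps subC a_ac)
    show "Group.monoid (sub_super R C)"
      by unfold_locales (auto simp: sub_super_def C_simps subC m_assoc)
  qed (auto simp: sub_super_def subC l_distr r_distr)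
  have neg: "\<ominus>\<^bsub>sub_super R C\<^esub> x = \<ominus> x" if "x \<in> C" for x
    using that C_simps(5)[OF that] subC
    by (intro abelian_group.minus_equality[OF ring.is_abelian_group[OF ringC]])
       (auto simp: sub_super_def l_neg)
  have sub: "subgroup (homog (sub_super R C) p) (add_monoid (sub_super R C))" for p
  proof (rule group.subgroupI)
    show "group (add_monoid (sub_super R C))"
      using abelian_group.a_group[OF ring.is_abelian_group[OF ringC]] .
    show "homog (sub_super R C) p \<noteq> {}"
      using C_simps(2) homog_zero[of p] by (auto simp: sub_super_def)
    fix x assume "x \<in> homog (sub_super R C) p"
    then have "\<ominus>\<^bsub>sub_super R C\<^esub> x \<in> homog (sub_super R C) p"
      using neg C_simps(5) homog_neg[of x p] by (simp add: sub_super_def)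
    then show "inv\<^bsub>add_monoid (sub_super R C)\<^esub> x \<in> homog (sub_super R C) p"
      by (simp add: a_inv_def)
  qed (auto simp: sub_super_def C_simps)
  have dec: "\<exists>!ab. ab \<in> homog (sub_super R C) False \<times> homog (sub_super R C) True \<and> x = fst ab \<oplus> snd ab"
    if x: "x \<in> C" for x
  proof -
    obtain a b where ab: "a \<in> homog R False" "b \<in> homog R True" "x = a \<oplus> b"
      using parity_decomposition[OF subC[OF x]] .
    then have "a \<in> C" "b \<in> C"
      using parts x by auto
    moreover have "ab = (a, b)"
      if "ab \<in> homog (sub_super R C) False \<times> homog (sub_super R C) True \<and> x = fst ab \<oplus> snd ab" for ab
      using that ab(3) parity_unique[OF ab(1,2), of "fst ab" "snd ab"]
      by (auto simp: sub_super_def mem_Times_iff prod_eq_iff)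
    ultimately show ?thesis
      using ab by (intro ex1I[of _ "(a, b)"]) (auto simp: sub_super_def)
  qed
  show ?thesis
    unfolding supercomm_ring_def
  proof (intro conjI ringC allI sub ballI)
    fix x assume "x \<in> carrier (sub_super R C)"
    then show "\<exists>!ab. ab \<in> homog (sub_super R C) False \<times> homog (sub_super R C) True \<and>
        x = fst ab \<oplus>\<^bsub>sub_super R C\<^esub> snd ab"
      using dec[of x] by (auto simp: sub_super_def)
  next
    show "\<one>\<^bsub>sub_super R C\<^esub> \<in> homog (sub_super R C) False"
      using C_simps(3) by (auto simp: sub_super_def)
  next
    fix p q x y assume "x \<in> homog (sub_super R C) p" "y \<in> homog (sub_super R C) q"
    then have xy: "x \<in> C" "x \<in> homog R p" "y \<in> C" "y \<in> homog R q"
      by (auto simp: sub_super_def)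
    then show "x \<otimes>\<^bsub>sub_super R C\<^esub> y \<in> homog (sub_super R C) (p \<noteq> q)"
      using homog_mult C_simps(6) by (auto simp: sub_super_def)
    have "y \<otimes> x \<in> C"
      using xy C_simps(6) by auto
    then show "x \<otimes>\<^bsub>sub_super R C\<^esub> y = ssgn (sub_super R C) (p \<and> q) (y \<otimes>\<^bsub>sub_super R C\<^esub> x)"
      using supercommute[OF xy(2,4)] neg by (auto simp: ssgn_def) (auto simp: sub_super_def)
  qed
qed

end

lemma (in supercommutative_ring) homog_finsum:
  assumes "finite A" "\<And>i. i \<in> A \<Longrightarrow> f i \<in> homog R p"
  shows "finsum R f A \<in> homog R p"
  using assms
proof (induction A)
  case (insert x A)
  then have "finsum R f (insert x A) = f x \<oplus> finsum R f A"
    by (intro finsum_insert) auto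
  then show ?case
    using insert by auto
qed auto

locale supercommutative_algebra = supercommutative_ring R + complex_algebra R c
  for R :: "('a, 'm) super_ring_scheme" (structure) and c +
  assumes scalar_even: "c a \<in> homog R False"
begin

lemma even_nilpotentsD:
  assumes "s \<in> carrier (even_nilpotents R)"
  shows "s \<in> nilpotents R" "s \<in> homog R False" "s \<in> carrier R"
  using assms by (auto simp: even_nilpotents_def)

lemma even_nilpotents_add:
  assumes "s \<in> carrier (even_nilpotents R)" "s' \<in> carrier (even_nilpotents R)"
  shows "s \<oplus> s' \<in> carrier (even_nilpotents R)" "nexp (s \<oplus> s') = nexp s \<otimes> nexp s'"
  using nilpotents_add[of s s'] even_central[of s s'] even_nilpotentsD[OF assms(1)] even_nilpotentsD[OF assms(2)]
  by (auto simp: even_nilpotents_def)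

lemma even_nilpotents_neg:
  assumes "s \<in> carrier (even_nilpotents R)"
  shows "\<ominus> s \<in> carrier (even_nilpotents R)"
  using nilpotents_neg[OF even_nilpotentsD(1)[OF assms]] homog_neg[OF even_nilpotentsD(2)[OF assms]]
  by (simp add: even_nilpotents_def)

lemma comm_group_even_nilpotents: "comm_group (even_nilpotents R)"
proof (rule comm_groupI)
  note simps = even_nilpotents_def partial_object.simps monoid.simps
  show "\<one>\<^bsub>even_nilpotents R\<^esub> \<in> carrier (even_nilpotents R)"
    using nilpotents_zero homog_zero by (simp add: even_nilpotents_def)
  fix x assume x: "x \<in> carrier (even_nilpotents R)"
  note xc = even_nilpotentsD(3)[OF x]
  show "\<one>\<^bsub>even_nilpotents R\<^esub> \<otimes>\<^bsub>even_nilpotents R\<^esub> x = x"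
    unfolding simps using xc by simp
  show "\<exists>y\<in>carrier (even_nilpotents R). y \<otimes>\<^bsub>even_nilpotents R\<^esub> x = \<one>\<^bsub>even_nilpotents R\<^esub>"
  proof (rule bexI[OF _ even_nilpotents_neg[OF x]])
    show "\<ominus> x \<otimes>\<^bsub>even_nilpotents R\<^esub> x = \<one>\<^bsub>even_nilpotents R\<^esub>"
      unfolding simps using xc by (rule l_neg)
  qed
  fix y assume y: "y \<in> carrier (even_nilpotents R)"
  note yc = even_nilpotentsD(3)[OF y]
  show "x \<otimes>\<^bsub>even_nilpotents R\<^esub> y \<in> carrier (even_nilpotents R)"
    using even_nilpotents_add(1)[OF x y] by (simp add: even_nilpotents_def)
  show "x \<otimes>\<^bsub>even_nilpotents R\<^esub> y = y \<otimes>\<^bsub>even_nilpotents R\<^esub> x"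
    unfolding simps using xc yc by (rule a_comm)
  fix z assume z: "z \<in> carrier (even_nilpotents R)"
  note zc = even_nilpotentsD(3)[OF z]
  show "x \<otimes>\<^bsub>even_nilpotents R\<^esub> y \<otimes>\<^bsub>even_nilpotents R\<^esub> z = x \<otimes>\<^bsub>even_nilpotents R\<^esub> (y \<otimes>\<^bsub>even_nilpotents R\<^esub> z)"
    unfolding simps using xc yc zc by (rule a_assoc)
qed

lemma nexp_even:
  assumes "s \<in> homog R False"
  shows "nexp s \<in> homog R False"
proof -
  have "s [^] k \<in> homog R False" for k :: nat
    by (induction k) (use assms in auto)
  then show ?thesis
    unfolding nexp_def exp_term_def by (intro homog_finsum even_mult scalar_even) auto
qed

lemma nexp_hom: "nexp \<in> hom (even_nilpotents R) (even_units R)"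
proof (rule homI)
  fix s assume s: "s \<in> carrier (even_nilpotents R)"
  note S = even_nilpotentsD[OF s]
  show "nexp s \<in> carrier (even_units R)"
    using even_unitsI[OF nexp_even[OF S(2)] nexp_closed nexp_mult_neg[OF S(1)]] S(3) by simp
  fix s' assume s': "s' \<in> carrier (even_nilpotents R)"
  show "nexp (s \<otimes>\<^bsub>even_nilpotents R\<^esub> s') = nexp s \<otimes>\<^bsub>even_units R\<^esub> nexp s'"
    using even_nilpotents_add(2)[OF s s'] by (simp add: even_nilpotents_def even_units_def)
qed

end

lemma super_homD:
  assumes "h \<in> super_hom R S"
  shows "h \<in> ring_hom R S" "x \<in> homog R p \<Longrightarrow> h x \<in> homog S p"
  using assms by (auto simp: super_hom_def)

lemma sub_super_simps [simp]:
  "carrier (sub_super R C) = C" "homog (sub_super R C) p = C \<inter> homog R p"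
  "x \<otimes>\<^bsub>sub_super R C\<^esub> y = x \<otimes>\<^bsub>R\<^esub> y" "x \<oplus>\<^bsub>sub_super R C\<^esub> y = x \<oplus>\<^bsub>R\<^esub> y"
  "\<one>\<^bsub>sub_super R C\<^esub> = \<one>\<^bsub>R\<^esub>" "\<zero>\<^bsub>sub_super R C\<^esub> = \<zero>\<^bsub>R\<^esub>"
  by (auto simp: sub_super_def)

lemma nat_pow_sub_super [simp]: "x [^]\<^bsub>sub_super R C\<^esub> (n::nat) = x [^]\<^bsub>R\<^esub> n"
  by (induction n) auto

lemma finsum_sub_super:
  assumes "ring R" "ring (sub_super R C)" "C \<subseteq> carrier R" "finite A" "f \<in> A \<rightarrow> C"
  shows "finsum (sub_super R C) f A = finsum R f A"
proof -
  interpret R: ring R by fact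
  interpret C: ring "sub_super R C" by fact
  show ?thesis
    using assms(4,5,3)
  proof (induction A)
    case (insert x A)
    have "finsum (sub_super R C) f (insert x A) = f x \<oplus>\<^bsub>R\<^esub> finsum (sub_super R C) f A"
      using insert by (subst C.finsum_insert) auto
    also have "\<dots> = finsum R f (insert x A)"
      using insert by (subst R.finsum_insert) auto
    finally show ?case .
  qed simp
qed

text \<open>The exponential of a closed function may thus be computed in the larger ring, where it is a product of exponentials of
  functions that are not closed.\<close>

lemma complex_algebra_sub_super:
  assumes "complex_algebra R c" "ring (sub_super R C)" "C \<subseteq> carrier R" "\<And>a. c a \<in> C"
  shows "complex_algebra (sub_super R C) c"
    and "s \<in> C \<Longrightarrow> complex_algebra.nexp (sub_super R C) c s = complex_algebra.nexp R c s"
proof -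
  interpret complex_algebra R c by fact
  interpret C: ring "sub_super R C" by fact
  show alg: "complex_algebra (sub_super R C) c"
  proof (intro complex_algebra.intro complex_algebra_axioms.intro C.ring_axioms)
    show "c \<in> ring_hom complex_ring (sub_super R C)"
      using scalar_hom assms(4) by (simp add: ring_hom_def)
    show "c a \<otimes>\<^bsub>sub_super R C\<^esub> x = x \<otimes>\<^bsub>sub_super R C\<^esub> c a" if "x \<in> carrier (sub_super R C)" for x a
      using scalar_central[of x a] that assms(3) by auto
  qed
  interpret D: complex_algebra "sub_super R C" c by (fact alg)
  assume s: "s \<in> C"
  have "D.exp_term k s = exp_term k s" for k
    by (simp add: D.exp_term_def exp_term_def)
  moreover have "D.exp_term k s \<in> C" for k
    using D.exp_term_closed[of s k] s by simp
  ultimately have "exp_term k s \<in> C" "D.exp_term k s = exp_term k s" for k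
    by auto
  then have "finsum (sub_super R C) (\<lambda>k. D.exp_term k s) A = finsum R (\<lambda>k. exp_term k s) A"
    if "finite A" for A :: "nat set"
    using finsum_sub_super[of R C A "\<lambda>k. exp_term k s"] that assms ring_axioms by auto
  then show "D.nexp s = nexp s"
    unfolding D.nexp_def nexp_def by simp
qed

lemma neg_sub_super:
  assumes "ring R" "ring (sub_super R C)" "C \<subseteq> carrier R" "x \<in> C"
  shows "\<ominus>\<^bsub>sub_super R C\<^esub> x = \<ominus>\<^bsub>R\<^esub> x"
proof -
  interpret R: ring R by fact
  interpret C: ring "sub_super R C" by fact
  have "\<ominus>\<^bsub>sub_super R C\<^esub> x \<in> C" "\<ominus>\<^bsub>sub_super R C\<^esub> x \<oplus>\<^bsub>R\<^esub> x = \<zero>\<^bsub>R\<^esub>"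
    using C.a_inv_closed[of x] C.l_neg[of x] assms(4) by auto
  then show ?thesis
    using R.minus_equality[of "\<ominus>\<^bsub>sub_super R C\<^esub> x" x] subsetD[OF assms(3)] assms(4) by simp
qed

locale odd_derivation = supercommutative_ring +
  fixes D
  assumes derivation: "super_derivation R True D"
begin

lemma deriv_closed [simp, intro]: "x \<in> carrier R \<Longrightarrow> D x \<in> carrier R"
  using derivation by (simp add: super_derivation_def)

lemma deriv_add: "x \<in> carrier R \<Longrightarrow> y \<in> carrier R \<Longrightarrow> D (x \<oplus> y) = D x \<oplus> D y"
  using derivation by (simp add: super_derivation_def)

lemma deriv_odd [simp, intro]: "x \<in> homog R False \<Longrightarrow> D x \<in> homog R True"
  and deriv_even [simp, intro]: "x \<in> homog R True \<Longrightarrow> D x \<in> homog R False"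
proof -
  have "D ` homog R q \<subseteq> homog R (True \<noteq> q)" for q
    using derivation unfolding super_derivation_def by (elim conjE) (drule (1) spec)
  from this[of False] this[of True]
  show "x \<in> homog R False \<Longrightarrow> D x \<in> homog R True" "x \<in> homog R True \<Longrightarrow> D x \<in> homog R False"
    by auto
qed

lemma deriv_leibniz:
  "x \<in> homog R q \<Longrightarrow> y \<in> carrier R \<Longrightarrow> D (x \<otimes> y) = D x \<otimes> y \<oplus> ssgn R q (x \<otimes> D y)"
  using derivation unfolding super_derivation_def by simp

lemma deriv_even_mult:
  "x \<in> homog R False \<Longrightarrow> y \<in> carrier R \<Longrightarrow> D (x \<otimes> y) = D x \<otimes> y \<oplus> x \<otimes> D y"
  using deriv_leibniz[of x False y] by (simp add: ssgn_def)

lemma deriv_odd_mult: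
  "x \<in> homog R True \<Longrightarrow> y \<in> carrier R \<Longrightarrow> D (x \<otimes> y) = D x \<otimes> y \<ominus> x \<otimes> D y"
  using deriv_leibniz[of x True y] by (simp add: ssgn_def minus_eq)

lemma deriv_zero [simp]: "D \<zero> = \<zero>"
proof -
  have "D \<zero> \<oplus> D \<zero> = D \<zero>"
    using deriv_add[of \<zero> \<zero>] by simp
  then show ?thesis
    using add.l_cancel_one[of "D \<zero>" "D \<zero>"] by simp
qed

lemma deriv_neg:
  assumes "x \<in> carrier R"
  shows "D (\<ominus> x) = \<ominus> D x"
proof -
  have "D (\<ominus> x) \<oplus> D x = \<zero>"
    using deriv_add[of "\<ominus> x" x] assms by (simp add: l_neg)
  then show ?thesis
    using minus_equality[of "D (\<ominus> x)" "D x"] assms by simp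
qed

lemma deriv_minus: "x \<in> carrier R \<Longrightarrow> y \<in> carrier R \<Longrightarrow> D (x \<ominus> y) = D x \<ominus> D y"
  by (simp add: minus_eq deriv_add deriv_neg)

lemma deriv_one [simp]: "D \<one> = \<zero>"
proof -
  have "D \<one> \<oplus> D \<one> = D \<one>"
    using deriv_even_mult[of \<one> \<one>] by simp
  then show ?thesis
    using add.l_cancel_one[of "D \<one>" "D \<one>"] by simp
qed

text \<open>The horizontal elements of the connection \<open>D + w\<close>. For \<open>w = 0\<close> these are the closed elements, so that the lemmas
  below also give the subring of closed elements.\<close>

definition flat :: "'a \<Rightarrow> 'a \<Rightarrow> bool" where
  "flat w g \<longleftrightarrow> g \<in> carrier R \<and> D g \<oplus> w \<otimes> g = \<zero>"

lemma flatD: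
  assumes "flat w g" "w \<in> carrier R"
  shows "g \<in> carrier R" "D g = \<ominus> (w \<otimes> g)"
  using assms minus_equality[of "D g" "w \<otimes> g"] by (auto simp: flat_def)

lemma flatI:
  assumes "w \<in> carrier R" "g \<in> carrier R" "D g = \<ominus> (w \<otimes> g)"
  shows "flat w g"
  using assms by (simp add: flat_def l_neg)

lemma flat_zero: "w \<in> carrier R \<Longrightarrow> flat w \<zero>"
  by (simp add: flat_def)

lemma flat_add:
  assumes "w \<in> carrier R" "flat w g" "flat w h"
  shows "flat w (g \<oplus> h)"
  using flatD[OF assms(2,1)] flatD[OF assms(3,1)] assms(1)
  by (intro flatI) (auto simp: deriv_add r_distr minus_add)

lemma flat_neg:
  assumes "w \<in> carrier R" "flat w g"
  shows "flat w (\<ominus> g)"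
  using flatD[OF assms(2,1)] assms(1) by (intro flatI) (auto simp: deriv_neg r_minus)

text \<open>The operator \<open>g \<mapsto> D g + w g\<close> is odd, so its kernel is graded.\<close>

lemma flat_parts:
  assumes "w \<in> homog R True" "a \<in> homog R False" "b \<in> homog R True" "flat w (a \<oplus> b)"
  shows "flat w a" "flat w b"
proof -
  have "(D a \<oplus> w \<otimes> a) \<oplus> (D b \<oplus> w \<otimes> b) = D (a \<oplus> b) \<oplus> w \<otimes> (a \<oplus> b)"
    using assms(1-3) by (simp add: deriv_add r_distr a_ac)
  then have "(D a \<oplus> w \<otimes> a) \<oplus> (D b \<oplus> w \<otimes> b) = \<zero>"
    using assms(4) by (simp add: flat_def)
  then have "D a \<oplus> w \<otimes> a = \<zero>" "D b \<oplus> w \<otimes> b = \<zero>"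
    using parity_zero[of "D a \<oplus> w \<otimes> a" True "D b \<oplus> w \<otimes> b"] assms(1-3) by auto
  then show "flat w a" "flat w b"
    using assms(2,3) by (auto simp: flat_def)
qed

text \<open>Multiplication by a closed function commutes with \<open>g \<mapsto> D g + w g\<close> up to sign.\<close>

lemma flat_scale:
  assumes w: "w \<in> homog R True" and s: "s \<in> carrier R" "D s = \<zero>" and m: "flat w m"
  shows "flat w (s \<otimes> m)"
proof -
  have mc: "m \<in> carrier R" and Dm: "D m = \<ominus> (w \<otimes> m)"
    using m w flatD[of w m] by auto
  obtain a b where ab: "a \<in> homog R False" "b \<in> homog R True" "s = a \<oplus> b"
    using parity_decomposition[OF s(1)] .
  then have D: "D a = \<zero>" "D b = \<zero>"
    using flat_parts[of \<zero> a b] s by (auto simp: flat_def)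
  have "D (a \<otimes> m) = \<ominus> (w \<otimes> (a \<otimes> m))"
    using ab(1) w mc Dm D even_left_commute[of a w m] by (simp add: deriv_even_mult r_minus)
  then have 1: "flat w (a \<otimes> m)"
    using ab(1) w mc by (intro flatI) auto
  have "w \<otimes> (b \<otimes> m) = (w \<otimes> b) \<otimes> m"
    using ab(2) w mc by (simp add: m_assoc)
  also have "\<dots> = \<ominus> (b \<otimes> (w \<otimes> m))"
    unfolding odd_anticommute[OF w ab(2)] using ab(2) w mc by (simp add: l_minus m_assoc)
  finally have "D (b \<otimes> m) = \<ominus> (w \<otimes> (b \<otimes> m))"
    using ab(2) w mc Dm D by (simp add: deriv_odd_mult minus_eq r_minus)
  then have 2: "flat w (b \<otimes> m)"
    using ab(2) w mc by (intro flatI) auto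
  have "s \<otimes> m = a \<otimes> m \<oplus> b \<otimes> m"
    using ab mc by (simp add: l_distr)
  then show ?thesis
    using flat_add[OF _ 1 2] w by simp
qed

text \<open>From \<open>D \<phi> = - w \<phi>\<close> follows \<open>D (\<phi>\<^bsup>-1\<^esup>) = w \<phi>\<^bsup>-1\<^esup>\<close>, and the two terms of \<open>D (\<phi>\<^bsup>-1\<^esup> m)\<close> cancel.\<close>

lemma flat_quotient_closed:
  assumes w: "w \<in> homog R True" and \<phi>: "\<phi> \<in> homog R False" "\<psi> \<in> carrier R" "\<phi> \<otimes> \<psi> = \<one>" "flat w \<phi>"
    and m: "flat w m"
  shows "D (\<psi> \<otimes> m) = \<zero>"
proof -
  have \<psi>: "\<psi> \<in> homog R False" "\<psi> \<otimes> \<phi> = \<one>"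
    using even_inverse[OF \<phi>(1-3)] by auto
  have mc: "m \<in> carrier R" and Dm: "D m = \<ominus> (w \<otimes> m)"
    using m w flatD[of w m] by auto
  have D\<phi>: "D \<phi> = \<ominus> (w \<otimes> \<phi>)"
    using flatD[OF \<phi>(4)] w by auto
  have "\<ominus> (w \<otimes> \<phi>) \<otimes> \<psi> = \<ominus> w"
    using \<phi>(1-3) w by (simp add: l_minus m_assoc)
  then have "\<ominus> w \<oplus> \<phi> \<otimes> D \<psi> = D (\<phi> \<otimes> \<psi>)"
    unfolding deriv_even_mult[OF \<phi>(1,2)] D\<phi> by simp
  also have "\<dots> = \<zero>"
    unfolding \<phi>(3) by simp
  finally have "\<phi> \<otimes> D \<psi> = w"
    using w \<phi>(1,2) minus_equality[of "\<phi> \<otimes> D \<psi>" "\<ominus> w"] a_comm[of "\<ominus> w" "\<phi> \<otimes> D \<psi>"] by simp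
  then have "\<psi> \<otimes> w = (\<psi> \<otimes> \<phi>) \<otimes> D \<psi>"
    using \<phi>(1,2) by (simp add: m_assoc)
  then have "D \<psi> = \<psi> \<otimes> w"
    using \<psi> \<phi>(2) by simp
  then show ?thesis
    using \<psi>(1) w mc by (simp add: deriv_even_mult Dm r_minus m_assoc r_neg)
qed

end

locale odd_derivation_over_C = odd_derivation R D + complex_algebra R c
  for R :: "('a, 'm) super_ring_scheme" (structure) and D c
begin

lemma odd_square_zero:
  assumes "t \<in> homog R True"
  shows "t \<otimes> t = \<zero>"
  using eq_neg_self_imp_zero[OF odd_anticommute[OF assms assms]] assms by simp

text \<open>The element \<open>1 - h\<close> is \<open>exp (-h)\<close>, as \<open>h\<^sup>2 = 0\<close>. Its defect \<open>D (1 - h) + w (1 - h)\<close> is \<open>- w h\<close>, and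
  differentiating \<open>h\<^sup>2 = 0\<close> gives \<open>2 w h = 0\<close>.\<close>

lemma flat_one_minus_primitive:
  assumes h: "h \<in> homog R False" "h \<otimes> h = \<zero>" and w: "D h = w"
  shows "flat w (\<one> \<ominus> h)" "(\<one> \<ominus> h) \<otimes> (\<one> \<oplus> h) = \<one>"
proof -
  have wc: "w \<in> homog R True"
    using h w by auto
  have "w \<otimes> h \<oplus> w \<otimes> h = \<zero>"
    using deriv_even_mult[of h h] h w even_central[of h w] wc by simp
  then have "w \<otimes> h = \<ominus> (w \<otimes> h)"
    using minus_equality[of "w \<otimes> h" "w \<otimes> h"] wc h by simp
  then have wh: "w \<otimes> h = \<zero>"
    using eq_neg_self_imp_zero[of "w \<otimes> h"] wc h by blast
  have "D (\<one> \<ominus> h) \<oplus> w \<otimes> (\<one> \<ominus> h) = \<zero>"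
    using h wc wh by (simp add: minus_eq deriv_add deriv_neg w r_distr r_minus l_neg)
  then show "flat w (\<one> \<ominus> h)"
    using h by (simp add: flat_def)
  show "(\<one> \<ominus> h) \<otimes> (\<one> \<oplus> h) = \<one>"
    using h by (simp add: minus_eq l_distr r_distr l_minus a_assoc r_neg l_neg)
qed

text \<open>The Poincare lemma in the odd direction: \<open>u w\<close> is closed, so differentiating \<open>t (u w)\<close> only differentiates \<open>t\<close>.
  The square of this primitive is \<open>- t\<^sup>2 (u w)\<^sup>2\<close>, and \<open>t\<^sup>2 = 0\<close> as \<open>t\<close> is odd.\<close>

lemma odd_primitive:
  assumes t: "t \<in> homog R True" and u: "u \<in> homog R False" "D t \<otimes> u = \<one>" "D u = \<zero>"
    and w: "w \<in> homog R True" "D w = \<zero>"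
  shows "t \<otimes> (u \<otimes> w) \<in> homog R False" "D (t \<otimes> (u \<otimes> w)) = w"
    "(t \<otimes> (u \<otimes> w)) \<otimes> (t \<otimes> (u \<otimes> w)) = \<zero>"
proof -
  let ?x = "u \<otimes> w"
  have x: "?x \<in> homog R True" "D ?x = \<zero>"
    using u(1,3) w by (auto simp: deriv_even_mult)
  show "t \<otimes> ?x \<in> homog R False"
    using t x by auto
  have "D t \<otimes> ?x = (D t \<otimes> u) \<otimes> w"
    using t u(1) w by (simp add: m_assoc)
  also have "\<dots> = w"
    using u(2) w by simp
  finally show "D (t \<otimes> ?x) = w"
    using t x w by (simp add: deriv_odd_mult minus_eq)
  have "(t \<otimes> ?x) \<otimes> (t \<otimes> ?x) = t \<otimes> ((?x \<otimes> t) \<otimes> ?x)"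
    using t x by (simp add: m_assoc)
  also have "\<dots> = t \<otimes> (\<ominus> (t \<otimes> ?x) \<otimes> ?x)"
    using odd_anticommute[OF x(1) t] by simp
  also have "\<dots> = \<ominus> ((t \<otimes> t) \<otimes> (?x \<otimes> ?x))"
    using t x by (simp add: m_assoc l_minus r_minus)
  also have "\<dots> = \<zero>"
    using odd_square_zero[OF t] x by simp
  finally show "(t \<otimes> ?x) \<otimes> (t \<otimes> ?x) = \<zero>" .
qed

end

section \<open>Cech cohomology in degree one\<close>

locale abelian_presheaf =
  fixes T :: "'a topology" and F :: "'a set \<Rightarrow> 'g monoid" and r :: "'a set \<Rightarrow> 'a set \<Rightarrow> 'g \<Rightarrow> 'g"
  assumes group: "openin T U \<Longrightarrow> comm_group (F U)"
    and restr_hom: "openin T U \<Longrightarrow> openin T V \<Longrightarrow> V \<subseteq> U \<Longrightarrow> r U V \<in> hom (F U) (F V)"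
    and restr_restr: "openin T U \<Longrightarrow> openin T V \<Longrightarrow> openin T W \<Longrightarrow> W \<subseteq> V \<Longrightarrow> V \<subseteq> U \<Longrightarrow>
      x \<in> carrier (F U) \<Longrightarrow> r V W (r U V x) = r U W x"
begin

lemma restr_closed: "openin T U \<Longrightarrow> openin T V \<Longrightarrow> V \<subseteq> U \<Longrightarrow> x \<in> carrier (F U) \<Longrightarrow> r U V x \<in> carrier (F V)"
  using restr_hom[of U V] by (auto simp: hom_def)

lemma restr_mult: "openin T U \<Longrightarrow> openin T V \<Longrightarrow> V \<subseteq> U \<Longrightarrow> x \<in> carrier (F U) \<Longrightarrow> y \<in> carrier (F U) \<Longrightarrow>
    r U V (x \<otimes>\<^bsub>F U\<^esub> y) = r U V x \<otimes>\<^bsub>F V\<^esub> r U V y"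
  using restr_hom[of U V] by (auto simp: hom_def)

lemma point_coverD:
  assumes "point_cover T U" "x \<in> topspace T"
  shows "openin T (U x)" "x \<in> U x"
  using assms by (auto simp: point_cover_def)

lemma cocycle_closed:
  assumes "(U, g) \<in> cech_Z1 T F r" "x \<in> topspace T" "y \<in> topspace T"
  shows "openin T (U x)" "openin T (U y)" "openin T (U x \<inter> U y)" "g x y \<in> carrier (F (U x \<inter> U y))"
  using assms by (auto simp: cech_Z1_def point_cover_def)

text \<open>The 0-cochain \<open>f\<close> on the common refinement \<open>W\<close> makes the cocycles \<open>(U, g)\<close> and \<open>(U', g')\<close> cohomologous.\<close>

definition cobounding :: "('a \<Rightarrow> 'a set) \<Rightarrow> ('a \<Rightarrow> 'a \<Rightarrow> 'g) \<Rightarrow> ('a \<Rightarrow> 'a set) \<Rightarrow> ('a \<Rightarrow> 'a \<Rightarrow> 'g) \<Rightarrow>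
    ('a \<Rightarrow> 'a set) \<Rightarrow> ('a \<Rightarrow> 'g) \<Rightarrow> bool" where
  "cobounding U g U' g' W f \<longleftrightarrow> (U, g) \<in> cech_Z1 T F r \<and> (U', g') \<in> cech_Z1 T F r \<and> point_cover T W \<and>
     (\<forall>x\<in>topspace T. W x \<subseteq> U x \<inter> U' x \<and> f x \<in> carrier (F (W x))) \<and>
     (\<forall>x\<in>topspace T. \<forall>y\<in>topspace T. let V = W x \<inter> W y in
        r (U' x \<inter> U' y) V (g' x y) \<otimes>\<^bsub>F V\<^esub> r (W y) V (f y) =
        r (W x) V (f x) \<otimes>\<^bsub>F V\<^esub> r (U x \<inter> U y) V (g x y))"

lemma cech_rel_iff: "((U, g), (U', g')) \<in> cech_rel T F r \<longleftrightarrow> (\<exists>W f. cobounding U g U' g' W f)"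
  unfolding cech_rel_def cobounding_def by simp

lemma cech_relI:
  assumes "(U, g) \<in> cech_Z1 T F r" "(U', g') \<in> cech_Z1 T F r" "point_cover T W"
    and "\<And>x. x \<in> topspace T \<Longrightarrow> W x \<subseteq> U x \<inter> U' x" "\<And>x. x \<in> topspace T \<Longrightarrow> f x \<in> carrier (F (W x))"
    and "\<And>x y. x \<in> topspace T \<Longrightarrow> y \<in> topspace T \<Longrightarrow>
       r (U' x \<inter> U' y) (W x \<inter> W y) (g' x y) \<otimes>\<^bsub>F (W x \<inter> W y)\<^esub> r (W y) (W x \<inter> W y) (f y) =
       r (W x) (W x \<inter> W y) (f x) \<otimes>\<^bsub>F (W x \<inter> W y)\<^esub> r (U x \<inter> U y) (W x \<inter> W y) (g x y)"
  shows "((U, g), (U', g')) \<in> cech_rel T F r"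
  using assms unfolding cech_rel_iff cobounding_def Let_def by blast

text \<open>The last part restricts the coboundary relation to any smaller open set, as is needed to compose two such relations on
  a common refinement.\<close>

lemma coboundingD:
  assumes C: "cobounding U g U' g' W f"
  shows "(U, g) \<in> cech_Z1 T F r" "(U', g') \<in> cech_Z1 T F r" "point_cover T W"
    and "x \<in> topspace T \<Longrightarrow> W x \<subseteq> U x \<inter> U' x" "x \<in> topspace T \<Longrightarrow> f x \<in> carrier (F (W x))"
    and "x \<in> topspace T \<Longrightarrow> y \<in> topspace T \<Longrightarrow> openin T V \<Longrightarrow> V \<subseteq> W x \<inter> W y \<Longrightarrow>
       r (U' x \<inter> U' y) V (g' x y) \<otimes>\<^bsub>F V\<^esub> r (W y) V (f y) =
       r (W x) V (f x) \<otimes>\<^bsub>F V\<^esub> r (U x \<inter> U y) V (g x y)"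
proof -
  show Z: "(U, g) \<in> cech_Z1 T F r" "(U', g') \<in> cech_Z1 T F r" and W: "point_cover T W"
    using C by (simp_all add: cobounding_def)
  have f: "W x \<subseteq> U x \<inter> U' x" "f x \<in> carrier (F (W x))" if "x \<in> topspace T" for x
    using C that unfolding cobounding_def by meson+
  show "x \<in> topspace T \<Longrightarrow> W x \<subseteq> U x \<inter> U' x" "x \<in> topspace T \<Longrightarrow> f x \<in> carrier (F (W x))"
    by (rule f, assumption)+
  assume xy: "x \<in> topspace T" "y \<in> topspace T" and V: "openin T V" "V \<subseteq> W x \<inter> W y"
  let ?W = "W x \<inter> W y"
  note o = point_coverD(1)[OF W xy(1)] point_coverD(1)[OF W xy(2)]
  have oW: "openin T ?W" using o by auto
  note c = cocycle_closed[OF Z(1) xy] cocycle_closed[OF Z(2) xy] f(2)[OF xy(1)] f(2)[OF xy(2)]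
  have s: "?W \<subseteq> U x \<inter> U y" "?W \<subseteq> U' x \<inter> U' y"
    using f(1) xy by auto
  have "r (U' x \<inter> U' y) ?W (g' x y) \<otimes>\<^bsub>F ?W\<^esub> r (W y) ?W (f y) =
      r (W x) ?W (f x) \<otimes>\<^bsub>F ?W\<^esub> r (U x \<inter> U y) ?W (g x y)"
    using C xy unfolding cobounding_def Let_def by meson
  then have "r ?W V (r (U' x \<inter> U' y) ?W (g' x y) \<otimes>\<^bsub>F ?W\<^esub> r (W y) ?W (f y)) =
    r ?W V (r (W x) ?W (f x) \<otimes>\<^bsub>F ?W\<^esub> r (U x \<inter> U y) ?W (g x y))"
    by simp
  then show "r (U' x \<inter> U' y) V (g' x y) \<otimes>\<^bsub>F V\<^esub> r (W y) V (f y) =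
       r (W x) V (f x) \<otimes>\<^bsub>F V\<^esub> r (U x \<inter> U y) V (g x y)"
    using o oW c s V by (simp add: restr_mult restr_closed restr_restr)
qed

text \<open>Inverse 0-cochains give symmetry. For transitivity multiply the two 0-cochains on the intersection of the two
  refinements; the order of the factors does not matter, as the groups are commutative.\<close>

theorem cech_rel_equiv: "equiv (cech_Z1 T F r) (cech_rel T F r)"
proof (rule equivI)
  show "cech_rel T F r \<subseteq> cech_Z1 T F r \<times> cech_Z1 T F r"
    by (auto simp: cech_rel_def)
  show "refl_on (cech_Z1 T F r) (cech_rel T F r)"
  proof (rule refl_onI)
    fix Ug assume "Ug \<in> cech_Z1 T F r"
    moreover obtain U g where [simp]: "Ug = (U, g)" by (cases Ug)
    ultimately have Z: "(U, g) \<in> cech_Z1 T F r" by simp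
    have cov: "point_cover T U" using Z by (auto simp: cech_Z1_def)
    have "((U, g), (U, g)) \<in> cech_rel T F r"
    proof (rule cech_relI[OF Z Z cov, where f = "\<lambda>x. \<one>\<^bsub>F (U x)\<^esub>"])
      fix x assume x: "x \<in> topspace T"
      interpret comm_group "F (U x)"
        using group point_coverD[OF cov x] by auto
      show "\<one>\<^bsub>F (U x)\<^esub> \<in> carrier (F (U x))" by simp
      fix y assume y: "y \<in> topspace T"
      let ?V = "U x \<inter> U y"
      note o = cocycle_closed[OF Z x y]
      interpret y: comm_group "F (U y)"
        using group o by auto
      interpret V: comm_group "F ?V"
        using group o by auto
      have "r (U z) ?V \<one>\<^bsub>F (U z)\<^esub> = \<one>\<^bsub>F ?V\<^esub>" if "z \<in> {x, y}" for z
        using restr_hom[of "U z" ?V] that o by (auto intro!: hom_one comm_group.axioms group)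
      moreover have "r ?V ?V (g x y) \<in> carrier (F ?V)"
        using o by (intro restr_closed) auto
      ultimately show "r ?V ?V (g x y) \<otimes>\<^bsub>F ?V\<^esub> r (U y) ?V \<one>\<^bsub>F (U y)\<^esub> =
          r (U x) ?V \<one>\<^bsub>F (U x)\<^esub> \<otimes>\<^bsub>F ?V\<^esub> r ?V ?V (g x y)"
        by simp
    qed auto
    then show "(Ug, Ug) \<in> cech_rel T F r" by simp
  qed
  show "sym (cech_rel T F r)"
  proof (rule symI)
    fix p q assume pq: "(p, q) \<in> cech_rel T F r"
    obtain U g U' g' where [simp]: "p = (U, g)" "q = (U', g')" by (cases p, cases q)
    have "((U, g), (U', g')) \<in> cech_rel T F r" using pq by simp
    then obtain W f where C: "cobounding U g U' g' W f"
      unfolding cech_rel_iff by blast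
    note Z = coboundingD(1,2)[OF C] and W = coboundingD(3)[OF C] and f = coboundingD(4,5)[OF C]
      and eq = coboundingD(6)[OF C]
    have "((U', g'), (U, g)) \<in> cech_rel T F r"
    proof (rule cech_relI[OF Z(2,1) W, where f = "\<lambda>x. inv\<^bsub>F (W x)\<^esub> (f x)"])
      fix x assume x: "x \<in> topspace T"
      interpret x: comm_group "F (W x)"
        using group point_coverD[OF W x] by auto
      show "W x \<subseteq> U' x \<inter> U x" using f(1)[OF x] by auto
      show "inv\<^bsub>F (W x)\<^esub> (f x) \<in> carrier (F (W x))" using f(2)[OF x] by simp
      fix y assume y: "y \<in> topspace T"
      let ?V = "W x \<inter> W y"
      note o = point_coverD(1)[OF W x] point_coverD(1)[OF W y]
      then have oV: "openin T ?V" by auto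
      interpret y: comm_group "F (W y)"
        using group o by auto
      interpret V: comm_group "F ?V"
        using group oV by auto
      interpret rx: group_hom "F (W x)" "F ?V" "r (W x) ?V"
        using o oV restr_hom by unfold_locales auto
      interpret ry: group_hom "F (W y)" "F ?V" "r (W y) ?V"
        using o oV restr_hom by unfold_locales auto
      note c = cocycle_closed[OF Z(1) x y] cocycle_closed[OF Z(2) x y]
      have G: "r (U x \<inter> U y) ?V (g x y) \<in> carrier (F ?V)" "r (U' x \<inter> U' y) ?V (g' x y) \<in> carrier (F ?V)"
        using c oV f(1)[OF x] f(1)[OF y] by (auto intro!: restr_closed)
      have fx: "r (W x) ?V (f x) \<in> carrier (F ?V)" "r (W y) ?V (f y) \<in> carrier (F ?V)"
        using f(2)[OF x] f(2)[OF y] by auto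
      have "r (U x \<inter> U y) ?V (g x y)
          = inv\<^bsub>F ?V\<^esub> r (W x) ?V (f x) \<otimes>\<^bsub>F ?V\<^esub> (r (U' x \<inter> U' y) ?V (g' x y) \<otimes>\<^bsub>F ?V\<^esub> r (W y) ?V (f y))"
        using G fx eq[OF x y oV] by (simp add: V.inv_solve_left)
      then have "r (U x \<inter> U y) ?V (g x y) \<otimes>\<^bsub>F ?V\<^esub> inv\<^bsub>F ?V\<^esub> r (W y) ?V (f y)
          = inv\<^bsub>F ?V\<^esub> r (W x) ?V (f x) \<otimes>\<^bsub>F ?V\<^esub> r (U' x \<inter> U' y) ?V (g' x y)"
        using G fx by (simp add: V.m_assoc)
      then show "r (U x \<inter> U y) ?V (g x y) \<otimes>\<^bsub>F ?V\<^esub> r (W y) ?V (inv\<^bsub>F (W y)\<^esub> f y)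
          = r (W x) ?V (inv\<^bsub>F (W x)\<^esub> f x) \<otimes>\<^bsub>F ?V\<^esub> r (U' x \<inter> U' y) ?V (g' x y)"
        using f(2)[OF x] f(2)[OF y] by simp
    qed
    then show "(q, p) \<in> cech_rel T F r" by simp
  qed
  show "trans (cech_rel T F r)"
  proof (rule transI)
    fix p q s assume pq: "(p, q) \<in> cech_rel T F r" and qs: "(q, s) \<in> cech_rel T F r"
    obtain U g U' g' U'' g'' where [simp]: "p = (U, g)" "q = (U', g')" "s = (U'', g'')"
      by (cases p, cases q, cases s)
    have "((U, g), (U', g')) \<in> cech_rel T F r" using pq by simp
    then obtain W f where C: "cobounding U g U' g' W f"
      unfolding cech_rel_iff by blast
    have "((U', g'), (U'', g'')) \<in> cech_rel T F r" using qs by simp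
    then obtain W' f' where C': "cobounding U' g' U'' g'' W' f'"
      unfolding cech_rel_iff by blast
    note Z = coboundingD(1,2)[OF C] and W = coboundingD(3)[OF C] and f = coboundingD(4,5)[OF C]
      and eq = coboundingD(6)[OF C]
    note Z' = coboundingD(2)[OF C'] and W' = coboundingD(3)[OF C'] and f' = coboundingD(4,5)[OF C']
      and eq' = coboundingD(6)[OF C']
    let ?W = "\<lambda>x. W x \<inter> W' x"
    let ?f = "\<lambda>x. r (W x) (?W x) (f x) \<otimes>\<^bsub>F (?W x)\<^esub> r (W' x) (?W x) (f' x)"
    have "((U, g), (U'', g'')) \<in> cech_rel T F r"
    proof (rule cech_relI[OF Z(1) Z', where W = ?W and f = ?f])
      show "point_cover T ?W" using W W' by (auto simp: point_cover_def)
      fix x assume x: "x \<in> topspace T"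
      show "?W x \<subseteq> U x \<inter> U'' x" using f(1)[OF x] f'(1)[OF x] by auto
      note ox = point_coverD(1)[OF W x] point_coverD(1)[OF W' x]
      then have oWx: "openin T (?W x)" by auto
      interpret x: comm_group "F (?W x)"
        using group oWx by auto
      have fx: "r (W x) (?W x) (f x) \<in> carrier (F (?W x))" "r (W' x) (?W x) (f' x) \<in> carrier (F (?W x))"
        using f(2)[OF x] f'(2)[OF x] ox oWx by (auto intro!: restr_closed)
      then show "?f x \<in> carrier (F (?W x))" by simp
      fix y assume y: "y \<in> topspace T"
      note oy = point_coverD(1)[OF W y] point_coverD(1)[OF W' y]
      then have oWy: "openin T (?W y)" by auto
      have fy: "r (W y) (?W y) (f y) \<in> carrier (F (?W y))" "r (W' y) (?W y) (f' y) \<in> carrier (F (?W y))"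
        using f(2)[OF y] f'(2)[OF y] oy oWy by (auto intro!: restr_closed)
      let ?V = "?W x \<inter> ?W y"
      have oV: "openin T ?V" using oWx oWy by auto
      interpret V: comm_group "F ?V"
        using group oV by auto
      note c = cocycle_closed[OF Z(1) x y] cocycle_closed[OF Z(2) x y] cocycle_closed[OF Z' x y]
      let ?g = "r (U x \<inter> U y) ?V (g x y)" and ?g' = "r (U' x \<inter> U' y) ?V (g' x y)"
        and ?g'' = "r (U'' x \<inter> U'' y) ?V (g'' x y)"
      let ?a = "r (W x) ?V (f x)" and ?b = "r (W y) ?V (f y)"
        and ?a' = "r (W' x) ?V (f' x)" and ?b' = "r (W' y) ?V (f' y)"
      have G: "?g \<in> carrier (F ?V)" "?g' \<in> carrier (F ?V)" "?g'' \<in> carrier (F ?V)"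
        using c oV f(1)[OF x] f(1)[OF y] f'(1)[OF x] f'(1)[OF y] by (auto intro!: restr_closed)
      have A: "?a \<in> carrier (F ?V)" "?b \<in> carrier (F ?V)" "?a' \<in> carrier (F ?V)" "?b' \<in> carrier (F ?V)"
        using f(2)[OF x] f'(2)[OF x] f(2)[OF y] f'(2)[OF y] ox oy oV by (auto intro!: restr_closed)
      have rx: "r (?W x) ?V (?f x) = ?a \<otimes>\<^bsub>F ?V\<^esub> ?a'"
        using restr_mult[OF oWx oV Int_lower1 fx] restr_restr[OF ox(1) oWx oV Int_lower1 Int_lower1 f(2)[OF x]]
          restr_restr[OF ox(2) oWx oV Int_lower1 Int_lower2 f'(2)[OF x]] by simp
      have ry: "r (?W y) ?V (?f y) = ?b \<otimes>\<^bsub>F ?V\<^esub> ?b'"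
        using restr_mult[OF oWy oV Int_lower2 fy] restr_restr[OF oy(1) oWy oV Int_lower2 Int_lower1 f(2)[OF y]]
          restr_restr[OF oy(2) oWy oV Int_lower2 Int_lower2 f'(2)[OF y]] by simp
      have e: "?g' \<otimes>\<^bsub>F ?V\<^esub> ?b = ?a \<otimes>\<^bsub>F ?V\<^esub> ?g"
        by (rule eq[OF x y oV]) auto
      have e': "?g'' \<otimes>\<^bsub>F ?V\<^esub> ?b' = ?a' \<otimes>\<^bsub>F ?V\<^esub> ?g'"
        by (rule eq'[OF x y oV]) auto
      have "?g'' \<otimes>\<^bsub>F ?V\<^esub> (?b \<otimes>\<^bsub>F ?V\<^esub> ?b') = (?g'' \<otimes>\<^bsub>F ?V\<^esub> ?b') \<otimes>\<^bsub>F ?V\<^esub> ?b"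
        using G A by (simp add: V.m_ac)
      also have "\<dots> = ?a' \<otimes>\<^bsub>F ?V\<^esub> (?g' \<otimes>\<^bsub>F ?V\<^esub> ?b)"
        unfolding e' using G A by (simp add: V.m_assoc)
      also have "\<dots> = (?a \<otimes>\<^bsub>F ?V\<^esub> ?a') \<otimes>\<^bsub>F ?V\<^esub> ?g"
        unfolding e using G A by (simp add: V.m_ac)
      finally show "?g'' \<otimes>\<^bsub>F ?V\<^esub> r (?W y) ?V (?f y) = r (?W x) ?V (?f x) \<otimes>\<^bsub>F ?V\<^esub> ?g"
        unfolding rx ry .
    qed
    then show "(p, s) \<in> cech_rel T F r" by simp
  qed
qed

lemma cech_class_eqI:
  "((U, g), (U', g')) \<in> cech_rel T F r \<Longrightarrow> cech_class T F r U g = cech_class T F r U' g'"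
  unfolding cech_class_def using equiv_class_eq[OF cech_rel_equiv] .

lemma cech_class_self: "(U, g) \<in> cech_Z1 T F r \<Longrightarrow> (U, g) \<in> cech_class T F r U g"
  unfolding cech_class_def using equiv_class_self[OF cech_rel_equiv] .

lemma mem_cech_class: "p \<in> cech_class T F r U g \<longleftrightarrow> ((U, g), p) \<in> cech_rel T F r"
  unfolding cech_class_def by auto

end

locale abelian_presheaf_hom = F: abelian_presheaf T F r + G: abelian_presheaf T G r'
  for T :: "'a topology" and F :: "'a set \<Rightarrow> 'g monoid" and r
    and G :: "'a set \<Rightarrow> 'h monoid" and r' +
  fixes \<phi> :: "'a set \<Rightarrow> 'g \<Rightarrow> 'h"
  assumes hom: "openin T U \<Longrightarrow> \<phi> U \<in> hom (F U) (G U)"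
    and natural: "openin T U \<Longrightarrow> openin T V \<Longrightarrow> V \<subseteq> U \<Longrightarrow> x \<in> carrier (F U) \<Longrightarrow>
      r' U V (\<phi> U x) = \<phi> V (r U V x)"
begin

lemma map_closed: "openin T U \<Longrightarrow> x \<in> carrier (F U) \<Longrightarrow> \<phi> U x \<in> carrier (G U)"
  using hom[of U] by (auto simp: hom_def)

lemma map_mult: "openin T U \<Longrightarrow> x \<in> carrier (F U) \<Longrightarrow> y \<in> carrier (F U) \<Longrightarrow>
    \<phi> U x \<otimes>\<^bsub>G U\<^esub> \<phi> U y = \<phi> U (x \<otimes>\<^bsub>F U\<^esub> y)"
  using hom[of U] by (auto simp: hom_def)

lemma map_cocycle:
  assumes Z: "(U, g) \<in> cech_Z1 T F r"
  shows "(U, \<lambda>x y. \<phi> (U x \<inter> U y) (g x y)) \<in> cech_Z1 T G r'"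
  unfolding cech_Z1_def Let_def mem_Collect_eq case_prod_conv
proof (intro conjI ballI)
  show cov: "point_cover T U"
    using Z by (auto simp: cech_Z1_def)
  fix x y assume xy: "x \<in> topspace T" "y \<in> topspace T"
  note c = F.cocycle_closed[OF Z]
  show "\<phi> (U x \<inter> U y) (g x y) \<in> carrier (G (U x \<inter> U y))"
    using map_closed c[OF xy] by auto
  fix z assume z: "z \<in> topspace T"
  let ?V = "U x \<inter> U y \<inter> U z"
  have oV: "openin T ?V"
    using c[OF xy] c[OF xy(2) z] by auto
  have eq: "r (U x \<inter> U y) ?V (g x y) \<otimes>\<^bsub>F ?V\<^esub> r (U y \<inter> U z) ?V (g y z) = r (U x \<inter> U z) ?V (g x z)"
    using Z xy z unfolding cech_Z1_def Let_def by auto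
  have s: "?V \<subseteq> U x \<inter> U y" "?V \<subseteq> U y \<inter> U z" "?V \<subseteq> U x \<inter> U z" by auto
  note cc = c(3,4)[OF xy] c(3,4)[OF xy(2) z] c(3,4)[OF xy(1) z]
  show "r' (U x \<inter> U y) ?V (\<phi> (U x \<inter> U y) (g x y)) \<otimes>\<^bsub>G ?V\<^esub> r' (U y \<inter> U z) ?V (\<phi> (U y \<inter> U z) (g y z)) =
      r' (U x \<inter> U z) ?V (\<phi> (U x \<inter> U z) (g x z))"
    using cc oV s by (simp add: natural map_mult F.restr_closed eq)
qed

lemma map_cech_rel:
  assumes "((U, g), (U', g')) \<in> cech_rel T F r"
  shows "((U, \<lambda>x y. \<phi> (U x \<inter> U y) (g x y)), (U', \<lambda>x y. \<phi> (U' x \<inter> U' y) (g' x y))) \<in> cech_rel T G r'"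
proof -
  from assms obtain W f where C: "F.cobounding U g U' g' W f"
    unfolding F.cech_rel_iff by blast
  note Z = F.coboundingD(1,2)[OF C] and W = F.coboundingD(3)[OF C] and f = F.coboundingD(4,5)[OF C]
    and eq = F.coboundingD(6)[OF C]
  show ?thesis
  proof (rule G.cech_relI[OF map_cocycle[OF Z(1)] map_cocycle[OF Z(2)] W f(1), where f = "\<lambda>x. \<phi> (W x) (f x)"])
    fix x assume x: "x \<in> topspace T"
    note ox = F.point_coverD(1)[OF W x]
    show "\<phi> (W x) (f x) \<in> carrier (G (W x))"
      using ox f(2)[OF x] by (rule map_closed)
    fix y assume y: "y \<in> topspace T"
    let ?V = "W x \<inter> W y"
    note oy = F.point_coverD(1)[OF W y]
    have oV: "openin T ?V" using ox oy by auto
    note c = F.cocycle_closed[OF Z(1) x y] F.cocycle_closed[OF Z(2) x y] f(2)[OF x] f(2)[OF y]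
    have s: "?V \<subseteq> U x \<inter> U y" "?V \<subseteq> U' x \<inter> U' y" "?V \<subseteq> W x" "?V \<subseteq> W y"
      using f(1)[OF x] f(1)[OF y] by auto
    show "r' (U' x \<inter> U' y) ?V (\<phi> (U' x \<inter> U' y) (g' x y)) \<otimes>\<^bsub>G ?V\<^esub> r' (W y) ?V (\<phi> (W y) (f y)) =
        r' (W x) ?V (\<phi> (W x) (f x)) \<otimes>\<^bsub>G ?V\<^esub> r' (U x \<inter> U y) ?V (\<phi> (U x \<inter> U y) (g x y))"
      using c ox oy oV s by (simp add: natural map_mult F.restr_closed eq[OF x y oV])
  qed
qed

end

section \<open>The sheaves of \<open>Proj\<close> of the differential forms\<close>

text \<open>For an open set \<open>V\<close>, the ring \<open>S V\<close> below is the sum of all \<open>\<O>\<^sub>\<Delta>(k)(V)\<close>, with \<open>\<O> V k\<close> its part of degree \<open>k\<close>. The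
  sheaf \<open>A\<close> is \<open>\<O>\<^sub>\<Delta>\<close> and \<open>Y\<close> is the dual curve.\<close>

locale proj_supercurve =
  fixes \<tau> :: topology_kind
    and \<Lambda> :: "'k super_ring" and \<iota> :: "complex \<Rightarrow> 'k"
    and X :: "('a, 'f, 'k) superspace"
    and \<Omega> :: "('a, 'f, 'w) forms"
    and \<Delta> :: "('a, 'w, 'l) proj"
  assumes base: "nilpotent_extension \<Lambda> \<iota>"
    and curve: "supercurve \<tau> \<Lambda> \<iota> X"
    and forms: "differential_forms \<tau> \<Lambda> \<iota> X \<Omega>"
    and proj: "is_proj \<tau> \<Lambda> \<iota> X \<Omega> \<Delta>"
begin

abbreviation "T \<equiv> topo X"
abbreviation "S \<equiv> sec \<Delta>"
abbreviation "res \<equiv> restr \<Delta>"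
abbreviation "\<O> \<equiv> degree_part \<Delta>"
abbreviation "loc \<equiv> localize \<Delta>"
abbreviation "d \<equiv> dtilde \<Delta>"
abbreviation "Y \<equiv> dual_curve X \<Omega> \<Delta>"
abbreviation "A \<equiv> O_Delta X \<Omega> \<Delta>"

lemma topo_forms [simp]: "topo \<Omega> = T"
  using forms by (simp add: differential_forms_def)

lemma topo_proj [simp]: "topo \<Delta> = T"
  using proj by (simp add: is_proj_def)

lemma scalars_ring_hom: "\<iota> \<in> ring_hom complex_ring \<Lambda>" "\<iota> a \<in> homog \<Lambda> False" "\<iota> a \<in> carrier \<Lambda>"
proof -
  show h: "\<iota> \<in> ring_hom complex_ring \<Lambda>" and "\<iota> a \<in> homog \<Lambda> False"
    using base by (auto simp: nilpotent_extension_def)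
  show "\<iota> a \<in> carrier \<Lambda>"
    using ring_hom_closed[OF h, of a] by (simp add: complex_ring_def)
qed

lemma superspace: "superspace_over \<Lambda> X"
  using curve by (simp add: supercurve_def)

lemma presheaf_curve: "super_presheaf X"
  using superspace by (simp add: superspace_over_def super_sheaf_def)

lemma cst_hom: "openin T V \<Longrightarrow> cst X V \<in> super_hom \<Lambda> (sec X V)"
  using superspace unfolding superspace_over_def by meson

lemma cst_restr:
  "openin T U \<Longrightarrow> openin T V \<Longrightarrow> V \<subseteq> U \<Longrightarrow> a \<in> carrier \<Lambda> \<Longrightarrow> restr X U V (cst X U a) = cst X V a"
  using superspace unfolding superspace_over_def by meson

lemma curve_ring: "openin T V \<Longrightarrow> supercommutative_ring (sec X V)"
  using presheaf_curve unfolding super_presheaf_def supercommutative_ring_def by meson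

lemma curve_restr_hom: "openin T U \<Longrightarrow> openin T V \<Longrightarrow> V \<subseteq> U \<Longrightarrow> restr X U V \<in> super_hom (sec X U) (sec X V)"
  using presheaf_curve unfolding super_presheaf_def by meson

lemma graded_forms: "graded_super_sheaf \<Omega>"
  using forms unfolding differential_forms_def by meson

lemma presheaf_forms: "super_presheaf \<Omega>"
  using graded_forms unfolding graded_super_sheaf_def by meson

lemma forms_ring: "openin T V \<Longrightarrow> supercommutative_ring (sec \<Omega> V)"
  using presheaf_forms unfolding super_presheaf_def supercommutative_ring_def topo_forms by meson

lemma forms_restr_hom: "openin T U \<Longrightarrow> openin T V \<Longrightarrow> V \<subseteq> U \<Longrightarrow> restr \<Omega> U V \<in> super_hom (sec \<Omega> U) (sec \<Omega> V)"
  using presheaf_forms unfolding super_presheaf_def topo_forms by meson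

lemma forms_restr_restr: "openin T U \<Longrightarrow> openin T V \<Longrightarrow> openin T W \<Longrightarrow> W \<subseteq> V \<Longrightarrow> V \<subseteq> U \<Longrightarrow>
    x \<in> carrier (sec \<Omega> U) \<Longrightarrow> restr \<Omega> V W (restr \<Omega> U V x) = restr \<Omega> U W x"
  using presheaf_forms unfolding super_presheaf_def topo_forms by meson

lemma forms_degree_subgroup: "openin T V \<Longrightarrow> subgroup (degree_part \<Omega> V k) (add_monoid (sec \<Omega> V))"
  using graded_forms unfolding graded_super_sheaf_def topo_forms by meson

lemma forms_degree_closed: "openin T V \<Longrightarrow> \<alpha> \<in> degree_part \<Omega> V k \<Longrightarrow> \<alpha> \<in> carrier (sec \<Omega> V)"
  using subgroup.subset[OF forms_degree_subgroup[of V k]] by auto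

lemma forms_degree_restr: "openin T U \<Longrightarrow> openin T V \<Longrightarrow> V \<subseteq> U \<Longrightarrow> \<alpha> \<in> degree_part \<Omega> U k \<Longrightarrow>
    restr \<Omega> U V \<alpha> \<in> degree_part \<Omega> V k"
  using graded_forms unfolding graded_super_sheaf_def topo_forms by (meson image_subset_iff)

lemma forms_degree_mult: "openin T V \<Longrightarrow> \<alpha> \<in> degree_part \<Omega> V k \<Longrightarrow> \<beta> \<in> degree_part \<Omega> V l \<Longrightarrow>
    \<alpha> \<otimes>\<^bsub>sec \<Omega> V\<^esub> \<beta> \<in> degree_part \<Omega> V (k + l)"
  using graded_forms unfolding graded_super_sheaf_def topo_forms by meson

lemma incl_hom: "openin T V \<Longrightarrow> incl \<Omega> V \<in> super_hom (sec X V) (sec \<Omega> V)"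
  using forms unfolding differential_forms_def by meson

lemma incl_degree: "openin T V \<Longrightarrow> f \<in> carrier (sec X V) \<Longrightarrow> incl \<Omega> V f \<in> degree_part \<Omega> V 0"
proof -
  assume "openin T V" "f \<in> carrier (sec X V)"
  moreover have "bij_betw (incl \<Omega> V) (carrier (sec X V)) (degree_part \<Omega> V 0)" if "openin T V"
    using forms that unfolding differential_forms_def by meson
  ultimately show ?thesis by (auto simp: bij_betw_def)
qed

lemma incl_restr: "openin T U \<Longrightarrow> openin T V \<Longrightarrow> V \<subseteq> U \<Longrightarrow> f \<in> carrier (sec X U) \<Longrightarrow>
    restr \<Omega> U V (incl \<Omega> U f) = incl \<Omega> V (restr X U V f)"
  using forms unfolding differential_forms_def by meson

lemma ext_d_derivation: "openin T V \<Longrightarrow> super_derivation (sec \<Omega> V) True (ext_d \<Omega> V)"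
  using forms unfolding differential_forms_def by meson

lemma ext_d_degree: "openin T V \<Longrightarrow> \<alpha> \<in> degree_part \<Omega> V k \<Longrightarrow> ext_d \<Omega> V \<alpha> \<in> degree_part \<Omega> V (k + 1)"
  using forms unfolding differential_forms_def by (meson image_subset_iff)

lemma ext_d_ext_d: "openin T V \<Longrightarrow> \<alpha> \<in> carrier (sec \<Omega> V) \<Longrightarrow> ext_d \<Omega> V (ext_d \<Omega> V \<alpha>) = \<zero>\<^bsub>sec \<Omega> V\<^esub>"
  using forms unfolding differential_forms_def by meson

lemma dfun_cst: "openin T V \<Longrightarrow> a \<in> carrier \<Lambda> \<Longrightarrow> dfun \<Omega> V (cst X V a) = \<zero>\<^bsub>sec \<Omega> V\<^esub>"
  using forms unfolding differential_forms_def by meson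

lemma ext_d_restr: "openin T U \<Longrightarrow> openin T V \<Longrightarrow> V \<subseteq> U \<Longrightarrow> \<alpha> \<in> carrier (sec \<Omega> U) \<Longrightarrow>
    restr \<Omega> U V (ext_d \<Omega> U \<alpha>) = ext_d \<Omega> V (restr \<Omega> U V \<alpha>)"
  using forms unfolding differential_forms_def by meson

lemma dfun_degree: "openin T V \<Longrightarrow> f \<in> carrier (sec X V) \<Longrightarrow> dfun \<Omega> V f \<in> degree_part \<Omega> V 1"
  using ext_d_degree[OF _ incl_degree, of V f] by (simp add: dfun_def)

lemma coordinates_closed:
  assumes "local_coordinates \<tau> \<Lambda> \<iota> X U z \<theta>"
  shows "openin T U" "\<theta> \<in> homog (sec X U) True" "z \<in> carrier (sec X U)"
proof -
  have "\<exists>B. product_over \<Lambda> \<iota> X U B \<theta> \<and> z \<in> B U"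
  proof (cases \<tau>)
    case Zariski
    then show ?thesis
      using assms unfolding local_coordinates_def zariski_coordinates_def etale_coordinate_def by auto
  next
    case Complex
    then obtain \<kappa> :: "'a \<Rightarrow> complex" and \<beta> :: "'a set \<Rightarrow> (complex \<Rightarrow> complex) \<Rightarrow> 'f"
      where "product_over \<Lambda> \<iota> X U (\<lambda>V. \<beta> V ` {f. f holomorphic_on \<kappa> ` V}) \<theta>" "z = \<beta> U (\<lambda>w. w)"
      using assms unfolding local_coordinates_def complex_coordinates_def by auto
    moreover have "\<beta> U (\<lambda>w. w) \<in> \<beta> U ` {f. f holomorphic_on \<kappa> ` U}"
      by (intro imageI CollectI holomorphic_on_ident)
    ultimately show ?thesis by blast
  qed
  then obtain B where B: "product_over \<Lambda> \<iota> X U B \<theta>" "z \<in> B U" by blast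
  then show "openin T U" "\<theta> \<in> homog (sec X U) True"
    unfolding product_over_def by meson+
  moreover have "openin T V \<and> V \<subseteq> U \<Longrightarrow> subring (B V) (sec X V)" for V
    using B(1) unfolding product_over_def by meson
  ultimately show "z \<in> carrier (sec X U)"
    using B(2) subringE(1)[of "B U" "sec X U"] by auto
qed

lemma coordinates_cover:
  assumes "x \<in> topspace T"
  obtains U z \<theta> where "x \<in> U" "local_coordinates \<tau> \<Lambda> \<iota> X U z \<theta>"
  using curve assms unfolding supercurve_def by meson

text \<open>The case \<open>k = 0\<close> of the condition that the forms of degree \<open>k + 1\<close> are free on \<open>d\<theta>\<^bsup>k+1\<^esup>\<close> and \<open>d\<theta>\<^bsup>k\<^esup> dz\<close>.\<close>

lemma one_forms_generated:
  assumes "local_coordinates \<tau> \<Lambda> \<iota> X U z \<theta>" "openin T V" "V \<subseteq> U" "\<alpha> \<in> degree_part \<Omega> V 1"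
  obtains a b where "a \<in> carrier (sec X V)" "b \<in> carrier (sec X V)"
    "\<alpha> = dfun \<Omega> V (restr X U V \<theta>) \<otimes>\<^bsub>sec \<Omega> V\<^esub> incl \<Omega> V a \<oplus>\<^bsub>sec \<Omega> V\<^esub>
         dfun \<Omega> V (restr X U V z) \<otimes>\<^bsub>sec \<Omega> V\<^esub> incl \<Omega> V b"
proof -
  let ?R = "sec \<Omega> V" and ?dz = "dfun \<Omega> V (restr X U V z)" and ?d\<theta> = "dfun \<Omega> V (restr X U V \<theta>)"
  have "\<forall>V k. openin T V \<and> V \<subseteq> U \<longrightarrow>
           (let R = sec \<Omega> V; dz = dfun \<Omega> V (restr X U V z); d\<theta> = dfun \<Omega> V (restr X U V \<theta>) in
            \<forall>\<alpha>\<in>degree_part \<Omega> V (int k + 1). \<exists>!ab. ab \<in> carrier (sec X V) \<times> carrier (sec X V) \<and>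
              \<alpha> = (d\<theta> [^]\<^bsub>R\<^esub> (k + 1)) \<otimes>\<^bsub>R\<^esub> incl \<Omega> V (fst ab) \<oplus>\<^bsub>R\<^esub>
                  (d\<theta> [^]\<^bsub>R\<^esub> k) \<otimes>\<^bsub>R\<^esub> dz \<otimes>\<^bsub>R\<^esub> incl \<Omega> V (snd ab))"
    using forms assms(1) unfolding differential_forms_def by meson
  from this[rule_format, of V 0, unfolded Let_def] assms(2,3)
  have "\<forall>\<alpha>\<in>degree_part \<Omega> V 1. \<exists>!ab. ab \<in> carrier (sec X V) \<times> carrier (sec X V) \<and>
     \<alpha> = \<one>\<^bsub>?R\<^esub> \<otimes>\<^bsub>?R\<^esub> ?d\<theta> \<otimes>\<^bsub>?R\<^esub> incl \<Omega> V (fst ab) \<oplus>\<^bsub>?R\<^esub> \<one>\<^bsub>?R\<^esub> \<otimes>\<^bsub>?R\<^esub> ?dz \<otimes>\<^bsub>?R\<^esub> incl \<Omega> V (snd ab)"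
    by simp
  from ex1_implies_ex[OF bspec[OF this assms(4)]] obtain ab
    where ab: "ab \<in> carrier (sec X V) \<times> carrier (sec X V)"
      "\<alpha> = \<one>\<^bsub>?R\<^esub> \<otimes>\<^bsub>?R\<^esub> ?d\<theta> \<otimes>\<^bsub>?R\<^esub> incl \<Omega> V (fst ab) \<oplus>\<^bsub>?R\<^esub> \<one>\<^bsub>?R\<^esub> \<otimes>\<^bsub>?R\<^esub> ?dz \<otimes>\<^bsub>?R\<^esub> incl \<Omega> V (snd ab)"
    by blast
  interpret R: supercommutative_ring ?R
    using forms_ring assms(2) .
  note coord = coordinates_closed[OF assms(1)]
  interpret X: supercommutative_ring "sec X U"
    using curve_ring coord(1) .
  have "restr X U V f \<in> carrier (sec X V)" if "f \<in> carrier (sec X U)" for f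
    using ring_hom_closed[OF super_homD(1)[OF curve_restr_hom[OF coord(1) assms(2,3)]] that] .
  then have "?d\<theta> \<in> carrier ?R" "?dz \<in> carrier ?R"
    using coord by (auto intro!: forms_degree_closed[OF assms(2) dfun_degree[OF assms(2)]])
  moreover have "incl \<Omega> V f \<in> carrier ?R" if "f \<in> carrier (sec X V)" for f
    using forms_degree_closed[OF assms(2) incl_degree[OF assms(2) that]] .
  ultimately show ?thesis
    using that[of "fst ab" "snd ab"] ab by (simp add: mem_Times_iff)
qed

lemma graded_proj: "graded_super_sheaf \<Delta>"
  using proj unfolding is_proj_def by meson

lemma presheaf_proj: "super_presheaf \<Delta>"
  using graded_proj unfolding graded_super_sheaf_def by meson

lemma proj_ring: "openin T V \<Longrightarrow> supercommutative_ring (S V)"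
  using presheaf_proj unfolding super_presheaf_def supercommutative_ring_def topo_proj by meson

lemma res_hom: "openin T U \<Longrightarrow> openin T V \<Longrightarrow> V \<subseteq> U \<Longrightarrow> res U V \<in> super_hom (S U) (S V)"
  using presheaf_proj unfolding super_presheaf_def topo_proj by meson

lemma res_id: "openin T U \<Longrightarrow> x \<in> carrier (S U) \<Longrightarrow> res U U x = x"
  using presheaf_proj unfolding super_presheaf_def topo_proj by meson

lemma res_res: "openin T U \<Longrightarrow> openin T V \<Longrightarrow> openin T W \<Longrightarrow> W \<subseteq> V \<Longrightarrow> V \<subseteq> U \<Longrightarrow>
    x \<in> carrier (S U) \<Longrightarrow> res V W (res U V x) = res U W x"
  using presheaf_proj unfolding super_presheaf_def topo_proj by meson

lemma degree_subgroup: "openin T V \<Longrightarrow> subgroup (\<O> V k) (add_monoid (S V))"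
  using graded_proj unfolding graded_super_sheaf_def topo_proj by meson

lemma one_degree: "openin T V \<Longrightarrow> \<one>\<^bsub>S V\<^esub> \<in> \<O> V 0"
  using graded_proj unfolding graded_super_sheaf_def topo_proj by meson

lemma degree_mult: "openin T V \<Longrightarrow> x \<in> \<O> V k \<Longrightarrow> y \<in> \<O> V l \<Longrightarrow>
    x \<otimes>\<^bsub>S V\<^esub> y \<in> \<O> V (k + l)"
  using graded_proj unfolding graded_super_sheaf_def topo_proj by meson

lemma degree_decomposition: "openin T V \<Longrightarrow> x \<in> carrier (S V) \<Longrightarrow>
    \<exists>!f. (\<forall>k. f k \<in> \<O> V k) \<and> finite {k. f k \<noteq> \<zero>\<^bsub>S V\<^esub>} \<and>
           x = finsum (S V) f {k. f k \<noteq> \<zero>\<^bsub>S V\<^esub>}"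
  by (rule graded_proj[unfolded graded_super_sheaf_def topo_proj, THEN conjunct2, THEN conjunct1,
        THEN spec, THEN mp, THEN conjunct2, THEN conjunct2, THEN conjunct2, THEN conjunct1, THEN bspec])

lemma degree_parts: "openin T V \<Longrightarrow> a \<in> homog (S V) False \<Longrightarrow> b \<in> homog (S V) True \<Longrightarrow>
    a \<oplus>\<^bsub>S V\<^esub> b \<in> \<O> V k \<Longrightarrow> a \<in> \<O> V k \<and> b \<in> \<O> V k"
  using graded_proj unfolding graded_super_sheaf_def topo_proj by meson

lemma res_degree: "openin T U \<Longrightarrow> openin T V \<Longrightarrow> V \<subseteq> U \<Longrightarrow> x \<in> \<O> U k \<Longrightarrow>
    res U V x \<in> \<O> V k"
  using graded_proj unfolding graded_super_sheaf_def topo_proj by (meson image_subset_iff)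

lemma degree_gluing: "gluing T (\<lambda>U. \<O> U k) res"
  using graded_proj unfolding graded_super_sheaf_def topo_proj by meson

lemma localize_hom: "openin T V \<Longrightarrow> loc V \<in> super_hom (sec \<Omega> V) (S V)"
  using proj unfolding is_proj_def by meson

lemma localize_degree: "openin T V \<Longrightarrow> \<alpha> \<in> degree_part \<Omega> V k \<Longrightarrow> loc V \<alpha> \<in> \<O> V k"
  using proj unfolding is_proj_def by (meson image_subset_iff)

lemma dtilde_derivation: "openin T V \<Longrightarrow> super_derivation (S V) True (d V)"
  using proj unfolding is_proj_def by meson

lemma dtilde_degree: "openin T V \<Longrightarrow> x \<in> \<O> V k \<Longrightarrow> d V x \<in> \<O> V (k + 1)"
  using proj unfolding is_proj_def by (meson image_subset_iff)

lemma dtilde_localize: "openin T V \<Longrightarrow> \<alpha> \<in> carrier (sec \<Omega> V) \<Longrightarrow>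
    d V (loc V \<alpha>) = loc V (ext_d \<Omega> V \<alpha>)"
  using proj unfolding is_proj_def by meson

lemma localize_restr: "openin T U \<Longrightarrow> openin T V \<Longrightarrow> V \<subseteq> U \<Longrightarrow> \<alpha> \<in> carrier (sec \<Omega> U) \<Longrightarrow>
    res U V (loc U \<alpha>) = loc V (restr \<Omega> U V \<alpha>)"
  using proj unfolding is_proj_def by meson

lemma dtilde_restr: "openin T U \<Longrightarrow> openin T V \<Longrightarrow> V \<subseteq> U \<Longrightarrow> x \<in> carrier (S U) \<Longrightarrow>
    res U V (d U x) = d V (res U V x)"
  using proj unfolding is_proj_def by meson

lemma dtheta_localization:
  assumes "local_coordinates \<tau> \<Lambda> \<iota> X U z \<theta>" "openin T V" "V \<subseteq> U"
  shows "loc V (dfun \<Omega> V (restr X U V \<theta>)) \<in> Units (S V)"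
    and "s \<in> \<O> V k \<Longrightarrow> \<exists>n::nat. \<exists>\<alpha>\<in>degree_part \<Omega> V (k + int n).
      s \<otimes>\<^bsub>S V\<^esub> (loc V (dfun \<Omega> V (restr X U V \<theta>)) [^]\<^bsub>S V\<^esub> n) = loc V \<alpha>"
  using proj assms unfolding is_proj_def Let_def by meson+

definition scalar :: "'a set \<Rightarrow> complex \<Rightarrow> 'l" where
  "scalar V a = pull_fun \<Omega> \<Delta> V (cst X V (\<iota> a))"

lemma pull_hom: "openin T V \<Longrightarrow> pull_fun \<Omega> \<Delta> V \<in> super_hom (sec X V) (S V)"
proof -
  assume V: "openin T V"
  have "loc V \<circ> incl \<Omega> V \<in> ring_hom (sec X V) (S V)"
    using super_homD(1)[OF incl_hom[OF V]] super_homD(1)[OF localize_hom[OF V]] by (rule ring_hom_trans)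
  moreover have "pull_fun \<Omega> \<Delta> V = loc V \<circ> incl \<Omega> V"
    by (auto simp: pull_fun_def)
  ultimately show ?thesis
    using super_homD(2)[OF incl_hom[OF V]] super_homD(2)[OF localize_hom[OF V]]
    unfolding super_hom_def by auto
qed

lemma pull_degree: "openin T V \<Longrightarrow> f \<in> carrier (sec X V) \<Longrightarrow> pull_fun \<Omega> \<Delta> V f \<in> \<O> V 0"
  unfolding pull_fun_def by (intro localize_degree incl_degree)

lemma pull_restr:
  assumes "openin T U" "openin T V" "V \<subseteq> U" "f \<in> carrier (sec X U)"
  shows "res U V (pull_fun \<Omega> \<Delta> U f) = pull_fun \<Omega> \<Delta> V (restr X U V f)"
  unfolding pull_fun_def
  using assms localize_restr[OF assms(1-3) forms_degree_closed[OF assms(1) incl_degree]] incl_restr by simp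

lemma dtilde_pull:
  assumes "openin T V" "f \<in> carrier (sec X V)"
  shows "d V (pull_fun \<Omega> \<Delta> V f) = loc V (dfun \<Omega> V f)"
  unfolding pull_fun_def dfun_def
  by (intro dtilde_localize forms_degree_closed[OF _ incl_degree] assms)

lemma cst_closed: "openin T V \<Longrightarrow> a \<in> carrier \<Lambda> \<Longrightarrow> cst X V a \<in> carrier (sec X V)"
  using ring_hom_closed[OF super_homD(1)[OF cst_hom]] .

lemma localize_zero:
  assumes V: "openin T V"
  shows "loc V \<zero>\<^bsub>sec \<Omega> V\<^esub> = \<zero>\<^bsub>S V\<^esub>"
proof -
  interpret O: supercommutative_ring "sec \<Omega> V"
    using forms_ring[OF V] .
  interpret S: supercommutative_ring "S V"
    using proj_ring[OF V] .
  show ?thesis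
    by (rule ring_hom_zero_neg(1)[OF O.ring_axioms S.ring_axioms super_homD(1)[OF localize_hom[OF V]]])
qed

lemma dtilde_pull_cst:
  assumes "openin T V" "a \<in> carrier \<Lambda>"
  shows "d V (pull_fun \<Omega> \<Delta> V (cst X V a)) = \<zero>\<^bsub>S V\<^esub>"
  using assms by (simp add: dtilde_pull cst_closed dfun_cst localize_zero)

lemma scalar_facts:
  assumes V: "openin T V"
  shows "scalar V a \<in> \<O> V 0" "scalar V a \<in> homog (S V) False"
    "d V (scalar V a) = \<zero>\<^bsub>S V\<^esub>" "scalar V \<in> ring_hom complex_ring (S V)"
proof -
  note \<iota> = scalars_ring_hom(2,3)[of a]
  show "scalar V a \<in> \<O> V 0"
    unfolding scalar_def by (intro pull_degree cst_closed V \<iota>)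
  show "scalar V a \<in> homog (S V) False"
    unfolding scalar_def by (intro super_homD(2)[OF pull_hom[OF V]] super_homD(2)[OF cst_hom[OF V]] \<iota>)
  show "d V (scalar V a) = \<zero>\<^bsub>S V\<^esub>"
    unfolding scalar_def by (intro dtilde_pull_cst V \<iota>)
  have "pull_fun \<Omega> \<Delta> V \<circ> (cst X V \<circ> \<iota>) \<in> ring_hom complex_ring (S V)"
    by (intro ring_hom_trans[OF _ super_homD(1)[OF pull_hom[OF V]]]
          ring_hom_trans[OF scalars_ring_hom(1) super_homD(1)[OF cst_hom[OF V]]])
  moreover have "scalar V = pull_fun \<Omega> \<Delta> V \<circ> (cst X V \<circ> \<iota>)"
    by (auto simp: scalar_def)
  ultimately show "scalar V \<in> ring_hom complex_ring (S V)" by simp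
qed

lemma scalar_restr:
  assumes "openin T U" "openin T V" "V \<subseteq> U"
  shows "res U V (scalar U a) = scalar V a"
  unfolding scalar_def using assms scalars_ring_hom(3)[of a]
  by (simp add: pull_restr cst_closed cst_restr)

lemma proj_algebra:
  assumes V: "openin T V"
  shows "odd_derivation_over_C (S V) (d V) (scalar V)"
proof -
  interpret S: supercommutative_ring "S V"
    using proj_ring[OF V] .
  show ?thesis
  proof (intro odd_derivation_over_C.intro odd_derivation.intro odd_derivation_axioms.intro
      complex_algebra.intro complex_algebra_axioms.intro)
    show "super_derivation (S V) True (d V)"
      using dtilde_derivation[OF V] .
    show "scalar V \<in> ring_hom complex_ring (S V)"
      using scalar_facts(4)[OF V] .
    show "scalar V a \<otimes>\<^bsub>S V\<^esub> x = x \<otimes>\<^bsub>S V\<^esub> scalar V a" if "x \<in> carrier (S V)" for x a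
      using S.even_central[OF scalar_facts(2)[OF V] that] .
  qed (intro S.supercommutative_ring_axioms S.ring_axioms)+
qed

lemma degree_closed [simp]: "openin T V \<Longrightarrow> x \<in> \<O> V k \<Longrightarrow> x \<in> carrier (S V)"
  using subgroup.subset[OF degree_subgroup[of V k]] by auto

lemma degree_add: "openin T V \<Longrightarrow> x \<in> \<O> V k \<Longrightarrow> y \<in> \<O> V k \<Longrightarrow>
    x \<oplus>\<^bsub>S V\<^esub> y \<in> \<O> V k"
  using subgroup.m_closed[OF degree_subgroup[of V k]] by auto

lemma degree_zero: "openin T V \<Longrightarrow> \<zero>\<^bsub>S V\<^esub> \<in> \<O> V k"
  using subgroup.one_closed[OF degree_subgroup[of V k]] by auto

lemma degree_neg: "openin T V \<Longrightarrow> x \<in> \<O> V k \<Longrightarrow> \<ominus>\<^bsub>S V\<^esub> x \<in> \<O> V k"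
  using subgroup.m_inv_closed[OF degree_subgroup[of V k]] by (auto simp: a_inv_def)

lemma degree_minus: "openin T V \<Longrightarrow> x \<in> \<O> V k \<Longrightarrow> y \<in> \<O> V k \<Longrightarrow>
    x \<ominus>\<^bsub>S V\<^esub> y \<in> \<O> V k"
  unfolding a_minus_def by (intro degree_add degree_neg)

lemma degree_zero_mult: "openin T V \<Longrightarrow> x \<in> \<O> V 0 \<Longrightarrow> y \<in> \<O> V k \<Longrightarrow>
    x \<otimes>\<^bsub>S V\<^esub> y \<in> \<O> V k"
  using degree_mult[of V x 0 y k] by simp

context
  fixes U V assumes UV: "openin T U" "openin T V" "V \<subseteq> U"
begin

interpretation SU: supercommutative_ring "S U"
  using proj_ring[OF UV(1)] .
interpretation SV: supercommutative_ring "S V"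
  using proj_ring[OF UV(2)] .

lemma res_ring_hom: "res U V \<in> ring_hom (S U) (S V)"
  using super_homD(1)[OF res_hom[OF UV]] .

lemma res_closed: "x \<in> carrier (S U) \<Longrightarrow> res U V x \<in> carrier (S V)"
  using ring_hom_closed[OF res_ring_hom] .

lemma res_homog: "x \<in> homog (S U) p \<Longrightarrow> res U V x \<in> homog (S V) p"
  using super_homD(2)[OF res_hom[OF UV]] .

lemma res_mult: "x \<in> carrier (S U) \<Longrightarrow> y \<in> carrier (S U) \<Longrightarrow>
    res U V (x \<otimes>\<^bsub>S U\<^esub> y) = res U V x \<otimes>\<^bsub>S V\<^esub> res U V y"
  using ring_hom_mult[OF res_ring_hom] .

lemma res_add: "x \<in> carrier (S U) \<Longrightarrow> y \<in> carrier (S U) \<Longrightarrow>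
    res U V (x \<oplus>\<^bsub>S U\<^esub> y) = res U V x \<oplus>\<^bsub>S V\<^esub> res U V y"
  using ring_hom_add[OF res_ring_hom] .

lemma res_one: "res U V \<one>\<^bsub>S U\<^esub> = \<one>\<^bsub>S V\<^esub>"
  using ring_hom_one[OF res_ring_hom] .

lemma res_zero: "res U V \<zero>\<^bsub>S U\<^esub> = \<zero>\<^bsub>S V\<^esub>"
  using ring_hom_zero_neg(1)[OF SU.ring_axioms SV.ring_axioms res_ring_hom] .

lemma res_neg: "x \<in> carrier (S U) \<Longrightarrow> res U V (\<ominus>\<^bsub>S U\<^esub> x) = \<ominus>\<^bsub>S V\<^esub> res U V x"
  using ring_hom_zero_neg(2)[OF SU.ring_axioms SV.ring_axioms res_ring_hom] .

lemma res_minus: "x \<in> carrier (S U) \<Longrightarrow> y \<in> carrier (S U) \<Longrightarrow>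
    res U V (x \<ominus>\<^bsub>S U\<^esub> y) = res U V x \<ominus>\<^bsub>S V\<^esub> res U V y"
  unfolding a_minus_def by (simp add: res_add res_neg)

end

lemma degree_glue:
  assumes \<U>: "\<And>U. U \<in> \<U> \<Longrightarrow> openin T U" "\<And>U. U \<in> \<U> \<Longrightarrow> s U \<in> \<O> U k"
    and "\<And>U V. U \<in> \<U> \<Longrightarrow> V \<in> \<U> \<Longrightarrow> res U (U \<inter> V) (s U) = res V (U \<inter> V) (s V)"
  shows "\<exists>!t. t \<in> \<O> (\<Union>\<U>) k \<and> (\<forall>U\<in>\<U>. res (\<Union>\<U>) U t = s U)"
proof -
  have "(\<forall>U\<in>\<U>. openin T U \<and> s U \<in> \<O> U k) \<longrightarrow>
        (\<forall>U\<in>\<U>. \<forall>V\<in>\<U>. res U (U \<inter> V) (s U) = res V (U \<inter> V) (s V)) \<longrightarrow>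
        (\<exists>!t. t \<in> \<O> (\<Union>\<U>) k \<and> (\<forall>U\<in>\<U>. res (\<Union>\<U>) U t = s U))"
    using degree_gluing[of k, unfolded gluing_def, THEN spec, THEN spec] .
  moreover have "\<forall>U\<in>\<U>. openin T U \<and> s U \<in> \<O> U k"
    using \<U> by blast
  moreover have "\<forall>U\<in>\<U>. \<forall>V\<in>\<U>. res U (U \<inter> V) (s U) = res V (U \<inter> V) (s V)"
    by (intro ballI assms(3))
  ultimately show ?thesis by (elim impE)
qed

lemma degree_separated:
  assumes \<U>: "\<And>U. U \<in> \<U> \<Longrightarrow> openin T U" and st: "s \<in> \<O> (\<Union>\<U>) k" "t \<in> \<O> (\<Union>\<U>) k"
    and eq: "\<And>U. U \<in> \<U> \<Longrightarrow> res (\<Union>\<U>) U s = res (\<Union>\<U>) U t"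
  shows "s = t"
proof -
  have V: "openin T (\<Union>\<U>)" using \<U> by auto
  have "\<exists>!t. t \<in> \<O> (\<Union>\<U>) k \<and> (\<forall>U\<in>\<U>. res (\<Union>\<U>) U t = res (\<Union>\<U>) U s)"
  proof (rule degree_glue)
    fix A assume A: "A \<in> \<U>"
    then show "openin T A" by (rule \<U>)
    then show "res (\<Union>\<U>) A s \<in> \<O> A k"
      using V A st(1) by (intro res_degree) auto
    fix B assume B: "B \<in> \<U>"
    have AB: "openin T A" "openin T B" "openin T (A \<inter> B)"
      using \<U> A B by auto
    have s: "s \<in> carrier (S (\<Union>\<U>))"
      using st V degree_closed by blast
    show "res A (A \<inter> B) (res (\<Union>\<U>) A s) = res B (A \<inter> B) (res (\<Union>\<U>) B s)"
      using res_res[OF V AB(1,3) Int_lower1 Union_upper[OF A] s]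
        res_res[OF V AB(2,3) Int_lower2 Union_upper[OF B] s] by simp
  qed
  then show ?thesis
    by (rule ex1_eq) (intro conjI ballI st eq[symmetric] refl; assumption)+
qed

text \<open>Compare the homogeneous components in \<open>y u = 1\<close>: that of degree 0 reads \<open>y u\<^bsub>-1\<^esub> = 1\<close>, and \<open>y\<close> has only one
  inverse.\<close>

lemma inverse_degree:
  assumes V: "openin T V" and y: "y \<in> \<O> V 1" "y \<in> homog (S V) False"
    and u: "u \<in> carrier (S V)" "y \<otimes>\<^bsub>S V\<^esub> u = \<one>\<^bsub>S V\<^esub>"
  shows "u \<in> \<O> V (-1)"
proof -
  interpret S: supercommutative_ring "S V"
    using proj_ring[OF V] .
  let ?S = "S V"
  have uy: "u \<otimes>\<^bsub>?S\<^esub> y = \<one>\<^bsub>?S\<^esub>"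
    using S.even_inverse(2)[OF y(2) u] .
  obtain f where f: "\<And>k. f k \<in> \<O> V k" "finite {k. f k \<noteq> \<zero>\<^bsub>?S\<^esub>}"
    "u = finsum ?S f {k. f k \<noteq> \<zero>\<^bsub>?S\<^esub>}"
    using ex1_implies_ex[OF degree_decomposition[OF V u(1)]] that by (elim exE conjE) (rule that; simp)
  have fc: "f k \<in> carrier ?S" for k
    using degree_closed[OF V f(1)] .
  \<comment> \<open>Two decompositions of 1 into homogeneous components: the products of \<open>y\<close> with the components of \<open>u\<close>, and the trivial one.\<close>
  let ?g = "\<lambda>k. y \<otimes>\<^bsub>?S\<^esub> f (k - 1)" and ?h = "\<lambda>k::int. if k = 0 then \<one>\<^bsub>?S\<^esub> else \<zero>\<^bsub>?S\<^esub>"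
  have g0: "?g k = \<zero>\<^bsub>?S\<^esub> \<longleftrightarrow> f (k - 1) = \<zero>\<^bsub>?S\<^esub>" for k
  proof
    assume "?g k = \<zero>\<^bsub>?S\<^esub>"
    then have "(u \<otimes>\<^bsub>?S\<^esub> y) \<otimes>\<^bsub>?S\<^esub> f (k - 1) = \<zero>\<^bsub>?S\<^esub>"
      using u y fc by (simp add: S.m_assoc)
    then show "f (k - 1) = \<zero>\<^bsub>?S\<^esub>"
      using uy fc by simp
  qed (use y in simp)
  have gd: "?g k \<in> \<O> V k" for k
    using degree_mult[OF V y(1) f(1)[of "k - 1"]] by simp
  have supp: "{k. ?g k \<noteq> \<zero>\<^bsub>?S\<^esub>} = (\<lambda>k. k + 1) ` {k. f k \<noteq> \<zero>\<^bsub>?S\<^esub>}"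
    unfolding g0 by (auto simp: image_iff intro!: exI[of _ "_ - 1"])
  have "finsum ?S ?g {k. ?g k \<noteq> \<zero>\<^bsub>?S\<^esub>} = finsum ?S (\<lambda>k. ?g (k + 1)) {k. f k \<noteq> \<zero>\<^bsub>?S\<^esub>}"
    unfolding supp using y fc by (intro S.finsum_reindex) (auto simp: inj_on_def)
  also have "\<dots> = y \<otimes>\<^bsub>?S\<^esub> u"
    using f(2) y fc by (simp add: f(3) S.finsum_rdistr Pi_def)
  finally have g: "(\<forall>k. ?g k \<in> \<O> V k) \<and> finite {k. ?g k \<noteq> \<zero>\<^bsub>?S\<^esub>} \<and>
      \<one>\<^bsub>?S\<^esub> = finsum ?S ?g {k. ?g k \<noteq> \<zero>\<^bsub>?S\<^esub>}"
    using u(2) gd f(2) unfolding supp by simp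
  have "{k. ?h k \<noteq> \<zero>\<^bsub>?S\<^esub>} \<subseteq> {0}" by auto
  then have "finsum ?S ?h {k. ?h k \<noteq> \<zero>\<^bsub>?S\<^esub>} = finsum ?S ?h {0}"
    by (intro S.add.finprod_mono_neutral_cong_left) auto
  then have h: "(\<forall>k. ?h k \<in> \<O> V k) \<and> finite {k. ?h k \<noteq> \<zero>\<^bsub>?S\<^esub>} \<and>
      \<one>\<^bsub>?S\<^esub> = finsum ?S ?h {k. ?h k \<noteq> \<zero>\<^bsub>?S\<^esub>}"
    using one_degree[OF V] degree_zero[OF V] by (simp add: finite_subset[of _ "{0}"] S.finsum_insert)
  have "?g = ?h"
    by (rule ex1_eq[OF degree_decomposition[OF V S.one_closed], of ?g ?h]) (rule g, rule h)
  then have "y \<otimes>\<^bsub>?S\<^esub> f (-1) = \<one>\<^bsub>?S\<^esub>"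
    by (auto dest: fun_cong[of _ _ 0])
  then have "u \<otimes>\<^bsub>?S\<^esub> (y \<otimes>\<^bsub>?S\<^esub> f (-1)) = u"
    using u by simp
  then have "(u \<otimes>\<^bsub>?S\<^esub> y) \<otimes>\<^bsub>?S\<^esub> f (-1) = u"
    using u(1) y(2) fc by (simp add: S.m_assoc)
  then have "f (-1) = u"
    using uy fc by simp
  then show ?thesis
    using f(1)[of "-1"] by simp
qed

end

section \<open>Charts\<close>

context proj_supercurve
begin

text \<open>What is used of coordinates \<open>(z, \<theta>)\<close>: \<open>t\<close> is the pullback of \<open>\<theta>\<close> and \<open>u\<close> the inverse of \<open>d\<theta>\<close>. The conditions
  that \<open>d~\<^sup>2 = 0\<close> and that one-forms are sums of two products \<open>df \<cdot> a\<close> are imposed on all smaller open sets, so that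
  charts can be restricted although \<open>z\<close> and \<open>\<theta>\<close> are not part of the data.\<close>

definition chart :: "'a set \<Rightarrow> 'l \<Rightarrow> 'l \<Rightarrow> bool" where
  "chart U t u \<longleftrightarrow> openin T U \<and> t \<in> \<O> U 0 \<and> t \<in> homog (S U) True \<and>
     u \<in> \<O> U (-1) \<and> u \<in> homog (S U) False \<and>
     d U t \<otimes>\<^bsub>S U\<^esub> u = \<one>\<^bsub>S U\<^esub> \<and>
     (\<forall>V. openin T V \<and> V \<subseteq> U \<longrightarrow>
        (\<forall>k. \<forall>s\<in>\<O> V k. d V (d V s) = \<zero>\<^bsub>S V\<^esub>) \<and>
        (\<forall>\<alpha>\<in>degree_part \<Omega> V 1. \<exists>f\<in>carrier (sec X V). \<exists>g\<in>carrier (sec X V).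
           \<exists>a\<in>carrier (sec X V). \<exists>b\<in>carrier (sec X V).
           \<alpha> = dfun \<Omega> V f \<otimes>\<^bsub>sec \<Omega> V\<^esub> incl \<Omega> V a \<oplus>\<^bsub>sec \<Omega> V\<^esub> dfun \<Omega> V g \<otimes>\<^bsub>sec \<Omega> V\<^esub> incl \<Omega> V b))"

lemma chartD:
  assumes "chart U t u"
  shows "openin T U" "t \<in> \<O> U 0" "t \<in> homog (S U) True"
     "u \<in> \<O> U (-1)" "u \<in> homog (S U) False"
     "d U t \<otimes>\<^bsub>S U\<^esub> u = \<one>\<^bsub>S U\<^esub>"
  using assms unfolding chart_def by meson+

lemma dtilde_dtilde:
  "chart U t u \<Longrightarrow> openin T V \<Longrightarrow> V \<subseteq> U \<Longrightarrow> s \<in> \<O> V k \<Longrightarrow>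
     d V (d V s) = \<zero>\<^bsub>S V\<^esub>"
  unfolding chart_def by meson

lemma chart_generated:
  assumes "chart U t u" "\<alpha> \<in> degree_part \<Omega> U 1"
  obtains f g a b where "f \<in> carrier (sec X U)" "g \<in> carrier (sec X U)" "a \<in> carrier (sec X U)"
    "b \<in> carrier (sec X U)"
    "\<alpha> = dfun \<Omega> U f \<otimes>\<^bsub>sec \<Omega> U\<^esub> incl \<Omega> U a \<oplus>\<^bsub>sec \<Omega> U\<^esub> dfun \<Omega> U g \<otimes>\<^bsub>sec \<Omega> U\<^esub> incl \<Omega> U b"
  using assms unfolding chart_def by (meson subset_refl)

lemma chart_restr:
  assumes c: "chart U t u" and V: "openin T V" "V \<subseteq> U"
  shows "chart V (res U V t) (res U V u)"
proof -
  note C = chartD[OF c] and h = chartD(1)[OF c] V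
  interpret U: odd_derivation_over_C "S U" "d U" "scalar U"
    using proj_algebra[OF C(1)] .
  have "d V (res U V t) \<otimes>\<^bsub>S V\<^esub> res U V u
      = res U V (d U t \<otimes>\<^bsub>S U\<^esub> u)"
    using C(1-5) by (subst res_mult[OF h]) (simp_all add: dtilde_restr[OF h])
  also have "\<dots> = \<one>\<^bsub>S V\<^esub>"
    by (simp only: C(6) res_one[OF h])
  finally have 1: "d V (res U V t) \<otimes>\<^bsub>S V\<^esub> res U V u = \<one>\<^bsub>S V\<^esub>" .
  have "W \<subseteq> U" if "W \<subseteq> V" for W
    using that V by auto
  then show ?thesis
    using c 1 C V res_degree[OF h] res_homog[OF h] unfolding chart_def by meson
qed

text \<open>A section of \<open>\<O>\<^sub>\<Delta>(k)\<close> times a power of \<open>d\<theta>\<close> is a differential form, on which \<open>d\<^sup>2 = 0\<close>; as \<open>d\<theta>\<close> is even, closed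
  and invertible, \<open>d~\<^sup>2 = 0\<close> on the section itself.\<close>

lemma coordinates_chart:
  assumes c: "local_coordinates \<tau> \<Lambda> \<iota> X U z \<theta>"
  shows "\<exists>t u. chart U t u"
proof -
  note C = coordinates_closed[OF c]
  define \<theta>r where "\<theta>r V = restr X U V \<theta>" for V
  define y where "y V = loc V (dfun \<Omega> V (\<theta>r V))" for V
  interpret X: supercommutative_ring "sec X U"
    using curve_ring[OF C(1)] .
  have zX: "restr X U V z \<in> carrier (sec X V)" if "openin T V" "V \<subseteq> U" for V
    using ring_hom_closed[OF super_homD(1)[OF curve_restr_hom[OF C(1) that]] C(3)] .
  have \<theta>: "\<theta>r V \<in> homog (sec X V) True" "\<theta>r V \<in> carrier (sec X V)" if "openin T V" "V \<subseteq> U" for V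
    unfolding \<theta>r_def using ring_hom_closed[OF super_homD(1)[OF curve_restr_hom[OF C(1) that]]]
      super_homD(2)[OF curve_restr_hom[OF C(1) that]] C(2) by auto
  have y_eq: "y V = d V (pull_fun \<Omega> \<Delta> V (\<theta>r V))" if "openin T V" "V \<subseteq> U" for V
    using dtilde_pull[OF that(1) \<theta>(2)[OF that]] by (simp add: y_def)
  have y: "y V \<in> Units (S V)" "y V \<in> \<O> V 1" "y V \<in> homog (S V) False"
    "d V (y V) = \<zero>\<^bsub>S V\<^esub>" if V: "openin T V" "V \<subseteq> U" for V
  proof -
    interpret S: odd_derivation_over_C "S V" "d V" "scalar V"
      using proj_algebra[OF V(1)] .
    show "y V \<in> Units (S V)"
      unfolding y_def \<theta>r_def using dtheta_localization(1)[OF c V] .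
    show "y V \<in> \<O> V 1"
      unfolding y_def by (intro localize_degree dfun_degree V \<theta>)
    have "pull_fun \<Omega> \<Delta> V (\<theta>r V) \<in> homog (S V) True"
      by (intro super_homD(2)[OF pull_hom[OF V(1)]] \<theta> V)
    then show "y V \<in> homog (S V) False"
      using y_eq[OF V] by auto
    have "incl \<Omega> V (\<theta>r V) \<in> carrier (sec \<Omega> V)"
      by (intro forms_degree_closed[OF V(1) incl_degree[OF V(1)]] \<theta> V)
    moreover have "dfun \<Omega> V (\<theta>r V) \<in> carrier (sec \<Omega> V)"
      by (intro forms_degree_closed[OF V(1) dfun_degree[OF V(1)]] \<theta> V)
    ultimately show "d V (y V) = \<zero>\<^bsub>S V\<^esub>"
      using V(1) unfolding y_def by (simp add: dtilde_localize dfun_def ext_d_ext_d localize_zero)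
  qed
  interpret S: odd_derivation_over_C "S U" "d U" "scalar U"
    using proj_algebra[OF C(1)] .
  let ?u = "inv\<^bsub>S U\<^esub> (y U)"
  note yU = y[OF C(1) subset_refl]
  have u: "?u \<in> carrier (S U)" "y U \<otimes>\<^bsub>S U\<^esub> ?u = \<one>\<^bsub>S U\<^esub>"
    using yU(1) by auto
  have sq: "d V (d V s) = \<zero>\<^bsub>S V\<^esub>"
    if V: "openin T V" "V \<subseteq> U" and s: "s \<in> \<O> V k" for V s k
  proof -
    interpret SV: odd_derivation_over_C "S V" "d V" "scalar V"
      using proj_algebra[OF V(1)] .
    let ?S = "S V" and ?d = "d V"
    obtain n :: nat and \<alpha> where n: "\<alpha> \<in> degree_part \<Omega> V (k + int n)"
      "s \<otimes>\<^bsub>?S\<^esub> (y V [^]\<^bsub>?S\<^esub> n) = loc V \<alpha>"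
      using dtheta_localization(2)[OF c V s] unfolding y_def \<theta>r_def by blast
    have \<alpha>: "\<alpha> \<in> carrier (sec \<Omega> V)" "ext_d \<Omega> V \<alpha> \<in> carrier (sec \<Omega> V)"
      using forms_degree_closed[OF V(1)] n(1) ext_d_degree[OF V(1)] by blast+
    have sc: "s \<in> carrier ?S" using degree_closed[OF V(1) s] .
    have yn: "y V [^]\<^bsub>?S\<^esub> m \<in> homog ?S False \<and> ?d (y V [^]\<^bsub>?S\<^esub> m) = \<zero>\<^bsub>?S\<^esub>" for m :: nat
      by (induction m) (use y[OF V] in \<open>simp_all add: SV.deriv_even_mult\<close>)
    let ?p = "y V [^]\<^bsub>?S\<^esub> n"
    have p: "?p \<in> homog ?S False" "?d ?p = \<zero>\<^bsub>?S\<^esub>" using yn[of n] by auto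
    have dp: "?d (?p \<otimes>\<^bsub>?S\<^esub> x) = ?p \<otimes>\<^bsub>?S\<^esub> ?d x" if "x \<in> carrier ?S" for x
      using that p by (simp add: SV.deriv_even_mult)
    have "?p \<otimes>\<^bsub>?S\<^esub> s = loc V \<alpha>"
      using n(2) SV.even_central[OF p(1) sc] by simp
    then have "?p \<otimes>\<^bsub>?S\<^esub> ?d (?d s) = ?d (?d (loc V \<alpha>))"
      using sc by (simp add: dp[symmetric])
    also have "\<dots> = ?p \<otimes>\<^bsub>?S\<^esub> \<zero>\<^bsub>?S\<^esub>"
      using \<alpha> V(1) p by (simp add: dtilde_localize ext_d_ext_d localize_zero)
    finally show ?thesis
      using SV.Units_l_cancel[OF SV.Units_pow_closed[OF y(1)[OF V], of n]] sc by simp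
  qed
  have gen: "\<exists>f\<in>carrier (sec X V). \<exists>g\<in>carrier (sec X V). \<exists>a\<in>carrier (sec X V). \<exists>b\<in>carrier (sec X V).
      \<alpha> = dfun \<Omega> V f \<otimes>\<^bsub>sec \<Omega> V\<^esub> incl \<Omega> V a \<oplus>\<^bsub>sec \<Omega> V\<^esub> dfun \<Omega> V g \<otimes>\<^bsub>sec \<Omega> V\<^esub> incl \<Omega> V b"
    if V: "openin T V" "V \<subseteq> U" and \<alpha>: "\<alpha> \<in> degree_part \<Omega> V 1" for V \<alpha>
  proof -
    obtain a b where ab: "a \<in> carrier (sec X V)" "b \<in> carrier (sec X V)"
      "\<alpha> = dfun \<Omega> V (restr X U V \<theta>) \<otimes>\<^bsub>sec \<Omega> V\<^esub> incl \<Omega> V a \<oplus>\<^bsub>sec \<Omega> V\<^esub>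
         dfun \<Omega> V (restr X U V z) \<otimes>\<^bsub>sec \<Omega> V\<^esub> incl \<Omega> V b"
      using one_forms_generated[OF c V \<alpha>] .
    show ?thesis
      by (rule bexI[OF _ \<theta>(2)[OF V, unfolded \<theta>r_def]], rule bexI[OF _ zX[OF V]],
          rule bexI[OF _ ab(1)], rule bexI[OF _ ab(2)], rule ab(3))
  qed
  have "chart U (pull_fun \<Omega> \<Delta> U (\<theta>r U)) ?u"
    unfolding chart_def
  proof (intro conjI allI impI ballI)
    show "pull_fun \<Omega> \<Delta> U (\<theta>r U) \<in> \<O> U 0"
      by (intro pull_degree \<theta> C(1) subset_refl)
    show "pull_fun \<Omega> \<Delta> U (\<theta>r U) \<in> homog (S U) True"
      by (intro super_homD(2)[OF pull_hom[OF C(1)]] \<theta> C(1) subset_refl)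
    show "?u \<in> \<O> U (- 1)"
      by (rule inverse_degree[OF C(1) yU(2,3) u])
    show "?u \<in> homog (S U) False"
      by (rule S.even_inverse(1)[OF yU(3) u])
    show "d U (pull_fun \<Omega> \<Delta> U (\<theta>r U)) \<otimes>\<^bsub>S U\<^esub> ?u = \<one>\<^bsub>S U\<^esub>"
      using u(2) y_eq[OF C(1) subset_refl] by simp
  next
    fix V k s assume "openin T V \<and> V \<subseteq> U" "s \<in> \<O> V k"
    then show "d V (d V s) = \<zero>\<^bsub>S V\<^esub>"
      by (elim conjE) (rule sq)
  next
    fix V \<alpha> assume "openin T V \<and> V \<subseteq> U" "\<alpha> \<in> degree_part \<Omega> V 1"
    then show "\<exists>f\<in>carrier (sec X V). \<exists>g\<in>carrier (sec X V). \<exists>a\<in>carrier (sec X V). \<exists>b\<in>carrier (sec X V).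
      \<alpha> = dfun \<Omega> V f \<otimes>\<^bsub>sec \<Omega> V\<^esub> incl \<Omega> V a \<oplus>\<^bsub>sec \<Omega> V\<^esub> dfun \<Omega> V g \<otimes>\<^bsub>sec \<Omega> V\<^esub> incl \<Omega> V b"
      by (elim conjE) (rule gen)
  qed (rule C(1))
  then show ?thesis by blast
qed

lemma charts_cover:
  assumes "x \<in> topspace T"
  shows "\<exists>U t u. x \<in> U \<and> chart U t u"
proof -
  obtain U z \<theta> where "x \<in> U" "local_coordinates \<tau> \<Lambda> \<iota> X U z \<theta>"
    using coordinates_cover[OF assms] .
  with coordinates_chart[of U z \<theta>] show ?thesis by blast
qed

text \<open>Differentiate \<open>d~ t \<cdot> u = 1\<close>, using \<open>d~ (d~ t) = 0\<close>.\<close>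

lemma dtilde_inverse_dt:
  assumes "chart U t u"
  shows "d U u = \<zero>\<^bsub>S U\<^esub>"
proof -
  note C = chartD[OF assms]
  interpret S: odd_derivation_over_C "S U" "d U" "scalar U"
    using proj_algebra[OF C(1)] .
  let ?S = "S U" and ?d = "d U"
  have dt: "?d t \<in> homog ?S False" using C by auto
  have "?d (?d t \<otimes>\<^bsub>?S\<^esub> u) = ?d t \<otimes>\<^bsub>?S\<^esub> ?d u"
    using C dt dtilde_dtilde[OF assms C(1) subset_refl C(2)] by (subst S.deriv_even_mult) auto
  then have "?d t \<otimes>\<^bsub>?S\<^esub> ?d u = \<zero>\<^bsub>?S\<^esub>"
    unfolding C(6) by simp
  then have "(u \<otimes>\<^bsub>?S\<^esub> ?d t) \<otimes>\<^bsub>?S\<^esub> ?d u = \<zero>\<^bsub>?S\<^esub>"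
    using C dt by (simp add: S.m_assoc)
  then show ?thesis
    using S.even_inverse(2)[OF dt _ C(6)] C(5) by simp
qed

lemma charts_union:
  assumes V: "openin T V"
  shows "\<Union>{W. W \<subseteq> V \<and> (\<exists>t u. chart W t u)} = V"
proof (intro equalityI subsetI)
  fix x assume x: "x \<in> V"
  then have "x \<in> topspace T" using openin_subset[OF V] by auto
  then obtain U t u where U: "x \<in> U" "chart U t u" using charts_cover by blast
  have "openin T (U \<inter> V)" using chartD(1)[OF U(2)] V by auto
  then have "U \<inter> V \<in> {W. W \<subseteq> V \<and> (\<exists>t u. chart W t u)}" using chart_restr[OF U(2)] by auto
  then show "x \<in> \<Union>{W. W \<subseteq> V \<and> (\<exists>t u. chart W t u)}" using x U by blast
qed auto

lemma local_eqI:
  assumes V: "openin T V" and st: "s \<in> \<O> V k" "s' \<in> \<O> V k"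
    and eq: "\<And>W t u. chart W t u \<Longrightarrow> W \<subseteq> V \<Longrightarrow> res V W s = res V W s'"
  shows "s = s'"
proof -
  let ?\<U> = "{W. W \<subseteq> V \<and> (\<exists>t u. chart W t u)}"
  show ?thesis
    by (rule degree_separated[of ?\<U> s k s']) (use st eq chartD(1) in \<open>auto simp: charts_union[OF V]\<close>)
qed

end

section \<open>Vertical fields and contractions\<close>

context proj_supercurve
begin

lemma O_Delta_simps [simp]:
  "topo A = T" "sec A V = sub_super (S V) (\<O> V 0)"
  "restr A = res" "cst A V a = pull_fun \<Omega> \<Delta> V (cst X V a)"
  by (simp_all add: O_Delta_def)

abbreviation closed_functions :: "'a set \<Rightarrow> 'l set" where
  "closed_functions V \<equiv> {s \<in> \<O> V 0. d V s = \<zero>\<^bsub>S V\<^esub>}"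

abbreviation "dual_ring V \<equiv> sub_super (S V) (closed_functions V)"

lemma dual_curve_simps [simp]:
  "topo Y = T" "sec Y V = sub_super (S V) (closed_functions V)"
  "restr Y = res" "cst Y V a = pull_fun \<Omega> \<Delta> V (cst X V a)"
  by (simp_all add: dual_curve_def)

lemma degree_zero_ring:
  assumes V: "openin T V"
  shows "supercommutative_ring (sub_super (S V) (\<O> V 0))"
proof -
  interpret S: supercommutative_ring "S V"
    using proj_ring[OF V] .
  have "subring (\<O> V 0) (S V)"
    using degree_closed[OF V] one_degree[OF V] degree_neg[OF V] degree_zero_mult[OF V] degree_add[OF V]
    by (intro S.subringI) auto
  then show ?thesis
    using degree_parts[OF V] by (intro supercommutative_ring.intro S.supercomm_ring_sub_super) auto
qed

lemma closed_functions_ring: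
  assumes V: "openin T V"
  shows "supercommutative_ring (dual_ring V)"
proof -
  interpret S: odd_derivation_over_C "S V" "d V" "scalar V"
    using proj_algebra[OF V] .
  let ?S = "S V" and ?d = "d V"
  have c: "x \<in> closed_functions V \<longleftrightarrow> x \<in> \<O> V 0 \<and> S.flat \<zero>\<^bsub>?S\<^esub> x" for x
    using degree_closed[OF V, of x 0] by (auto simp: S.flat_def)
  have "subring (closed_functions V) ?S"
  proof (rule S.subringI)
    show "closed_functions V \<subseteq> carrier ?S"
      using degree_closed[OF V] by auto
    show "\<one>\<^bsub>?S\<^esub> \<in> closed_functions V"
      using one_degree[OF V] by simp
    fix x assume x: "x \<in> closed_functions V"
    show "\<ominus>\<^bsub>?S\<^esub> x \<in> closed_functions V"
      using x degree_neg[OF V] S.flat_neg[of "\<zero>\<^bsub>?S\<^esub>" x] unfolding c by auto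
    fix y assume y: "y \<in> closed_functions V"
    show "x \<oplus>\<^bsub>?S\<^esub> y \<in> closed_functions V"
      using x y degree_add[OF V] S.flat_add[of "\<zero>\<^bsub>?S\<^esub>" x y] unfolding c by auto
    show "x \<otimes>\<^bsub>?S\<^esub> y \<in> closed_functions V"
      using x y degree_closed[OF V] degree_zero_mult[OF V] S.flat_scale[of "\<zero>\<^bsub>?S\<^esub>" x y]
      by (auto simp: S.flat_def)
  qed
  then show ?thesis
  proof (intro supercommutative_ring.intro S.supercomm_ring_sub_super)
    fix a b assume ab: "a \<in> homog ?S False" "b \<in> homog ?S True" "a \<oplus>\<^bsub>?S\<^esub> b \<in> closed_functions V"
    then show "a \<in> closed_functions V \<and> b \<in> closed_functions V"
      using degree_parts[OF V ab(1,2)] S.flat_parts[OF _ ab(1,2), of "\<zero>\<^bsub>?S\<^esub>"] unfolding c by auto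
  qed
qed

text \<open>The relation \<open>v = a d~\<close> on all of \<open>U\<close>, for a section \<open>a\<close> of \<open>\<O>\<^sub>\<Delta>(-1)\<close>.\<close>

definition field_factor :: "('a set \<Rightarrow> 'l \<Rightarrow> 'l) \<Rightarrow> 'a set \<Rightarrow> 'l \<Rightarrow> bool" where
  "field_factor v U a \<longleftrightarrow> a \<in> \<O> U (-1) \<and>
     (\<forall>V. openin T V \<and> V \<subseteq> U \<longrightarrow>
        (\<forall>g\<in>\<O> V 0. v V g = res U V a \<otimes>\<^bsub>S V\<^esub> d V g))"

lemma field_factorD:
  assumes "field_factor v U a"
  shows "a \<in> \<O> U (-1)"
    and "openin T V \<Longrightarrow> V \<subseteq> U \<Longrightarrow> g \<in> \<O> V 0 \<Longrightarrow> v V g = res U V a \<otimes>\<^bsub>S V\<^esub> d V g"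
  using assms by (simp_all add: field_factor_def)

lemma field_factor_restr:
  assumes f: "field_factor v U a" and UV: "openin T U" "openin T V" "V \<subseteq> U"
  shows "field_factor v V (res U V a)"
  unfolding field_factor_def
proof (intro conjI allI impI ballI)
  show "res U V a \<in> \<O> V (-1)"
    using res_degree[OF UV field_factorD(1)[OF f]] .
  fix W g assume "openin T W \<and> W \<subseteq> V" and g: "g \<in> \<O> W 0"
  then have W: "openin T W" "W \<subseteq> V" by auto
  have "res V W (res U V a) = res U W a"
    using res_res[OF UV(1,2) W(1,2) UV(3) degree_closed[OF UV(1) field_factorD(1)[OF f]]] .
  then show "v W g = res V W (res U V a) \<otimes>\<^bsub>S W\<^esub> d W g"
    using field_factorD(2)[OF f W(1) _ g] W(2) UV(3) by auto
qed

text \<open>Evaluate the field on \<open>t\<close>.\<close>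

lemma field_factor_unique:
  assumes c: "chart U t u" and "field_factor v U a"
  shows "a = v U t \<otimes>\<^bsub>S U\<^esub> u"
proof -
  note C = chartD[OF c]
  interpret S: odd_derivation_over_C "S U" "d U" "scalar U"
    using proj_algebra[OF C(1)] .
  have a: "a \<in> carrier (S U)"
    using degree_closed[OF C(1) field_factorD(1)[OF assms(2)]] .
  have "v U t = a \<otimes>\<^bsub>S U\<^esub> d U t"
    using field_factorD(2)[OF assms(2) C(1) subset_refl C(2)] res_id[OF C(1) a] by simp
  then have "v U t \<otimes>\<^bsub>S U\<^esub> u = a \<otimes>\<^bsub>S U\<^esub> (d U t \<otimes>\<^bsub>S U\<^esub> u)"
    using a C(1-5) by (simp add: S.m_assoc)
  then show ?thesis
    unfolding C(6) using a by simp
qed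

lemma vertical_fieldD:
  assumes "vertical_field \<Lambda> X \<Omega> \<Delta> V p v" "openin T W" "W \<subseteq> V"
  shows "super_derivation (sub_super (S W) (\<O> W 0)) p (v W)"
    and "s \<in> \<O> W 0 \<Longrightarrow> d W s = \<zero>\<^bsub>S W\<^esub> \<Longrightarrow> v W s = \<zero>\<^bsub>S W\<^esub>"
    and "openin T W' \<Longrightarrow> W' \<subseteq> W \<Longrightarrow> s \<in> \<O> W 0 \<Longrightarrow> res W W' (v W s) = v W' (res W W' s)"
proof -
  have v: "vector_field \<Lambda> A V p v"
    using assms(1) unfolding vertical_field_def by (rule conjunct1)
  then show "super_derivation (sub_super (S W) (\<O> W 0)) p (v W)"
    using assms(2,3) unfolding vector_field_def O_Delta_simps by meson
  show "res W W' (v W s) = v W' (res W W' s)"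
    if "openin T W'" "W' \<subseteq> W" "s \<in> \<O> W 0"
    using v assms(2,3) that unfolding vector_field_def O_Delta_simps sub_super_simps by meson
  show "v W s = \<zero>\<^bsub>S W\<^esub>" if "s \<in> \<O> W 0" "d W s = \<zero>\<^bsub>S W\<^esub>"
    using assms that unfolding vertical_field_def by simp
qed

text \<open>On a chart \<open>\<O>\<^sub>\<Delta>\<close> is generated by \<open>t\<close> over the closed functions: in \<open>g = (g - t e) + t e\<close> with \<open>e = u d~ g\<close> both
  \<open>e\<close> and \<open>g - t e\<close> are closed. A vertical field kills them, so it maps \<open>g\<close> to \<open>(v t) e\<close>.\<close>

lemma vertical_field_chart:
  assumes v: "vertical_field \<Lambda> X \<Omega> \<Delta> W p v" and c: "chart U t u" and UW: "U \<subseteq> W"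
    and g: "g \<in> \<O> U 0"
  shows "v U t \<in> \<O> U 0" "v U g = (v U t \<otimes>\<^bsub>S U\<^esub> u) \<otimes>\<^bsub>S U\<^esub> d U g"
proof -
  note C = chartD[OF c]
  let ?S = "S U" and ?d = "d U" and ?O = "sub_super (S U) (\<O> U 0)"
  interpret S: odd_derivation_over_C ?S ?d "scalar U"
    using proj_algebra[OF C(1)] .
  interpret O: supercommutative_ring ?O
    using degree_zero_ring[OF C(1)] .
  note V = vertical_fieldD[OF v C(1) UW]
  have v_closed: "v U x \<in> \<O> U 0" if "x \<in> \<O> U 0" for x
    using V(1) that by (simp add: super_derivation_def)
  then show vt: "v U t \<in> \<O> U 0"
    using C(2) .
  have v_add: "v U (x \<oplus>\<^bsub>?S\<^esub> y) = v U x \<oplus>\<^bsub>?S\<^esub> v U y" if "x \<in> \<O> U 0" "y \<in> \<O> U 0" for x y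
    using V(1) that by (simp add: super_derivation_def)
  have v_mult: "v U (t \<otimes>\<^bsub>?S\<^esub> y) = v U t \<otimes>\<^bsub>?S\<^esub> y \<oplus>\<^bsub>?S\<^esub> ssgn ?O p (t \<otimes>\<^bsub>?S\<^esub> v U y)"
    if "y \<in> \<O> U 0" for y
  proof -
    have "\<forall>q. \<forall>x\<in>homog ?O q. \<forall>y\<in>carrier ?O.
        v U (x \<otimes>\<^bsub>?O\<^esub> y) = v U x \<otimes>\<^bsub>?O\<^esub> y \<oplus>\<^bsub>?O\<^esub> ssgn ?O (p \<and> q) (x \<otimes>\<^bsub>?O\<^esub> v U y)"
      using V(1) unfolding super_derivation_def by (elim conjE)
    from this[THEN spec[of _ True]] show ?thesis
      using C(2,3) that by simp
  qed
  let ?e = "u \<otimes>\<^bsub>?S\<^esub> ?d g"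
  have gc: "g \<in> carrier ?S" "?d g \<in> carrier ?S" "t \<in> carrier ?S" "u \<in> carrier ?S"
    using degree_closed[OF C(1)] g C by auto
  have e: "?e \<in> \<O> U 0"
    using degree_mult[OF C(1,4) dtilde_degree[OF C(1) g]] by simp
  have de: "?d ?e = \<zero>\<^bsub>?S\<^esub>"
    using gc dtilde_inverse_dt[OF c] dtilde_dtilde[OF c C(1) subset_refl g]
    by (simp add: S.deriv_even_mult[OF C(5)])
  have ec: "?e \<in> carrier ?S"
    using gc by auto
  have te: "t \<otimes>\<^bsub>?S\<^esub> ?e \<in> \<O> U 0"
    using degree_zero_mult[OF C(1,2) e] .
  have dte: "?d (t \<otimes>\<^bsub>?S\<^esub> ?e) = ?d g"
  proof -
    have "?d (t \<otimes>\<^bsub>?S\<^esub> ?e) = ?d t \<otimes>\<^bsub>?S\<^esub> ?e"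
      using gc ec by (simp add: S.deriv_odd_mult[OF C(3)] de S.minus_eq)
    also have "\<dots> = (?d t \<otimes>\<^bsub>?S\<^esub> u) \<otimes>\<^bsub>?S\<^esub> ?d g"
      using gc by (simp add: S.m_assoc)
    also have "\<dots> = ?d g"
      unfolding C(6) using gc by simp
    finally show ?thesis .
  qed
  let ?r = "g \<ominus>\<^bsub>?S\<^esub> t \<otimes>\<^bsub>?S\<^esub> ?e"
  have r: "?r \<in> \<O> U 0"
    using degree_minus[OF C(1) g te] .
  have "?d ?r = \<zero>\<^bsub>?S\<^esub>"
    using gc ec S.deriv_minus[of g "t \<otimes>\<^bsub>?S\<^esub> ?e"] by (simp add: dte S.minus_eq S.r_neg)
  then have vr: "v U ?r = \<zero>\<^bsub>?S\<^esub>"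
    using V(2)[OF r] by simp
  have ve: "v U ?e = \<zero>\<^bsub>?S\<^esub>"
    using V(2)[OF e de] .
  have "ssgn ?O p (t \<otimes>\<^bsub>?S\<^esub> v U ?e) = \<zero>\<^bsub>?S\<^esub>"
    unfolding ve using gc O.minus_zero by (simp add: ssgn_def)
  then have vte: "v U (t \<otimes>\<^bsub>?S\<^esub> ?e) = v U t \<otimes>\<^bsub>?S\<^esub> ?e"
    using v_mult[OF e] degree_closed[OF C(1) vt] ec by simp
  have "?r \<oplus>\<^bsub>?S\<^esub> t \<otimes>\<^bsub>?S\<^esub> ?e = g"
    using gc ec by (simp add: S.minus_eq S.a_assoc S.l_neg)
  then have "v U g = v U ?r \<oplus>\<^bsub>?S\<^esub> v U (t \<otimes>\<^bsub>?S\<^esub> ?e)"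
    using v_add[OF r te] by simp
  also have "\<dots> = v U t \<otimes>\<^bsub>?S\<^esub> ?e"
    unfolding vr vte using degree_closed[OF C(1) vt] ec by simp
  also have "\<dots> = (v U t \<otimes>\<^bsub>?S\<^esub> u) \<otimes>\<^bsub>?S\<^esub> ?d g"
    using degree_closed[OF C(1) vt] gc by (simp add: S.m_assoc)
  finally show "v U g = (v U t \<otimes>\<^bsub>?S\<^esub> u) \<otimes>\<^bsub>?S\<^esub> ?d g" .
qed

lemma vertical_field_factor_chart:
  assumes v: "vertical_field \<Lambda> X \<Omega> \<Delta> W p v" and c: "chart U t u" and UW: "U \<subseteq> W"
  shows "field_factor v U (v U t \<otimes>\<^bsub>S U\<^esub> u)"
  unfolding field_factor_def
proof (intro conjI allI impI ballI)
  note C = chartD[OF c]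
  have vt: "v U t \<in> \<O> U 0"
    using vertical_field_chart(1)[OF v c UW C(2)] .
  show "v U t \<otimes>\<^bsub>S U\<^esub> u \<in> \<O> U (-1)"
    using degree_zero_mult[OF C(1) vt C(4)] .
  fix V g assume "openin T V \<and> V \<subseteq> U" and g: "g \<in> \<O> V 0"
  then have V: "openin T V" "V \<subseteq> U" by auto
  have "res U V (v U t \<otimes>\<^bsub>S U\<^esub> u) = v V (res U V t) \<otimes>\<^bsub>S V\<^esub> res U V u"
    using res_mult[OF C(1) V degree_closed[OF C(1) vt] degree_closed[OF C(1,4)]]
      vertical_fieldD(3)[OF v C(1) UW V C(2)] by simp
  then show "v V g = res U V (v U t \<otimes>\<^bsub>S U\<^esub> u) \<otimes>\<^bsub>S V\<^esub> d V g"
    using vertical_field_chart(2)[OF v chart_restr[OF c V] _ g] V UW by simp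
qed

text \<open>The factors on charts agree on overlaps by uniqueness, and so glue to a section of \<open>\<O>\<^sub>\<Delta>(-1)\<close>.\<close>

lemma vertical_field_factor:
  assumes v: "vertical_field \<Lambda> X \<Omega> \<Delta> W p v" and W: "openin T W"
  shows "\<exists>a. field_factor v W a"
proof -
  let ?\<U> = "{U. U \<subseteq> W \<and> (\<exists>t u. chart U t u)}"
  note U = charts_union[OF W]
  define s where "s U = (SOME a. field_factor v U a)" for U
  have s: "field_factor v U (s U)" if "U \<in> ?\<U>" for U
  proof -
    from that obtain t u where "chart U t u" "U \<subseteq> W" by auto
    from vertical_field_factor_chart[OF v this] show ?thesis
      unfolding s_def by (rule someI)
  qed
  have oU: "openin T U" if "U \<in> ?\<U>" for U
    using that by (auto dest: chartD(1))
  have "\<exists>!a. a \<in> \<O> (\<Union>?\<U>) (-1) \<and> (\<forall>U\<in>?\<U>. res (\<Union>?\<U>) U a = s U)"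
  proof (rule degree_glue)
    show "openin T U" if "U \<in> ?\<U>" for U
      using that by (rule oU)
    show "s U \<in> \<O> U (-1)" if "U \<in> ?\<U>" for U
      using field_factorD(1)[OF s[OF that]] .
    fix A B assume A: "A \<in> ?\<U>" and B: "B \<in> ?\<U>"
    have AB: "openin T A" "openin T B" "openin T (A \<inter> B)"
      using oU[OF A] oU[OF B] by auto
    obtain t u where "chart A t u" using A by auto
    then have c: "chart (A \<inter> B) (res A (A \<inter> B) t) (res A (A \<inter> B) u)"
      by (rule chart_restr) (use AB in auto)
    show "res A (A \<inter> B) (s A) = res B (A \<inter> B) (s B)"
      using field_factor_unique[OF c field_factor_restr[OF s[OF A] AB(1,3) Int_lower1]]
        field_factor_unique[OF c field_factor_restr[OF s[OF B] AB(2,3) Int_lower2]] by simp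
  qed
  then have "\<exists>a. a \<in> \<O> W (-1) \<and> (\<forall>U\<in>?\<U>. res W U a = s U)"
    unfolding U by (rule ex1_implies_ex)
  then obtain a where a: "a \<in> \<O> W (-1)" and aU: "\<forall>U\<in>?\<U>. res W U a = s U"
    by (elim exE conjE)
  have "field_factor v W a"
    unfolding field_factor_def
  proof (intro conjI allI impI ballI a)
    fix V g assume "openin T V \<and> V \<subseteq> W" and g: "g \<in> \<O> V 0"
    then have V: "openin T V" "V \<subseteq> W" by auto
    have vg: "v V g \<in> \<O> V 0"
      using vertical_fieldD(1)[OF v V] g by (simp add: super_derivation_def)
    have ra: "res W V a \<in> \<O> V (-1)"
      using res_degree[OF W V a] .
    show "v V g = res W V a \<otimes>\<^bsub>S V\<^esub> d V g"
    proof (rule local_eqI[OF V(1) vg])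
      show "res W V a \<otimes>\<^bsub>S V\<^esub> d V g \<in> \<O> V 0"
        using degree_mult[OF V(1) ra dtilde_degree[OF V(1) g]] by simp
      fix U t u assume U: "chart U t u" "U \<subseteq> V"
      note oU = chartD(1)[OF U(1)]
      have UU: "U \<in> ?\<U>" using U V by blast
      have gU: "res V U g \<in> \<O> U 0"
        using res_degree[OF V(1) oU U(2) g] .
      have "res V U (v V g) = v U (res V U g)"
        using vertical_fieldD(3)[OF v V oU U(2) g] .
      also have "\<dots> = s U \<otimes>\<^bsub>S U\<^esub> d U (res V U g)"
        using field_factorD(2)[OF s[OF UU] oU subset_refl gU]
          res_id[OF oU degree_closed[OF oU field_factorD(1)[OF s[OF UU]]]] by simp
      also have "s U = res V U (res W V a)"
        using bspec[OF aU UU] res_res[OF W V(1) oU U(2) V(2) degree_closed[OF W a]] by simp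
      also have "d U (res V U g) = res V U (d V g)"
        using dtilde_restr[OF V(1) oU U(2) degree_closed[OF V(1) g]] by simp
      also have "res V U (res W V a) \<otimes>\<^bsub>S U\<^esub> res V U (d V g) =
          res V U (res W V a \<otimes>\<^bsub>S V\<^esub> d V g)"
        using res_mult[OF V(1) oU U(2) degree_closed[OF V(1) ra] degree_closed[OF V(1) dtilde_degree[OF V(1) g]]]
        by simp
      finally show "res V U (v V g) = res V U (res W V a \<otimes>\<^bsub>S V\<^esub> d V g)" .
    qed
  qed
  then show ?thesis by blast
qed

lemma localize_mult: "openin T V \<Longrightarrow> \<alpha> \<in> carrier (sec \<Omega> V) \<Longrightarrow> \<beta> \<in> carrier (sec \<Omega> V) \<Longrightarrow>
    loc V (\<alpha> \<otimes>\<^bsub>sec \<Omega> V\<^esub> \<beta>) = loc V \<alpha> \<otimes>\<^bsub>S V\<^esub> loc V \<beta>"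
  using ring_hom_mult[OF super_homD(1)[OF localize_hom]] .

lemma localize_add: "openin T V \<Longrightarrow> \<alpha> \<in> carrier (sec \<Omega> V) \<Longrightarrow> \<beta> \<in> carrier (sec \<Omega> V) \<Longrightarrow>
    loc V (\<alpha> \<oplus>\<^bsub>sec \<Omega> V\<^esub> \<beta>) = loc V \<alpha> \<oplus>\<^bsub>S V\<^esub> loc V \<beta>"
  using ring_hom_add[OF super_homD(1)[OF localize_hom]] .

lemma localize_closed: "openin T V \<Longrightarrow> \<alpha> \<in> carrier (sec \<Omega> V) \<Longrightarrow> loc V \<alpha> \<in> carrier (S V)"
  using ring_hom_closed[OF super_homD(1)[OF localize_hom]] .

lemma incl_closed: "openin T V \<Longrightarrow> f \<in> carrier (sec X V) \<Longrightarrow> incl \<Omega> V f \<in> carrier (sec \<Omega> V)"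
  using forms_degree_closed[OF _ incl_degree] .

lemma dfun_closed: "openin T V \<Longrightarrow> f \<in> carrier (sec X V) \<Longrightarrow> dfun \<Omega> V f \<in> carrier (sec \<Omega> V)"
  using forms_degree_closed[OF _ dfun_degree] .

text \<open>If \<open>v = a d~\<close>, then \<open>\<alpha> \<mapsto> a \<alpha>\<close> is right linear and maps \<open>df\<close> to \<open>a d~ f = v f\<close>. That \<open>a\<close> exists on all of \<open>W\<close>
  makes the contraction exist there, not only on charts.\<close>

lemma is_contraction_field_factor:
  assumes W: "openin T W" and f: "field_factor v W a"
  shows "is_contraction X \<Omega> \<Delta> W v (\<lambda>V \<alpha>. res W V a \<otimes>\<^bsub>S V\<^esub> loc V \<alpha>)"
  unfolding is_contraction_def
proof (intro allI impI)
  fix V assume "openin T V \<and> V \<subseteq> W"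
  then have V: "openin T V" "V \<subseteq> W" by auto
  interpret S: supercommutative_ring "S V"
    using proj_ring[OF V(1)] .
  let ?a = "res W V a"
  have a: "?a \<in> \<O> V (-1)"
    using res_degree[OF W V field_factorD(1)[OF f]] .
  note ac = degree_closed[OF V(1) a]
  show "(\<forall>\<alpha>\<in>degree_part \<Omega> V 1. ?a \<otimes>\<^bsub>S V\<^esub> loc V \<alpha> \<in> \<O> V 0 \<and>
         (\<forall>\<beta>\<in>degree_part \<Omega> V 1. ?a \<otimes>\<^bsub>S V\<^esub> loc V (\<alpha> \<oplus>\<^bsub>sec \<Omega> V\<^esub> \<beta>) =
             ?a \<otimes>\<^bsub>S V\<^esub> loc V \<alpha> \<oplus>\<^bsub>S V\<^esub> ?a \<otimes>\<^bsub>S V\<^esub> loc V \<beta>) \<and>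
         (\<forall>f\<in>carrier (sec X V). ?a \<otimes>\<^bsub>S V\<^esub> loc V (\<alpha> \<otimes>\<^bsub>sec \<Omega> V\<^esub> incl \<Omega> V f) =
             ?a \<otimes>\<^bsub>S V\<^esub> loc V \<alpha> \<otimes>\<^bsub>S V\<^esub> pull_fun \<Omega> \<Delta> V f) \<and>
         (\<forall>W'. openin T W' \<and> W' \<subseteq> V \<longrightarrow> res V W' (?a \<otimes>\<^bsub>S V\<^esub> loc V \<alpha>) =
             res W W' a \<otimes>\<^bsub>S W'\<^esub> loc W' (restr \<Omega> V W' \<alpha>))) \<and>
      (\<forall>f\<in>carrier (sec X V). ?a \<otimes>\<^bsub>S V\<^esub> loc V (dfun \<Omega> V f) = v V (pull_fun \<Omega> \<Delta> V f))"
  proof (intro conjI ballI allI impI)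
    fix \<alpha> assume \<alpha>: "\<alpha> \<in> degree_part \<Omega> V 1"
    note \<alpha>c = forms_degree_closed[OF V(1) \<alpha>]
    have l\<alpha>: "loc V \<alpha> \<in> carrier (S V)"
      using localize_closed[OF V(1) \<alpha>c] .
    show "?a \<otimes>\<^bsub>S V\<^esub> loc V \<alpha> \<in> \<O> V 0"
      using degree_mult[OF V(1) a localize_degree[OF V(1) \<alpha>]] by simp
    show "?a \<otimes>\<^bsub>S V\<^esub> loc V (\<alpha> \<oplus>\<^bsub>sec \<Omega> V\<^esub> \<beta>) =
        ?a \<otimes>\<^bsub>S V\<^esub> loc V \<alpha> \<oplus>\<^bsub>S V\<^esub> ?a \<otimes>\<^bsub>S V\<^esub> loc V \<beta>"
      if "\<beta> \<in> degree_part \<Omega> V 1" for \<beta>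
      using localize_add[OF V(1) \<alpha>c forms_degree_closed[OF V(1) that]]
        localize_closed[OF V(1) forms_degree_closed[OF V(1) that]] ac l\<alpha> by (simp add: S.r_distr)
    show "?a \<otimes>\<^bsub>S V\<^esub> loc V (\<alpha> \<otimes>\<^bsub>sec \<Omega> V\<^esub> incl \<Omega> V f) =
             ?a \<otimes>\<^bsub>S V\<^esub> loc V \<alpha> \<otimes>\<^bsub>S V\<^esub> pull_fun \<Omega> \<Delta> V f"
      if "f \<in> carrier (sec X V)" for f
      using localize_mult[OF V(1) \<alpha>c incl_closed[OF V(1) that]]
        localize_closed[OF V(1) incl_closed[OF V(1) that]] ac l\<alpha>
      by (simp add: S.m_assoc pull_fun_def)
    fix W' assume "openin T W' \<and> W' \<subseteq> V"
    then have W': "openin T W'" "W' \<subseteq> V" by auto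
    show "res V W' (?a \<otimes>\<^bsub>S V\<^esub> loc V \<alpha>) =
             res W W' a \<otimes>\<^bsub>S W'\<^esub> loc W' (restr \<Omega> V W' \<alpha>)"
      using res_mult[OF V(1) W' ac l\<alpha>] localize_restr[OF V(1) W' \<alpha>c]
        res_res[OF W V(1) W'(1,2) V(2) degree_closed[OF W field_factorD(1)[OF f]]] by simp
  next
    fix g assume g: "g \<in> carrier (sec X V)"
    show "?a \<otimes>\<^bsub>S V\<^esub> loc V (dfun \<Omega> V g) = v V (pull_fun \<Omega> \<Delta> V g)"
      using field_factorD(2)[OF f V pull_degree[OF V(1) g]] dtilde_pull[OF V(1) g] by simp
  qed
qed

text \<open>On a chart a one-form is a sum of products \<open>df \<cdot> g\<close>, on which right linearity and the values on \<open>df\<close> determine a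
  contraction. Compatibility with restriction and separatedness of \<open>\<O>\<^sub>\<Delta>\<close> do the rest.\<close>

lemma is_contraction_unique:
  assumes W: "openin T W" and f: "field_factor v W a" and c: "is_contraction X \<Omega> \<Delta> W v c"
    and \<alpha>: "\<alpha> \<in> degree_part \<Omega> W 1"
  shows "c W \<alpha> = a \<otimes>\<^bsub>S W\<^esub> loc W \<alpha>"
proof -
  have c_deg: "c V \<beta> \<in> \<O> V 0"
    and c_add: "\<gamma> \<in> degree_part \<Omega> V 1 \<Longrightarrow> c V (\<beta> \<oplus>\<^bsub>sec \<Omega> V\<^esub> \<gamma>) = c V \<beta> \<oplus>\<^bsub>S V\<^esub> c V \<gamma>"
    and c_mult: "g \<in> carrier (sec X V) \<Longrightarrow> c V (\<beta> \<otimes>\<^bsub>sec \<Omega> V\<^esub> incl \<Omega> V g) = c V \<beta> \<otimes>\<^bsub>S V\<^esub> pull_fun \<Omega> \<Delta> V g"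
    and c_restr: "openin T V' \<Longrightarrow> V' \<subseteq> V \<Longrightarrow> res V V' (c V \<beta>) = c V' (restr \<Omega> V V' \<beta>)"
    if "openin T V" "V \<subseteq> W" "\<beta> \<in> degree_part \<Omega> V 1" for V \<beta> \<gamma> g V'
    using c that unfolding is_contraction_def by meson+
  have c_df: "c V (dfun \<Omega> V g) = v V (pull_fun \<Omega> \<Delta> V g)"
    if "openin T V" "V \<subseteq> W" "g \<in> carrier (sec X V)" for V g
    using c that unfolding is_contraction_def by meson
  have a: "a \<in> \<O> W (-1)" "a \<in> carrier (S W)"
    using field_factorD(1)[OF f] degree_closed[OF W] by auto
  have l\<alpha>: "loc W \<alpha> \<in> carrier (S W)"
    using localize_closed[OF W forms_degree_closed[OF W \<alpha>]] .
  show ?thesis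
  proof (rule local_eqI[OF W c_deg[OF W subset_refl \<alpha>]])
    show "a \<otimes>\<^bsub>S W\<^esub> loc W \<alpha> \<in> \<O> W 0"
      using degree_mult[OF W a(1) localize_degree[OF W \<alpha>]] by simp
    fix U t u assume U: "chart U t u" and UW: "U \<subseteq> W"
    note oU = chartD(1)[OF U]
    interpret S: supercommutative_ring "S U"
      using proj_ring[OF oU] .
    let ?a = "res W U a" and ?\<alpha> = "restr \<Omega> W U \<alpha>"
    have ac: "?a \<in> carrier (S U)"
      using res_closed[OF W oU UW a(2)] .
    have \<alpha>U: "?\<alpha> \<in> degree_part \<Omega> U 1"
      using forms_degree_restr[OF W oU UW \<alpha>] .
    have df: "c U (dfun \<Omega> U g \<otimes>\<^bsub>sec \<Omega> U\<^esub> incl \<Omega> U h) =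
        ?a \<otimes>\<^bsub>S U\<^esub> loc U (dfun \<Omega> U g \<otimes>\<^bsub>sec \<Omega> U\<^esub> incl \<Omega> U h)"
      if g: "g \<in> carrier (sec X U)" and h: "h \<in> carrier (sec X U)" for g h
    proof -
      have "c U (dfun \<Omega> U g \<otimes>\<^bsub>sec \<Omega> U\<^esub> incl \<Omega> U h) = v U (pull_fun \<Omega> \<Delta> U g) \<otimes>\<^bsub>S U\<^esub> pull_fun \<Omega> \<Delta> U h"
        using c_mult[OF oU UW dfun_degree[OF oU g] h] c_df[OF oU UW g] by simp
      also have "\<dots> = (?a \<otimes>\<^bsub>S U\<^esub> loc U (dfun \<Omega> U g)) \<otimes>\<^bsub>S U\<^esub> loc U (incl \<Omega> U h)"
        using field_factorD(2)[OF f oU UW pull_degree[OF oU g]] dtilde_pull[OF oU g]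
        by (simp add: pull_fun_def)
      also have "\<dots> = ?a \<otimes>\<^bsub>S U\<^esub> loc U (dfun \<Omega> U g \<otimes>\<^bsub>sec \<Omega> U\<^esub> incl \<Omega> U h)"
        using ac g h oU by (simp add: localize_mult localize_closed incl_closed dfun_closed S.m_assoc)
      finally show ?thesis .
    qed
    obtain g1 g2 h1 h2 where gh: "g1 \<in> carrier (sec X U)" "g2 \<in> carrier (sec X U)"
      "h1 \<in> carrier (sec X U)" "h2 \<in> carrier (sec X U)"
      "?\<alpha> = dfun \<Omega> U g1 \<otimes>\<^bsub>sec \<Omega> U\<^esub> incl \<Omega> U h1 \<oplus>\<^bsub>sec \<Omega> U\<^esub> dfun \<Omega> U g2 \<otimes>\<^bsub>sec \<Omega> U\<^esub> incl \<Omega> U h2"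
      using chart_generated[OF U \<alpha>U] .
    have deg: "dfun \<Omega> U g \<otimes>\<^bsub>sec \<Omega> U\<^esub> incl \<Omega> U h \<in> degree_part \<Omega> U 1"
      if "g \<in> carrier (sec X U)" "h \<in> carrier (sec X U)" for g h
      using forms_degree_mult[OF oU dfun_degree[OF oU that(1)] incl_degree[OF oU that(2)]] by simp
    note deg1 = deg[OF gh(1,3)] deg[OF gh(2,4)]
    note cl = deg1[THEN forms_degree_closed[OF oU]]
    have "c U ?\<alpha> = ?a \<otimes>\<^bsub>S U\<^esub> loc U ?\<alpha>"
      unfolding gh(5) c_add[OF oU UW deg1] df[OF gh(1,3)] df[OF gh(2,4)] localize_add[OF oU cl]
      using ac cl[THEN localize_closed[OF oU]] by (simp only: S.r_distr)
    then show "res W U (c W \<alpha>) = res W U (a \<otimes>\<^bsub>S W\<^esub> loc W \<alpha>)"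
      using c_restr[OF W subset_refl \<alpha> oU UW] res_mult[OF W oU UW a(2) l\<alpha>]
        localize_restr[OF W oU UW forms_degree_closed[OF W \<alpha>]] by simp
  qed
qed

lemma contract_eq:
  assumes W: "openin T W" and f: "field_factor v W a" and \<alpha>: "\<alpha> \<in> degree_part \<Omega> W 1"
  shows "contract X \<Omega> \<Delta> W v \<alpha> = a \<otimes>\<^bsub>S W\<^esub> loc W \<alpha>"
  unfolding contract_def
proof (rule the_equality)
  have "res W W a = a"
    using res_id[OF W degree_closed[OF W field_factorD(1)[OF f]]] .
  then show "\<exists>c. is_contraction X \<Omega> \<Delta> W v c \<and> a \<otimes>\<^bsub>S W\<^esub> loc W \<alpha> = c W \<alpha>"
    by (intro exI[of _ "\<lambda>V \<alpha>. res W V a \<otimes>\<^bsub>S V\<^esub> loc V \<alpha>"] conjI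
        is_contraction_field_factor[OF W f]) simp
next
  fix s assume "\<exists>c. is_contraction X \<Omega> \<Delta> W v c \<and> s = c W \<alpha>"
  then show "s = a \<otimes>\<^bsub>S W\<^esub> loc W \<alpha>"
    using is_contraction_unique[OF W f _ \<alpha>] by auto
qed

text \<open>In coordinates this is the field \<open>\<rho> \<partial>\<^sub>z + \<partial>\<^sub>\<theta>\<close>, which generates the vertical fields. With \<open>u\<close> even, the Leibniz rule
  for \<open>u d~\<close> is that for \<open>d~\<close>.\<close>

lemma vertical_field_inverse_dt:
  assumes c: "chart U t u"
  shows "vertical_field \<Lambda> X \<Omega> \<Delta> U True (\<lambda>V s. res U V u \<otimes>\<^bsub>S V\<^esub> d V s)"
    (is "vertical_field _ _ _ _ _ _ ?v")
  unfolding vertical_field_def vector_field_def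
proof (intro conjI allI impI ballI)
  note C = chartD[OF c]
  fix V assume "openin (topo A) V \<and> V \<subseteq> U"
  then have V: "openin T V" "V \<subseteq> U" by auto
  let ?S = "S V" and ?d = "d V" and ?u = "res U V u"
    and ?O = "sub_super (S V) (\<O> V 0)"
  interpret S: odd_derivation_over_C ?S ?d "scalar V"
    using proj_algebra[OF V(1)] .
  interpret O: supercommutative_ring ?O
    using degree_zero_ring[OF V(1)] .
  note C' = chartD[OF chart_restr[OF c V]]
  note dc = degree_closed[OF V(1)]
  have uc: "?u \<in> carrier ?S" using dc[OF C'(4)] .
  have vdeg: "?v V x \<in> \<O> V 0" if "x \<in> \<O> V 0" for x
    using degree_mult[OF V(1) C'(4) dtilde_degree[OF V(1) that]] by simp
  have neg: "\<ominus>\<^bsub>?O\<^esub> x = \<ominus>\<^bsub>?S\<^esub> x" if "x \<in> \<O> V 0" for x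
    using neg_sub_super[OF S.ring_axioms O.ring_axioms _ that] dc by auto
  show "super_derivation (sec A V) True (?v V)"
    unfolding super_derivation_def O_Delta_simps sub_super_simps
  proof (intro conjI allI ballI)
    fix q
    show "?v V ` (\<O> V 0 \<inter> homog ?S q) \<subseteq> \<O> V 0 \<inter> homog ?S (True \<noteq> q)"
      using vdeg C'(5) by (cases q) auto
    fix x y assume x: "x \<in> \<O> V 0 \<inter> homog ?S q" and y: "y \<in> \<O> V 0"
    have xv: "x \<otimes>\<^bsub>?S\<^esub> ?v V y \<in> \<O> V 0"
      using degree_zero_mult[OF V(1) _ vdeg[OF y]] x by auto
    have xc: "x \<in> homog ?S q" "x \<in> carrier ?S" "y \<in> carrier ?S"
      using x y dc by auto
    have swap: "?u \<otimes>\<^bsub>?S\<^esub> (x \<otimes>\<^bsub>?S\<^esub> ?d y) = x \<otimes>\<^bsub>?S\<^esub> ?v V y"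
      using S.even_left_commute[OF C'(5) xc(2) S.deriv_closed[OF xc(3)]] by simp
    have "?v V (x \<otimes>\<^bsub>?S\<^esub> y) = ?u \<otimes>\<^bsub>?S\<^esub> (?d x \<otimes>\<^bsub>?S\<^esub> y) \<oplus>\<^bsub>?S\<^esub> ?u \<otimes>\<^bsub>?S\<^esub> ssgn ?S q (x \<otimes>\<^bsub>?S\<^esub> ?d y)"
      unfolding S.deriv_leibniz[OF xc(1,3)] using uc xc by (simp add: S.r_distr ssgn_def)
    also have "?u \<otimes>\<^bsub>?S\<^esub> ssgn ?S q (x \<otimes>\<^bsub>?S\<^esub> ?d y) = ssgn ?S q (x \<otimes>\<^bsub>?S\<^esub> ?v V y)"
      using swap uc xc by (simp add: ssgn_def S.r_minus)
    also have "\<dots> = ssgn ?O (True \<and> q) (x \<otimes>\<^bsub>?S\<^esub> ?v V y)"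
      using neg[OF xv] by (simp add: ssgn_def)
    finally show "?v V (x \<otimes>\<^bsub>?S\<^esub> y) = ?v V x \<otimes>\<^bsub>?S\<^esub> y \<oplus>\<^bsub>?S\<^esub> ssgn ?O (True \<and> q) (x \<otimes>\<^bsub>?S\<^esub> ?v V y)"
      using uc xc by (simp add: S.m_assoc)
  next
    fix x assume x: "x \<in> \<O> V 0"
    then show "?v V x \<in> \<O> V 0" by (rule vdeg)
    fix y assume y: "y \<in> \<O> V 0"
    show "?v V (x \<oplus>\<^bsub>?S\<^esub> y) = ?v V x \<oplus>\<^bsub>?S\<^esub> ?v V y"
      using dc[OF x] dc[OF y] uc by (simp add: S.deriv_add S.r_distr)
  qed
  show "?v V (cst A V a) = \<zero>\<^bsub>sec A V\<^esub>" if "a \<in> carrier \<Lambda>" for a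
    using dtilde_pull_cst[OF V(1) that] uc by simp
  fix V' s assume "openin (topo A) V' \<and> V' \<subseteq> V" and s: "s \<in> carrier (sec A V)"
  then have V': "openin T V'" "V' \<subseteq> V" and s': "s \<in> carrier ?S" using dc by auto
  show "restr A V V' (?v V s) = ?v V' (restr A V V' s)"
    using res_mult[OF V(1) V' uc S.deriv_closed[OF s']] dtilde_restr[OF V(1) V' s']
      res_res[OF C(1) V(1) V' V(2) degree_closed[OF C(1,4)]] by simp
next
  note C = chartD[OF c]
  fix V s assume "openin T V \<and> V \<subseteq> U" and s: "s \<in> carrier (sec Y V)"
  then have V: "openin T V" "V \<subseteq> U" by auto
  interpret S: supercommutative_ring "S V"
    using proj_ring[OF V(1)] .
  show "?v V s = \<zero>\<^bsub>S V\<^esub>"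
    using s res_closed[OF C(1) V degree_closed[OF C(1,4)]] by simp
qed

end

section \<open>The exponential map in the cohomology of the dual curve\<close>

context proj_supercurve
begin

lemma closed_functions_restr:
  assumes h: "openin T U" "openin T V" "V \<subseteq> U" and x: "x \<in> closed_functions U"
  shows "res U V x \<in> closed_functions V"
  using x res_degree[OF h] dtilde_restr[OF h, of x] res_zero[OF h] degree_closed[OF h(1)] by force

lemma closed_functions_algebra:
  assumes V: "openin T V"
  shows "supercommutative_algebra (dual_ring V) (scalar V)"
    and "s \<in> closed_functions V \<Longrightarrow> complex_algebra.nexp (dual_ring V) (scalar V) s
      = complex_algebra.nexp (S V) (scalar V) s"
proof -
  interpret S: odd_derivation_over_C "S V" "d V" "scalar V"
    using proj_algebra[OF V] .
  interpret Y: supercommutative_ring "dual_ring V"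
    using closed_functions_ring[OF V] .
  have sub: "closed_functions V \<subseteq> carrier (S V)"
    using degree_closed[OF V] by auto
  have sc: "scalar V a \<in> closed_functions V" for a
    using scalar_facts(1,3)[OF V, of a] by auto
  note alg = complex_algebra_sub_super[OF S.complex_algebra_axioms Y.ring_axioms sub sc]
  show "supercommutative_algebra (dual_ring V) (scalar V)"
    using Y.supercommutative_ring_axioms alg(1) sc scalar_facts(2)[OF V]
    by (intro supercommutative_algebra.intro supercommutative_algebra_axioms.intro) auto
  show "s \<in> closed_functions V \<Longrightarrow> complex_algebra.nexp (dual_ring V) (scalar V) s
      = complex_algebra.nexp (S V) (scalar V) s"
    by (rule alg(2))
qed

lemma nil_exp_eq:
  assumes V: "openin T V"
  shows "nil_exp \<iota> Y V s
    = complex_algebra.nexp (dual_ring V) (scalar V) s"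
proof -
  interpret Y: supercommutative_algebra "dual_ring V" "scalar V"
    using closed_functions_algebra(1)[OF V] .
  show ?thesis
    unfolding nil_exp_def Y.nexp_def Y.exp_term_def by (simp add: scalar_def)
qed

lemma closed_functions_restr_hom:
  assumes h: "openin T U" "openin T V" "V \<subseteq> U"
  shows "res U V \<in> ring_hom (dual_ring U) (dual_ring V)"
  using closed_functions_restr[OF h] degree_closed[OF h(1)]
  by (intro ring_hom_memI) (auto simp: res_mult[OF h] res_add[OF h] res_one[OF h])

abbreviation "unit_sheaf \<equiv> \<lambda>U. even_units (dual_ring U)"
abbreviation "nilpotent_sheaf \<equiv> \<lambda>U. even_nilpotents (dual_ring U)"

lemma unit_sheafD:
  assumes V: "openin T V" and "a \<in> carrier (unit_sheaf V)"
  obtains b where "a \<in> closed_functions V" "a \<in> homog (S V) False" "b \<in> closed_functions V"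
    "b \<in> homog (S V) False" "a \<otimes>\<^bsub>S V\<^esub> b = \<one>\<^bsub>S V\<^esub>" "b \<otimes>\<^bsub>S V\<^esub> a = \<one>\<^bsub>S V\<^esub>"
proof -
  interpret Y: supercommutative_ring "dual_ring V"
    using closed_functions_ring[OF V] .
  from assms(2) obtain b where "a \<in> homog (dual_ring V) False"
    "b \<in> homog (dual_ring V) False"
    "a \<otimes>\<^bsub>dual_ring V\<^esub> b = \<one>\<^bsub>dual_ring V\<^esub>"
    "b \<otimes>\<^bsub>dual_ring V\<^esub> a = \<one>\<^bsub>dual_ring V\<^esub>"
    by (rule Y.even_unitsE)
  then show ?thesis
    using that[of b] by simp
qed

lemma unit_sheafI:
  assumes V: "openin T V" and "a \<in> closed_functions V" "a \<in> homog (S V) False"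
    "b \<in> closed_functions V" "a \<otimes>\<^bsub>S V\<^esub> b = \<one>\<^bsub>S V\<^esub>"
  shows "a \<in> carrier (unit_sheaf V)"
proof -
  interpret Y: supercommutative_ring "dual_ring V"
    using closed_functions_ring[OF V] .
  show ?thesis
    by (rule Y.even_unitsI[of a b]) (use assms in auto)
qed

lemma unit_presheaf: "abelian_presheaf T unit_sheaf res"
proof (rule abelian_presheaf.intro)
  fix U assume U: "openin T U"
  interpret Y: supercommutative_ring "dual_ring U"
    using closed_functions_ring[OF U] .
  show "comm_group (unit_sheaf U)"
    by (rule Y.comm_group_even_units)
  fix V assume V: "openin T V" "V \<subseteq> U"
  note h = U V
  show "res U V \<in> hom (unit_sheaf U) (unit_sheaf V)"
  proof (rule homI)
    fix a assume "a \<in> carrier (unit_sheaf U)"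
    then obtain b where ab: "a \<in> closed_functions U" "a \<in> homog (S U) False" "b \<in> closed_functions U"
      "a \<otimes>\<^bsub>S U\<^esub> b = \<one>\<^bsub>S U\<^esub>"
      by (rule unit_sheafD[OF U])
    have "a \<in> carrier (S U)" "b \<in> carrier (S U)"
      using ab degree_closed[OF U] by auto
    then have "res U V a \<otimes>\<^bsub>S V\<^esub> res U V b = \<one>\<^bsub>S V\<^esub>"
      using res_mult[OF h, of a b] res_one[OF h] ab(4) by simp
    then show "res U V a \<in> carrier (unit_sheaf V)"
      by (rule unit_sheafI[OF V(1) closed_functions_restr[OF h ab(1)] res_homog[OF h ab(2)]
            closed_functions_restr[OF h ab(3)]])
  next
    fix a b assume a: "a \<in> carrier (unit_sheaf U)" and b: "b \<in> carrier (unit_sheaf U)"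
    have "a \<in> carrier (S U)" "b \<in> carrier (S U)"
      using a b degree_closed[OF U] by (auto elim!: unit_sheafD[OF U])
    then show "res U V (a \<otimes>\<^bsub>unit_sheaf U\<^esub> b) = res U V a \<otimes>\<^bsub>unit_sheaf V\<^esub> res U V b"
      using res_mult[OF h] by (simp add: even_units_def)
  qed
next
  fix U V W x assume h: "openin T U" "openin T V" "openin T W" "W \<subseteq> V" "V \<subseteq> U" and x: "x \<in> carrier (unit_sheaf U)"
  have "x \<in> carrier (S U)"
    using x degree_closed[OF h(1)] by (auto elim!: unit_sheafD[OF h(1)])
  then show "res V W (res U V x) = res U W x"
    by (rule res_res[OF h])
qed

lemma nilpotent_sheaf_iff:
  assumes V: "openin T V"
  shows "s \<in> carrier (nilpotent_sheaf V) \<longleftrightarrow> s \<in> closed_functions V \<and> s \<in> homog (S V) False \<and> s \<in> nilpotents (S V)"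
  using degree_closed[OF V, of s 0] by (auto simp: even_nilpotents_def nilpotents_def)

lemma nilpotent_presheaf: "abelian_presheaf T nilpotent_sheaf res"
proof (rule abelian_presheaf.intro)
  fix U assume U: "openin T U"
  interpret Y: supercommutative_algebra "dual_ring U" "scalar U"
    using closed_functions_algebra(1)[OF U] .
  show "comm_group (nilpotent_sheaf U)"
    by (rule Y.comm_group_even_nilpotents)
  fix V assume V: "openin T V" "V \<subseteq> U"
  note h = U V
  interpret YV: supercommutative_algebra "dual_ring V" "scalar V"
    using closed_functions_algebra(1)[OF V(1)] .
  show "res U V \<in> hom (nilpotent_sheaf U) (nilpotent_sheaf V)"
  proof (rule homI)
    fix s assume s: "s \<in> carrier (nilpotent_sheaf U)"
    then have "res U V s \<in> nilpotents (dual_ring V)"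
      using ring_hom_nexp(1)[OF Y.complex_algebra_axioms YV.complex_algebra_axioms closed_functions_restr_hom[OF h] scalar_restr[OF h]]
      by (simp add: even_nilpotents_def)
    then show "res U V s \<in> carrier (nilpotent_sheaf V)"
      using s res_homog[OF h] by (auto simp: even_nilpotents_def nilpotents_def)
  next
    fix s s' assume s: "s \<in> carrier (nilpotent_sheaf U)" and s': "s' \<in> carrier (nilpotent_sheaf U)"
    then have "s \<in> carrier (S U)" "s' \<in> carrier (S U)"
      by (auto simp: nilpotent_sheaf_iff[OF U] nilpotents_def)
    then show "res U V (s \<otimes>\<^bsub>nilpotent_sheaf U\<^esub> s') = res U V s \<otimes>\<^bsub>nilpotent_sheaf V\<^esub> res U V s'"
      using res_add[OF h] by (simp add: even_nilpotents_def)
  qed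
next
  fix U V W x assume h: "openin T U" "openin T V" "openin T W" "W \<subseteq> V" "V \<subseteq> U"
    and x: "x \<in> carrier (nilpotent_sheaf U)"
  have "x \<in> carrier (S U)"
    using x by (auto simp: nilpotent_sheaf_iff[OF h(1)] nilpotents_def)
  then show "res V W (res U V x) = res U W x"
    by (rule res_res[OF h])
qed

lemma exponential: "abelian_presheaf_hom T nilpotent_sheaf res unit_sheaf res (nil_exp \<iota> Y)"
proof (intro abelian_presheaf_hom.intro abelian_presheaf_hom_axioms.intro nilpotent_presheaf unit_presheaf)
  fix U assume U: "openin T U"
  interpret Y: supercommutative_algebra "dual_ring U" "scalar U"
    using closed_functions_algebra(1)[OF U] .
  have e: "nil_exp \<iota> Y U = Y.nexp"
    using nil_exp_eq[OF U] by auto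
  show "nil_exp \<iota> Y U \<in> hom (nilpotent_sheaf U) (unit_sheaf U)"
    unfolding e by (rule Y.nexp_hom)
  fix V x assume V: "openin T V" "V \<subseteq> U" and x: "x \<in> carrier (nilpotent_sheaf U)"
  note h = U V
  interpret YV: supercommutative_algebra "dual_ring V" "scalar V"
    using closed_functions_algebra(1)[OF V(1)] .
  show "res U V (nil_exp \<iota> Y U x) = nil_exp \<iota> Y V (res U V x)"
    unfolding nil_exp_eq[OF U] nil_exp_eq[OF V(1)]
    by (rule ring_hom_nexp(2)[OF Y.complex_algebra_axioms YV.complex_algebra_axioms
          closed_functions_restr_hom[OF h] scalar_restr[OF h] Y.even_nilpotentsD(1)[OF x]])
qed

text \<open>The definition of \<^const>\<open>H1_exp\<close> picks the class by a description over all representing cocycles; it denotes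
  something because the exponential maps cohomologous cocycles to cohomologous ones.\<close>

lemma H1_exp_class:
  assumes Z: "(U, g) \<in> cech_Z1 T nilpotent_sheaf res"
  shows "H1_exp \<iota> Y (cech_class T nilpotent_sheaf res U g)
    = cech_class T unit_sheaf res U (\<lambda>x y. nil_exp \<iota> Y (U x \<inter> U y) (g x y))"
proof -
  interpret E: abelian_presheaf_hom T nilpotent_sheaf "res" unit_sheaf "res" "nil_exp \<iota> Y"
    by (rule exponential)
  show ?thesis
    unfolding H1_exp_def dual_curve_simps
  proof (rule the_equality)
    show "\<exists>U' g'. (U', g') \<in> cech_class T nilpotent_sheaf res U g \<and>
       cech_class T unit_sheaf res U (\<lambda>x y. nil_exp \<iota> Y (U x \<inter> U y) (g x y)) =
       cech_class T unit_sheaf res U' (\<lambda>x y. nil_exp \<iota> Y (U' x \<inter> U' y) (g' x y))"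
      using E.F.cech_class_self[OF Z] by blast
  next
    fix c assume "\<exists>U' g'. (U', g') \<in> cech_class T nilpotent_sheaf res U g \<and>
       c = cech_class T unit_sheaf res U' (\<lambda>x y. nil_exp \<iota> Y (U' x \<inter> U' y) (g' x y))"
    then obtain U' g' where "(U', g') \<in> cech_class T nilpotent_sheaf res U g"
      and c: "c = cech_class T unit_sheaf res U' (\<lambda>x y. nil_exp \<iota> Y (U' x \<inter> U' y) (g' x y))"
      by blast
    then have "((U, g), (U', g')) \<in> cech_rel T nilpotent_sheaf res"
      unfolding E.F.mem_cech_class by blast
    from E.G.cech_class_eqI[OF E.map_cech_rel[OF this]]
    show "c = cech_class T unit_sheaf res U (\<lambda>x y. nil_exp \<iota> Y (U x \<inter> U y) (g x y))"
      unfolding c by simp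
  qed
qed

end

section \<open>The transform as a line bundle\<close>

locale twisted_supercurve = proj_supercurve \<tau> \<Lambda> \<iota> X \<Omega> \<Delta>
  for \<tau> :: topology_kind
    and \<Lambda> :: "'k super_ring" and \<iota> :: "complex \<Rightarrow> 'k"
    and X :: "('a, 'f, 'k) superspace"
    and \<Omega> :: "('a, 'f, 'w) forms"
    and \<Delta> :: "('a, 'w, 'l) proj" +
  fixes \<omega> :: 'w
  assumes degree: "\<omega> \<in> degree_part \<Omega> (topspace (topo X)) 1"
    and odd: "\<omega> \<in> homog (sec \<Omega> (topspace (topo X))) True"
    and closed: "ext_d \<Omega> (topspace (topo X)) \<omega> = \<zero>\<^bsub>sec \<Omega> (topspace (topo X))\<^esub>"
begin

text \<open>The pullback of \<open>\<omega>\<close> to \<open>\<Delta>\<close>.\<close>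

definition w :: "'a set \<Rightarrow> 'l" where
  "w V = loc V (restr \<Omega> (topspace T) V \<omega>)"

lemma w_facts:
  assumes V: "openin T V"
  shows "restr \<Omega> (topspace T) V \<omega> \<in> degree_part \<Omega> V 1"
    "w V \<in> \<O> V 1" "w V \<in> homog (S V) True" "d V (w V) = \<zero>\<^bsub>S V\<^esub>"
proof -
  have h: "openin T (topspace T)" "openin T V" "V \<subseteq> topspace T"
    using V openin_subset by auto
  interpret O: supercommutative_ring "sec \<Omega> (topspace T)"
    using forms_ring[OF h(1)] .
  interpret OV: supercommutative_ring "sec \<Omega> V"
    using forms_ring[OF V] .
  show r: "restr \<Omega> (topspace T) V \<omega> \<in> degree_part \<Omega> V 1"
    using forms_degree_restr[OF h degree] .
  then show "w V \<in> \<O> V 1"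
    unfolding w_def by (rule localize_degree[OF V])
  show "w V \<in> homog (S V) True"
    unfolding w_def
    by (intro super_homD(2)[OF localize_hom[OF V]] super_homD(2)[OF forms_restr_hom[OF h]] odd)
  have "ext_d \<Omega> V (restr \<Omega> (topspace T) V \<omega>) = restr \<Omega> (topspace T) V (ext_d \<Omega> (topspace T) \<omega>)"
    using ext_d_restr[OF h forms_degree_closed[OF h(1) degree]] by simp
  also have "\<dots> = \<zero>\<^bsub>sec \<Omega> V\<^esub>"
    unfolding closed
    by (rule ring_hom_zero_neg(1)[OF O.ring_axioms OV.ring_axioms super_homD(1)[OF forms_restr_hom[OF h]]])
  finally show "d V (w V) = \<zero>\<^bsub>S V\<^esub>"
    unfolding w_def using dtilde_localize[OF V forms_degree_closed[OF V r]] localize_zero[OF V] by simp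
qed

lemma w_closed: "openin T V \<Longrightarrow> w V \<in> carrier (S V)"
  using degree_closed w_facts(2) by blast

lemma w_restr:
  assumes "openin T U" "openin T V" "V \<subseteq> U"
  shows "res U V (w U) = w V"
proof -
  have t: "openin T (topspace T)" "U \<subseteq> topspace T"
    using assms openin_subset by auto
  show ?thesis
    unfolding w_def
    using localize_restr[OF assms forms_degree_closed[OF assms(1) w_facts(1)[OF assms(1)]]]
      forms_restr_restr[OF t(1) assms(1,2,3) t(2) forms_degree_closed[OF t(1) degree]] by simp
qed

lemma twisted_connection_one:
  assumes V: "openin T V"
  shows "twisted_connection \<Omega> \<omega> V \<one>\<^bsub>sec X V\<^esub> = restr \<Omega> (topspace T) V \<omega>"
proof -
  interpret O: supercommutative_ring "sec \<Omega> V"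
    using forms_ring[OF V] .
  interpret O: odd_derivation "sec \<Omega> V" "ext_d \<Omega> V"
    using ext_d_derivation[OF V] by unfold_locales
  have "incl \<Omega> V \<one>\<^bsub>sec X V\<^esub> = \<one>\<^bsub>sec \<Omega> V\<^esub>"
    using ring_hom_one[OF super_homD(1)[OF incl_hom[OF V]]] .
  then show ?thesis
    using forms_degree_closed[OF V w_facts(1)[OF V]] by (simp add: twisted_connection_def dfun_def)
qed

lemma pullback_connection_eq:
  assumes W: "openin T W" and f: "field_factor v W a" and g: "g \<in> \<O> W 0"
  shows "pullback_connection X \<Omega> \<Delta> (twisted_connection \<Omega> \<omega>) W v g
    = a \<otimes>\<^bsub>S W\<^esub> (d W g \<oplus>\<^bsub>S W\<^esub> w W \<otimes>\<^bsub>S W\<^esub> g)"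
proof -
  interpret S: odd_derivation_over_C "S W" "d W" "scalar W"
    using proj_algebra[OF W] .
  have a: "a \<in> carrier (S W)"
    using degree_closed[OF W field_factorD(1)[OF f]] .
  have "contract X \<Omega> \<Delta> W v (twisted_connection \<Omega> \<omega> W \<one>\<^bsub>sec X W\<^esub>) = a \<otimes>\<^bsub>S W\<^esub> w W"
    unfolding twisted_connection_one[OF W] w_def
    by (rule contract_eq[OF W f w_facts(1)[OF W]])
  moreover have "v W g = a \<otimes>\<^bsub>S W\<^esub> d W g"
    using field_factorD(2)[OF f W subset_refl g] res_id[OF W a] by simp
  ultimately show ?thesis
    unfolding pullback_connection_def
    using a w_closed[OF W] degree_closed[OF W g] by (simp add: S.r_distr S.m_assoc)
qed

definition horizontal :: "'a set \<Rightarrow> 'l set" where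
  "horizontal V = {g \<in> \<O> V 0. odd_derivation.flat (S V) (d V) (w V) g}"

lemma horizontal_iff:
  assumes V: "openin T V"
  shows "g \<in> horizontal V \<longleftrightarrow> g \<in> \<O> V 0 \<and>
    d V g \<oplus>\<^bsub>S V\<^esub> w V \<otimes>\<^bsub>S V\<^esub> g = \<zero>\<^bsub>S V\<^esub>"
proof -
  interpret S: odd_derivation_over_C "S V" "d V" "scalar V"
    using proj_algebra[OF V] .
  show ?thesis
    using degree_closed[OF V, of g 0] by (auto simp: horizontal_def S.flat_def)
qed

lemma connection_restr:
  assumes h: "openin T U" "openin T V" "V \<subseteq> U" and g: "g \<in> \<O> U 0"
  shows "res U V (d U g \<oplus>\<^bsub>S U\<^esub> w U \<otimes>\<^bsub>S U\<^esub> g) =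
    d V (res U V g) \<oplus>\<^bsub>S V\<^esub> w V \<otimes>\<^bsub>S V\<^esub> res U V g"
proof -
  interpret S: odd_derivation_over_C "S U" "d U" "scalar U"
    using proj_algebra[OF h(1)] .
  have "g \<in> carrier (S U)" "w U \<in> carrier (S U)"
    using degree_closed[OF h(1) g] w_closed[OF h(1)] by auto
  then show ?thesis
    by (simp add: res_add[OF h] res_mult[OF h] dtilde_restr[OF h] w_restr[OF h])
qed

lemma connection_degree:
  assumes V: "openin T V" and g: "g \<in> \<O> V 0"
  shows "d V g \<oplus>\<^bsub>S V\<^esub> w V \<otimes>\<^bsub>S V\<^esub> g \<in> \<O> V 1"
  using degree_add[OF V] dtilde_degree[OF V g] degree_mult[OF V w_facts(2)[OF V] g] by simp

lemma horizontal_restr: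
  assumes h: "openin T U" "openin T V" "V \<subseteq> U" and g: "g \<in> horizontal U"
  shows "res U V g \<in> horizontal V"
  using g connection_restr[OF h, of g] res_degree[OF h, of g 0] res_zero[OF h]
  by (simp add: horizontal_iff[OF h(1)] horizontal_iff[OF h(2)])

text \<open>As \<open>\<nabla>\<^sub>v g = a (d~ g + \<omega> g)\<close> for \<open>v = a d~\<close>, every solution of \<open>d~ g + \<omega> g = 0\<close> is killed by all \<open>\<nabla>\<^sub>v\<close>. For the
  converse take \<open>v = u d~\<close> on charts, where \<open>u\<close> is invertible.\<close>

lemma transform_eq:
  assumes V: "openin T V"
  shows "transform_twisted \<Lambda> X \<Omega> \<Delta> \<omega> V = horizontal V"
proof (intro equalityI subsetI)
  fix g assume g: "g \<in> horizontal V"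
  then have g0: "g \<in> \<O> V 0" "d V g \<oplus>\<^bsub>S V\<^esub> w V \<otimes>\<^bsub>S V\<^esub> g = \<zero>\<^bsub>S V\<^esub>"
    using horizontal_iff[OF V] by auto
  show "g \<in> transform_twisted \<Lambda> X \<Omega> \<Delta> \<omega> V"
    unfolding transform_twisted_def pi_hat_plus_def mem_Collect_eq
  proof (intro conjI allI impI)
    show "g \<in> carrier (sec A V)"
      using g0 by simp
    fix W p v assume "openin T W \<and> W \<subseteq> V \<and> vertical_field \<Lambda> X \<Omega> \<Delta> W p v"
    then have W: "openin T W" "W \<subseteq> V" and v: "vertical_field \<Lambda> X \<Omega> \<Delta> W p v"
      by auto
    interpret S: supercommutative_ring "S W"
      using proj_ring[OF W(1)] .
    obtain a where a: "field_factor v W a"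
      using vertical_field_factor[OF v W(1)] by blast
    have gW: "res V W g \<in> horizontal W"
      using horizontal_restr[OF V W g] .
    then show "pullback_connection X \<Omega> \<Delta> (twisted_connection \<Omega> \<omega>) W v (res V W g) = \<zero>\<^bsub>S W\<^esub>"
      using pullback_connection_eq[OF W(1) a] degree_closed[OF W(1) field_factorD(1)[OF a]]
      by (simp add: horizontal_iff[OF W(1)])
  qed
next
  fix g assume g: "g \<in> transform_twisted \<Lambda> X \<Omega> \<Delta> \<omega> V"
  then have g0: "g \<in> \<O> V 0"
    unfolding transform_twisted_def pi_hat_plus_def by simp
  have "d V g \<oplus>\<^bsub>S V\<^esub> w V \<otimes>\<^bsub>S V\<^esub> g = \<zero>\<^bsub>S V\<^esub>"
  proof (rule local_eqI[OF V connection_degree[OF V g0] degree_zero[OF V]])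
    fix U t u assume c: "chart U t u" and UV: "U \<subseteq> V"
    note C = chartD[OF c]
    let ?S = "S U" and ?d = "d U" and ?g = "res V U g"
    let ?v = "\<lambda>V s. res U V u \<otimes>\<^bsub>S V\<^esub> d V s"
    interpret S: odd_derivation_over_C ?S ?d "scalar U"
      using proj_algebra[OF C(1)] .
    have gU: "?g \<in> \<O> U 0"
      using res_degree[OF V C(1) UV g0] .
    have f: "field_factor ?v U u"
      using C(4) by (simp add: field_factor_def)
    have uc: "u \<in> carrier ?S" "?d t \<in> carrier ?S"
      using degree_closed[OF C(1,4)] degree_closed[OF C(1,2)] by auto
    have x: "?d ?g \<oplus>\<^bsub>?S\<^esub> w U \<otimes>\<^bsub>?S\<^esub> ?g \<in> carrier ?S" (is "?x \<in> _")
      using degree_closed[OF C(1) connection_degree[OF C(1) gU]] .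
    have "pullback_connection X \<Omega> \<Delta> (twisted_connection \<Omega> \<omega>) U ?v ?g = \<zero>\<^bsub>?S\<^esub>"
      using g C(1) UV vertical_field_inverse_dt[OF c]
      unfolding transform_twisted_def pi_hat_plus_def mem_Collect_eq by blast
    then have "u \<otimes>\<^bsub>?S\<^esub> ?x = \<zero>\<^bsub>?S\<^esub>"
      using pullback_connection_eq[OF C(1) f gU] by simp
    then have "(?d t \<otimes>\<^bsub>?S\<^esub> u) \<otimes>\<^bsub>?S\<^esub> ?x = \<zero>\<^bsub>?S\<^esub>"
      using uc x by (simp only: S.m_assoc S.r_null)
    then have "?x = \<zero>\<^bsub>?S\<^esub>"
      unfolding C(6) using x by (simp only: S.l_one)
    then show "res V U (d V g \<oplus>\<^bsub>S V\<^esub> w V \<otimes>\<^bsub>S V\<^esub> g) = res V U \<zero>\<^bsub>S V\<^esub>"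
      unfolding connection_restr[OF V C(1) UV g0] res_zero[OF V C(1) UV] .
  qed
  then show "g \<in> horizontal V"
    using g0 horizontal_iff[OF V] by simp
qed

abbreviation "M \<equiv> transform_twisted \<Lambda> X \<Omega> \<Delta> \<omega>"

lemma horizontalD:
  assumes "openin T V" "m \<in> horizontal V"
  shows "m \<in> \<O> V 0" "m \<in> carrier (S V)"
    "odd_derivation.flat (S V) (d V) (w V) m"
  using assms degree_closed[OF assms(1)] by (auto simp: horizontal_def)

lemma horizontal_scale:
  assumes V: "openin T V" and a: "a \<in> closed_functions V" and m: "m \<in> horizontal V"
  shows "a \<otimes>\<^bsub>S V\<^esub> m \<in> horizontal V"
proof -
  interpret S: odd_derivation_over_C "S V" "d V" "scalar V"
    using proj_algebra[OF V] .
  have "S.flat (w V) (a \<otimes>\<^bsub>S V\<^esub> m)"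
    using a degree_closed[OF V] by (intro S.flat_scale w_facts(3)[OF V] horizontalD(3)[OF V m]) auto
  then show ?thesis
    using degree_zero_mult[OF V _ horizontalD(1)[OF V m]] a by (simp add: horizontal_def)
qed

lemma transform_submodule_sheaf: "submodule_sheaf Y A M"
  unfolding submodule_sheaf_def dual_curve_simps O_Delta_simps
proof (intro conjI allI impI ballI)
  fix V assume V: "openin T V"
  interpret S: odd_derivation_over_C "S V" "d V" "scalar V"
    using proj_algebra[OF V] .
  interpret O: supercommutative_ring "sub_super (S V) (\<O> V 0)"
    using degree_zero_ring[OF V] .
  let ?S = "S V" and ?O = "sub_super (S V) (\<O> V 0)"
  note wV = w_facts(3)[OF V] w_closed[OF V]
  note eq = transform_eq[OF V]
  have sub: "\<O> V 0 \<subseteq> carrier ?S"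
    using degree_closed[OF V] by auto
  show "subgroup (M V) (add_monoid ?O)"
    unfolding eq
  proof
    show "horizontal V \<subseteq> carrier (add_monoid ?O)"
      using horizontalD(1)[OF V] by auto
    show "\<one>\<^bsub>add_monoid ?O\<^esub> \<in> horizontal V"
      using degree_zero[OF V] S.flat_zero[OF wV(2)] by (simp add: horizontal_def)
    fix x assume x: "x \<in> horizontal V"
    have "\<ominus>\<^bsub>?O\<^esub> x \<in> horizontal V"
      using neg_sub_super[OF S.ring_axioms O.ring_axioms sub horizontalD(1)[OF V x]]
        degree_neg[OF V horizontalD(1)[OF V x]] S.flat_neg[OF wV(2) horizontalD(3)[OF V x]]
      by (simp add: horizontal_def)
    then show "inv\<^bsub>add_monoid ?O\<^esub> x \<in> horizontal V"
      by (simp add: a_inv_def)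
    fix y assume y: "y \<in> horizontal V"
    show "x \<otimes>\<^bsub>add_monoid ?O\<^esub> y \<in> horizontal V"
      using degree_add[OF V horizontalD(1)[OF V x] horizontalD(1)[OF V y]]
        S.flat_add[OF wV(2) horizontalD(3)[OF V x] horizontalD(3)[OF V y]]
      by (simp add: horizontal_def)
  qed
  show "a \<otimes>\<^bsub>?O\<^esub> m \<in> M V"
    if "a \<in> carrier (sub_super ?S (closed_functions V))" "m \<in> M V" for a m
    using horizontal_scale[OF V, of a m] that unfolding eq by simp
  fix a b assume ab: "a \<in> homog ?O False" "b \<in> homog ?O True" and "a \<oplus>\<^bsub>?O\<^esub> b \<in> M V"
  then have "S.flat (w V) (a \<oplus>\<^bsub>?S\<^esub> b)"
    using horizontalD(3)[OF V] unfolding eq by simp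
  then show "a \<in> M V" "b \<in> M V"
    using ab S.flat_parts[OF wV(1), of a b] unfolding eq by (simp_all add: horizontal_def)
next
  fix V W assume "openin T V \<and> openin T W \<and> W \<subseteq> V"
  then show "res V W ` M V \<subseteq> M W"
    using horizontal_restr[of V W] by (auto simp: transform_eq)
next
  show "gluing T M res"
    unfolding gluing_def
  proof (intro allI impI)
    fix \<U> s
    assume "\<forall>U\<in>\<U>. openin T U \<and> s U \<in> M U"
      and c: "\<forall>U\<in>\<U>. \<forall>V\<in>\<U>. res U (U \<inter> V) (s U) = res V (U \<inter> V) (s V)"
    then have U: "openin T U" "s U \<in> horizontal U" if "U \<in> \<U>" for U
      using that transform_eq by auto
    let ?V = "\<Union>\<U>"
    have V: "openin T ?V" using U(1) by auto
    have ex: "\<exists>!t. t \<in> \<O> ?V 0 \<and> (\<forall>U\<in>\<U>. res ?V U t = s U)"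
      by (rule degree_glue) (use U(1) horizontalD(1)[OF U] c in auto)
    then obtain t where t: "t \<in> \<O> ?V 0" "\<forall>U\<in>\<U>. res ?V U t = s U"
      by (elim ex1E conjE)
    have "d ?V t \<oplus>\<^bsub>S ?V\<^esub> w ?V \<otimes>\<^bsub>S ?V\<^esub> t = \<zero>\<^bsub>S ?V\<^esub>"
    proof (rule degree_separated[OF U(1) connection_degree[OF V t(1)] degree_zero[OF V]])
      fix U assume UU: "U \<in> \<U>"
      note h = V U(1)[OF UU] Union_upper[OF UU]
      show "res ?V U (d ?V t \<oplus>\<^bsub>S ?V\<^esub> w ?V \<otimes>\<^bsub>S ?V\<^esub> t) = res ?V U \<zero>\<^bsub>S ?V\<^esub>"
        unfolding connection_restr[OF h t(1)] bspec[OF t(2) UU] res_zero[OF h]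
        using U(2)[OF UU] horizontal_iff[OF h(2)] by blast
    qed
    then have tM: "t \<in> M ?V"
      using t(1) horizontal_iff[OF V] transform_eq[OF V] by simp
    show "\<exists>!t. t \<in> M ?V \<and> (\<forall>U\<in>\<U>. res ?V U t = s U)"
    proof (rule ex1I)
      show "t \<in> M ?V \<and> (\<forall>U\<in>\<U>. res ?V U t = s U)"
        using tM t(2) by (rule conjI)
      fix t' assume t': "t' \<in> M ?V \<and> (\<forall>U\<in>\<U>. res ?V U t' = s U)"
      then have "t' \<in> \<O> ?V 0 \<and> (\<forall>U\<in>\<U>. res ?V U t' = s U)"
        using horizontalD(1)[OF V, of t'] unfolding transform_eq[OF V] by (elim conjE) (rule conjI)
      then show "t' = t"
        by (rule ex1_eq[OF ex]) (rule conjI[OF t])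
    qed
  qed
qed

lemma trivializationD:
  assumes U: "openin T U" and t: "trivialization Y A M U \<phi>"
  shows "\<phi> \<in> horizontal U" "\<phi> \<in> homog (S U) False"
    and "openin T V \<Longrightarrow> V \<subseteq> U \<Longrightarrow> m \<in> horizontal V \<Longrightarrow>
      \<exists>!a. a \<in> closed_functions V \<and> m = a \<otimes>\<^bsub>S V\<^esub> res U V \<phi>"
proof -
  show "\<phi> \<in> horizontal U" "\<phi> \<in> homog (S U) False"
    using t transform_eq[OF U] by (simp_all add: trivialization_def)
  assume V: "openin T V" "V \<subseteq> U" and m: "m \<in> horizontal V"
  have "\<forall>V. openin T V \<and> V \<subseteq> U \<longrightarrow> (\<forall>m\<in>M V. \<exists>!a. a \<in> closed_functions V \<and> m = a \<otimes>\<^bsub>S V\<^esub> res U V \<phi>)"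
    using t unfolding trivialization_def dual_curve_simps O_Delta_simps sub_super_simps by (rule conjunct2)
  from this[THEN spec[of _ V]] V m
  show "\<exists>!a. a \<in> closed_functions V \<and> m = a \<otimes>\<^bsub>S V\<^esub> res U V \<phi>"
    unfolding transform_eq[OF V(1)] by (elim impE bspec) simp
qed

text \<open>Multiplication by the inverse of an invertible even solution maps solutions to closed functions.\<close>

lemma unit_trivialization:
  assumes U: "openin T U" and \<phi>: "\<phi> \<in> horizontal U" "\<phi> \<in> homog (S U) False"
    and \<psi>: "\<psi> \<in> \<O> U 0" "\<phi> \<otimes>\<^bsub>S U\<^esub> \<psi> = \<one>\<^bsub>S U\<^esub>"
  shows "trivialization Y A M U \<phi>"
  unfolding trivialization_def dual_curve_simps O_Delta_simps sub_super_simps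
proof (intro conjI allI impI ballI)
  show "\<phi> \<in> M U \<inter> (\<O> U 0 \<inter> homog (S U) False)"
    using \<phi> horizontalD(1)[OF U] transform_eq[OF U] by auto
  fix V m assume "openin T V \<and> V \<subseteq> U" and "m \<in> M V"
  then have V: "openin T V" "V \<subseteq> U" and m: "m \<in> horizontal V"
    using transform_eq by auto
  note h = U V
  let ?S = "S V" and ?\<phi> = "res U V \<phi>" and ?\<psi> = "res U V \<psi>"
  interpret S: odd_derivation_over_C ?S "d V" "scalar V"
    using proj_algebra[OF V(1)] .
  have \<phi>V: "?\<phi> \<in> homog ?S False" "S.flat (w V) ?\<phi>"
    using res_homog[OF h \<phi>(2)] horizontalD(3)[OF V(1) horizontal_restr[OF h \<phi>(1)]] by auto
  have \<psi>V: "?\<psi> \<in> \<O> V 0" "?\<psi> \<in> carrier ?S"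
    using res_degree[OF h \<psi>(1)] degree_closed[OF V(1)] by auto
  have \<phi>\<psi>: "?\<phi> \<otimes>\<^bsub>?S\<^esub> ?\<psi> = \<one>\<^bsub>?S\<^esub>"
    using res_mult[OF h horizontalD(2)[OF U \<phi>(1)] degree_closed[OF U \<psi>(1)]] res_one[OF h] \<psi>(2) by simp
  note \<psi>\<phi> = S.even_inverse(1,2)[OF \<phi>V(1) \<psi>V(2) \<phi>\<psi>]
  note mV = horizontalD[OF V(1) m]
  show "\<exists>!a. a \<in> closed_functions V \<and> m = a \<otimes>\<^bsub>?S\<^esub> ?\<phi>"
  proof (rule ex1I[of _ "?\<psi> \<otimes>\<^bsub>?S\<^esub> m"])
    have "(?\<psi> \<otimes>\<^bsub>?S\<^esub> m) \<otimes>\<^bsub>?S\<^esub> ?\<phi> = (?\<psi> \<otimes>\<^bsub>?S\<^esub> ?\<phi>) \<otimes>\<^bsub>?S\<^esub> m"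
      using S.even_central[OF \<phi>V(1) mV(2)] \<phi>V(1) \<psi>V(2) mV(2) by (simp add: S.m_assoc)
    then have "m = (?\<psi> \<otimes>\<^bsub>?S\<^esub> m) \<otimes>\<^bsub>?S\<^esub> ?\<phi>"
      unfolding \<psi>\<phi>(2) using mV(2) by simp
    then show "?\<psi> \<otimes>\<^bsub>?S\<^esub> m \<in> closed_functions V \<and> m = (?\<psi> \<otimes>\<^bsub>?S\<^esub> m) \<otimes>\<^bsub>?S\<^esub> ?\<phi>"
      using S.flat_quotient_closed[OF w_facts(3)[OF V(1)] \<phi>V(1) \<psi>V(2) \<phi>\<psi> \<phi>V(2) mV(3)]
        degree_zero_mult[OF V(1) \<psi>V(1) mV(1)] by blast
    fix a assume "a \<in> closed_functions V \<and> m = a \<otimes>\<^bsub>?S\<^esub> ?\<phi>"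
    then have a: "a \<in> carrier ?S" "m = a \<otimes>\<^bsub>?S\<^esub> ?\<phi>"
      using degree_closed[OF V(1)] by auto
    have "?\<psi> \<otimes>\<^bsub>?S\<^esub> m = a \<otimes>\<^bsub>?S\<^esub> (?\<phi> \<otimes>\<^bsub>?S\<^esub> ?\<psi>)"
      unfolding a(2) using S.even_central[OF \<psi>\<phi>(1), of "a \<otimes>\<^bsub>?S\<^esub> ?\<phi>"] a(1) \<phi>V(1) \<psi>V(2)
      by (simp add: S.m_assoc)
    then show "a = ?\<psi> \<otimes>\<^bsub>?S\<^esub> m"
      unfolding \<phi>\<psi> using a(1) by simp
  qed
qed

lemma chart_primitive:
  assumes c: "chart U t u"
  obtains h where "h \<in> \<O> U 0" "h \<in> homog (S U) False" "d U h = w U"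
    "h \<otimes>\<^bsub>S U\<^esub> h = \<zero>\<^bsub>S U\<^esub>"
proof -
  note C = chartD[OF c]
  interpret S: odd_derivation_over_C "S U" "d U" "scalar U"
    using proj_algebra[OF C(1)] .
  note P = S.odd_primitive[OF C(3,5,6) dtilde_inverse_dt[OF c] w_facts(3,4)[OF C(1)]]
  have "u \<otimes>\<^bsub>S U\<^esub> w U \<in> \<O> U 0"
    using degree_mult[OF C(1,4) w_facts(2)[OF C(1)]] by simp
  from degree_zero_mult[OF C(1,2) this] P show ?thesis
    by (rule that)
qed

text \<open>The trivialization is \<open>exp (-h)\<close>.\<close>

lemma primitive_trivialization:
  assumes U: "openin T U" and h: "h \<in> \<O> U 0" "h \<in> homog (S U) False" "d U h = w U"
    "h \<otimes>\<^bsub>S U\<^esub> h = \<zero>\<^bsub>S U\<^esub>"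
  shows "trivialization Y A M U (\<one>\<^bsub>S U\<^esub> \<ominus>\<^bsub>S U\<^esub> h)"
proof -
  interpret S: odd_derivation_over_C "S U" "d U" "scalar U"
    using proj_algebra[OF U] .
  note F = S.flat_one_minus_primitive[OF h(2,4,3)]
  show ?thesis
  proof (rule unit_trivialization[OF U])
    show "\<one>\<^bsub>S U\<^esub> \<ominus>\<^bsub>S U\<^esub> h \<in> horizontal U"
      using F(1) degree_minus[OF U one_degree[OF U] h(1)] by (simp add: horizontal_def)
    show "\<one>\<^bsub>S U\<^esub> \<oplus>\<^bsub>S U\<^esub> h \<in> \<O> U 0"
      using degree_add[OF U one_degree[OF U] h(1)] .
  qed (use F(2) h(2) in auto)
qed

theorem transform_line_bundle: "line_bundle Y A M"
  unfolding line_bundle_def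
proof (intro conjI ballI transform_submodule_sheaf)
  fix x assume "x \<in> topspace (topo Y)"
  then obtain U t u where U: "x \<in> U" "chart U t u"
    using charts_cover[of x] by auto
  obtain h where h: "h \<in> \<O> U 0" "h \<in> homog (S U) False" "d U h = w U"
    "h \<otimes>\<^bsub>S U\<^esub> h = \<zero>\<^bsub>S U\<^esub>"
    by (rule chart_primitive[OF U(2)])
  show "\<exists>U \<phi>. openin (topo Y) U \<and> x \<in> U \<and> trivialization Y A M U \<phi>"
    using U(1) chartD(1)[OF U(2)] primitive_trivialization[OF chartD(1)[OF U(2)] h] by auto
qed

lemma trivialization_cancel:
  assumes U: "openin T U" and t: "trivialization Y A M U \<phi>" and V: "openin T V" "V \<subseteq> U"
    and ab: "a \<in> closed_functions V" "b \<in> closed_functions V"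
    and eq: "a \<otimes>\<^bsub>S V\<^esub> res U V \<phi> = b \<otimes>\<^bsub>S V\<^esub> res U V \<phi>"
  shows "a = b"
proof -
  have m: "a \<otimes>\<^bsub>S V\<^esub> res U V \<phi> \<in> horizontal V"
    by (intro horizontal_scale V ab horizontal_restr[OF U V] trivializationD(1)[OF U t])
  show ?thesis
    by (rule ex1_eq[OF trivializationD(3)[OF U t V m], of a b]) (use ab eq in simp_all)
qed

text \<open>Each trivialization is a multiple of the other by a closed function, and by cancellation these two functions are inverse
  to each other.\<close>

lemma trivialization_transition:
  assumes U: "openin T U" "trivialization Y A M U \<phi>" and U': "openin T U'" "trivialization Y A M U' \<phi>'"
    and V: "openin T V" "V \<subseteq> U" "V \<subseteq> U'"
  shows "\<exists>f\<in>carrier (unit_sheaf V). res U' V \<phi>' = f \<otimes>\<^bsub>S V\<^esub> res U V \<phi>"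
proof -
  interpret S: odd_derivation_over_C "S V" "d V" "scalar V"
    using proj_algebra[OF V(1)] .
  interpret Y: supercommutative_ring "dual_ring V"
    using closed_functions_ring[OF V(1)] .
  let ?S = "S V" and ?\<phi> = "res U V \<phi>" and ?\<phi>' = "res U' V \<phi>'"
  have \<phi>: "?\<phi> \<in> horizontal V" "?\<phi> \<in> homog ?S False"
    by (intro horizontal_restr[OF U(1) V(1,2)] res_homog[OF U(1) V(1,2)] trivializationD(1,2)[OF U])+
  have \<phi>': "?\<phi>' \<in> horizontal V" "?\<phi>' \<in> homog ?S False"
    by (intro horizontal_restr[OF U'(1) V(1,3)] res_homog[OF U'(1) V(1,3)] trivializationD(1,2)[OF U'])+
  obtain f where f: "f \<in> closed_functions V" "?\<phi>' = f \<otimes>\<^bsub>?S\<^esub> ?\<phi>"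
    using trivializationD(3)[OF U V(1,2) \<phi>'(1)] by (elim ex1E conjE)
  obtain f' where f': "f' \<in> closed_functions V" "?\<phi> = f' \<otimes>\<^bsub>?S\<^esub> ?\<phi>'"
    using trivializationD(3)[OF U' V(1,3) \<phi>(1)] by (elim ex1E conjE)
  have fc: "f \<in> carrier ?S" "f' \<in> carrier ?S"
    using f(1) f'(1) degree_closed[OF V(1)] by auto
  have one: "\<one>\<^bsub>?S\<^esub> \<in> closed_functions V"
    using one_degree[OF V(1)] by simp
  have ff': "f' \<otimes>\<^bsub>?S\<^esub> f \<in> closed_functions V" "f \<otimes>\<^bsub>?S\<^esub> f' \<in> closed_functions V"
    using Y.m_closed[of f' f] Y.m_closed[of f f'] f(1) f'(1) by auto
  \<comment> \<open>The odd part of \<open>f\<close> is zero because both trivializations are even.\<close>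
  obtain f0 f1 where p: "f0 \<in> homog (sub_super ?S (closed_functions V)) False"
    "f1 \<in> homog (sub_super ?S (closed_functions V)) True" "f = f0 \<oplus>\<^bsub>?S\<^esub> f1"
    using Y.parity_decomposition[of f] f(1) by auto
  have "f0 \<otimes>\<^bsub>?S\<^esub> ?\<phi> \<oplus>\<^bsub>?S\<^esub> f1 \<otimes>\<^bsub>?S\<^esub> ?\<phi> = ?\<phi>' \<oplus>\<^bsub>?S\<^esub> \<zero>\<^bsub>?S\<^esub>"
  proof -
    have "f0 \<in> carrier ?S" "f1 \<in> carrier ?S" "?\<phi> \<in> carrier ?S"
      using p(1,2) \<phi>(2) by auto
    from S.l_distr[OF this] have "f0 \<otimes>\<^bsub>?S\<^esub> ?\<phi> \<oplus>\<^bsub>?S\<^esub> f1 \<otimes>\<^bsub>?S\<^esub> ?\<phi> = ?\<phi>'"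
      unfolding f(2) p(3) by (rule sym)
    then show ?thesis
      using S.homog_closed[OF \<phi>'(2)] by simp
  qed
  then have "f0 \<otimes>\<^bsub>?S\<^esub> ?\<phi> = ?\<phi>'"
    using p \<phi>(2) \<phi>'(2) by (intro S.parity_unique(1)[of "f0 \<otimes>\<^bsub>?S\<^esub> ?\<phi>" "f1 \<otimes>\<^bsub>?S\<^esub> ?\<phi>" ?\<phi>' "\<zero>\<^bsub>?S\<^esub>"]) auto
  then have f0_eq: "f0 \<otimes>\<^bsub>?S\<^esub> ?\<phi> = f \<otimes>\<^bsub>?S\<^esub> ?\<phi>"
    unfolding f(2) .
  have f0c: "f0 \<in> closed_functions V"
    using p(1) by simp
  have "f0 = f"
    by (rule trivialization_cancel[OF U V(1,2) f0c f(1) f0_eq])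
  then have f_even: "f \<in> homog ?S False"
    using p(1) by simp
  have "(f' \<otimes>\<^bsub>?S\<^esub> f) \<otimes>\<^bsub>?S\<^esub> ?\<phi> = \<one>\<^bsub>?S\<^esub> \<otimes>\<^bsub>?S\<^esub> ?\<phi>"
    using f(2) f'(2) fc \<phi>(2) by (simp add: S.m_assoc)
  then have "f' \<otimes>\<^bsub>?S\<^esub> f = \<one>\<^bsub>?S\<^esub>"
    by (rule trivialization_cancel[OF U V(1,2) ff'(1) one])
  then have "f \<otimes>\<^bsub>?S\<^esub> f' = \<one>\<^bsub>?S\<^esub>"
    using S.even_central[OF f_even fc(2)] by simp
  then have "f \<in> carrier (unit_sheaf V)"
    by (rule unit_sheafI[OF V(1) f(1) f_even f'(1)])
  then show ?thesis
    using f(2) by blast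
qed

text \<open>The data that \<^const>\<open>line_bundle_class\<close> quantifies over.\<close>

definition transition_data :: "('a \<Rightarrow> 'a set) \<Rightarrow> ('a \<Rightarrow> 'l) \<Rightarrow> ('a \<Rightarrow> 'a \<Rightarrow> 'l) \<Rightarrow> bool" where
  "transition_data U \<phi> g \<longleftrightarrow> point_cover T U \<and>
     (\<forall>x\<in>topspace T. trivialization Y A M (U x) (\<phi> x)) \<and>
     (\<forall>x\<in>topspace T. \<forall>y\<in>topspace T. g x y \<in> carrier (unit_sheaf (U x \<inter> U y)) \<and>
        res (U x) (U x \<inter> U y) (\<phi> x) =
          g x y \<otimes>\<^bsub>S (U x \<inter> U y)\<^esub> res (U y) (U x \<inter> U y) (\<phi> y))"

lemma transition_dataD:
  assumes "transition_data U \<phi> g" "x \<in> topspace T"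
  shows "openin T (U x)" "x \<in> U x" "trivialization Y A M (U x) (\<phi> x)"
    and "y \<in> topspace T \<Longrightarrow> g x y \<in> carrier (unit_sheaf (U x \<inter> U y))"
    and "y \<in> topspace T \<Longrightarrow> openin T V \<Longrightarrow> V \<subseteq> U x \<inter> U y \<Longrightarrow> res (U x) V (\<phi> x) =
      res (U x \<inter> U y) V (g x y) \<otimes>\<^bsub>S V\<^esub> res (U y) V (\<phi> y)"
proof -
  have cov: "point_cover T U" and triv: "\<And>x. x \<in> topspace T \<Longrightarrow> trivialization Y A M (U x) (\<phi> x)"
    using assms(1) unfolding transition_data_def by meson+
  show oUx: "openin T (U x)" and "x \<in> U x" and tx: "trivialization Y A M (U x) (\<phi> x)"
    using cov triv assms(2) by (auto simp: point_cover_def)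
  show "g x y \<in> carrier (unit_sheaf (U x \<inter> U y))" if "y \<in> topspace T"
    using assms that unfolding transition_data_def by meson
  assume y: "y \<in> topspace T" and V: "openin T V" "V \<subseteq> U x \<inter> U y"
  have oUy: "openin T (U y)"
    using cov y by (auto simp: point_cover_def)
  let ?W = "U x \<inter> U y"
  have W: "openin T ?W" using oUx oUy by auto
  have g: "g x y \<in> carrier (unit_sheaf ?W)"
    and eq: "res (U x) ?W (\<phi> x) = g x y \<otimes>\<^bsub>S ?W\<^esub> res (U y) ?W (\<phi> y)"
    using assms y unfolding transition_data_def by meson+
  have gc: "g x y \<in> carrier (S ?W)"
    using unit_sheafD[OF W g] degree_closed[OF W] by blast
  note \<phi>x = horizontalD(2)[OF oUx trivializationD(1)[OF oUx tx]]
  note \<phi>y = horizontalD(2)[OF oUy trivializationD(1)[OF oUy triv[OF y]]]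
  have "res ?W V (res (U x) ?W (\<phi> x)) =
      res ?W V (g x y) \<otimes>\<^bsub>S V\<^esub> res ?W V (res (U y) ?W (\<phi> y))"
    unfolding eq by (rule res_mult[OF W V gc res_closed[OF oUy W Int_lower2 \<phi>y]])
  then show "res (U x) V (\<phi> x) = res ?W V (g x y) \<otimes>\<^bsub>S V\<^esub> res (U y) V (\<phi> y)"
    unfolding res_res[OF oUx W V Int_lower1 \<phi>x] res_res[OF oUy W V Int_lower2 \<phi>y] .
qed

lemma unit_closed_functions:
  assumes "openin T V" "a \<in> carrier (unit_sheaf V)"
  shows "a \<in> closed_functions V" "a \<in> carrier (S V)"
  using unit_sheafD[OF assms] degree_closed[OF assms(1)] by blast+

lemma unit_mult_closed:
  assumes "openin T V" "a \<in> carrier (unit_sheaf V)" "b \<in> carrier (unit_sheaf V)"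
  shows "a \<otimes>\<^bsub>S V\<^esub> b \<in> closed_functions V"
proof -
  interpret Y: supercommutative_ring "dual_ring V"
    using closed_functions_ring[OF assms(1)] .
  show ?thesis
    using Y.m_closed[of a b] unit_closed_functions(1)[OF assms(1,2)] unit_closed_functions(1)[OF assms(1,3)]
    by simp
qed

text \<open>Cancel \<open>\<phi>\<^sub>z\<close> from \<open>\<phi>\<^sub>x = g\<^bsub>xy\<^esub> g\<^bsub>yz\<^esub> \<phi>\<^sub>z = g\<^bsub>xz\<^esub> \<phi>\<^sub>z\<close>.\<close>

lemma transition_cocycle:
  assumes d: "transition_data U \<phi> g"
  shows "(U, g) \<in> cech_Z1 T unit_sheaf res"
  unfolding cech_Z1_def Let_def mem_Collect_eq case_prod_conv
proof (intro conjI ballI)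
  show "point_cover T U"
    using d by (simp add: transition_data_def)
  fix x y assume xy: "x \<in> topspace T" "y \<in> topspace T"
  note x = transition_dataD[OF d xy(1)] and y = transition_dataD[OF d xy(2)]
  show "g x y \<in> carrier (unit_sheaf (U x \<inter> U y))"
    by (rule x(4)[OF xy(2)])
  fix z assume zT: "z \<in> topspace T"
  note z = transition_dataD[OF d zT]
  let ?V = "U x \<inter> U y \<inter> U z"
  have V: "openin T ?V" and W: "openin T (U x \<inter> U y)" "openin T (U y \<inter> U z)" "openin T (U x \<inter> U z)"
    using x(1) y(1) z(1) by auto
  have s: "?V \<subseteq> U x \<inter> U y" "?V \<subseteq> U y \<inter> U z" "?V \<subseteq> U x \<inter> U z" "?V \<subseteq> U z" by auto
  interpret S: supercommutative_ring "S ?V"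
    using proj_ring[OF V] .
  let ?a = "res (U x \<inter> U y) ?V (g x y)" and ?b = "res (U y \<inter> U z) ?V (g y z)"
    and ?c = "res (U x \<inter> U z) ?V (g x z)" and ?\<phi> = "res (U z) ?V (\<phi> z)"
  note r = abelian_presheaf.restr_closed[OF unit_presheaf]
  have a: "?a \<in> carrier (unit_sheaf ?V)" and b: "?b \<in> carrier (unit_sheaf ?V)" and c: "?c \<in> carrier (unit_sheaf ?V)"
    by (rule r[OF W(1) V s(1) x(4)[OF xy(2)]], rule r[OF W(2) V s(2) y(4)[OF zT]], rule r[OF W(3) V s(3) x(4)[OF zT]])
  have \<phi>: "?\<phi> \<in> carrier (S ?V)"
    using res_closed[OF z(1) V s(4) horizontalD(2)[OF z(1) trivializationD(1)[OF z(1,3)]]] .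
  have "(?a \<otimes>\<^bsub>S ?V\<^esub> ?b) \<otimes>\<^bsub>S ?V\<^esub> ?\<phi> = ?a \<otimes>\<^bsub>S ?V\<^esub> res (U y) ?V (\<phi> y)"
    unfolding y(5)[OF zT V s(2)] using unit_closed_functions(2)[OF V] a b \<phi> by (simp add: S.m_assoc)
  also have "\<dots> = ?c \<otimes>\<^bsub>S ?V\<^esub> ?\<phi>"
    using x(5)[OF xy(2) V s(1)] x(5)[OF zT V s(3)] by simp
  finally have "?a \<otimes>\<^bsub>S ?V\<^esub> ?b = ?c"
    by (rule trivialization_cancel[OF z(1,3) V s(4) unit_mult_closed[OF V a b] unit_closed_functions(1)[OF V c]])
  then show "?a \<otimes>\<^bsub>unit_sheaf ?V\<^esub> ?b = ?c"
    by (simp add: even_units_def)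
qed

text \<open>With \<open>\<phi>'\<^sub>x = f\<^sub>x \<phi>\<^sub>x\<close>, cancel \<open>\<phi>\<^sub>y\<close> from \<open>g'\<^bsub>xy\<^esub> f\<^sub>y \<phi>\<^sub>y = \<phi>'\<^sub>x = f\<^sub>x g\<^bsub>xy\<^esub> \<phi>\<^sub>y\<close>.\<close>

lemma transition_cohomologous:
  assumes d: "transition_data U \<phi> g" and d': "transition_data U' \<phi>' g'"
  shows "((U, g), (U', g')) \<in> cech_rel T unit_sheaf res"
proof -
  interpret F: abelian_presheaf T unit_sheaf "res"
    by (rule unit_presheaf)
  let ?W = "\<lambda>x. U x \<inter> U' x"
  have W: "openin T (?W x)" if "x \<in> topspace T" for x
    using transition_dataD(1)[OF d that] transition_dataD(1)[OF d' that] by auto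
  have "\<forall>x\<in>topspace T. \<exists>f. f \<in> carrier (unit_sheaf (?W x)) \<and>
      res (U' x) (?W x) (\<phi>' x) = f \<otimes>\<^bsub>S (?W x)\<^esub> res (U x) (?W x) (\<phi> x)"
    using trivialization_transition[OF transition_dataD(1,3)[OF d] transition_dataD(1,3)[OF d'] W]
    by blast
  then obtain f where f: "\<And>x. x \<in> topspace T \<Longrightarrow> f x \<in> carrier (unit_sheaf (?W x))"
    "\<And>x. x \<in> topspace T \<Longrightarrow> res (U' x) (?W x) (\<phi>' x) = f x \<otimes>\<^bsub>S (?W x)\<^esub> res (U x) (?W x) (\<phi> x)"
    unfolding bchoice_iff by blast
  show ?thesis
  proof (rule F.cech_relI[OF transition_cocycle[OF d] transition_cocycle[OF d'], where W = ?W and f = f])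
    show "point_cover T ?W"
      using d d' by (auto simp: transition_data_def point_cover_def)
    fix x assume xT: "x \<in> topspace T"
    show "?W x \<subseteq> U x \<inter> U' x" by simp
    show "f x \<in> carrier (unit_sheaf (?W x))" by (rule f(1)[OF xT])
    fix y assume yT: "y \<in> topspace T"
    note x = transition_dataD[OF d xT] and y = transition_dataD[OF d yT]
    note x' = transition_dataD[OF d' xT] and y' = transition_dataD[OF d' yT]
    let ?V = "?W x \<inter> ?W y"
    have V: "openin T ?V" using W[OF xT] W[OF yT] by auto
    interpret S: supercommutative_ring "S ?V"
      using proj_ring[OF V] .
    have s: "?V \<subseteq> U x \<inter> U y" "?V \<subseteq> U' x \<inter> U' y" "?V \<subseteq> U y" "?V \<subseteq> U' y" by auto
    have o: "openin T (U x \<inter> U y)" "openin T (U' x \<inter> U' y)"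
      using x(1) y(1) x'(1) y'(1) by auto
    let ?g = "res (U x \<inter> U y) ?V (g x y)" and ?g' = "res (U' x \<inter> U' y) ?V (g' x y)"
    let ?f = "\<lambda>z. res (?W z) ?V (f z)" and ?\<phi> = "res (U y) ?V (\<phi> y)"
    have g: "?g \<in> carrier (unit_sheaf ?V)" and g': "?g' \<in> carrier (unit_sheaf ?V)"
      by (rule F.restr_closed[OF o(1) V s(1) x(4)[OF yT]], rule F.restr_closed[OF o(2) V s(2) x'(4)[OF yT]])
    have fx: "?f x \<in> carrier (unit_sheaf ?V)" and fy: "?f y \<in> carrier (unit_sheaf ?V)"
      by (rule F.restr_closed[OF W[OF xT] V Int_lower1 f(1)[OF xT]], rule F.restr_closed[OF W[OF yT] V Int_lower2 f(1)[OF yT]])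
    have f_restr: "res (U' z) ?V (\<phi>' z) = ?f z \<otimes>\<^bsub>S ?V\<^esub> res (U z) ?V (\<phi> z)"
      if z: "z \<in> topspace T" and Vz: "?V \<subseteq> ?W z" for z
    proof -
      note dz = transition_dataD[OF d z] and dz' = transition_dataD[OF d' z]
      note \<phi>z = horizontalD(2)[OF dz(1) trivializationD(1)[OF dz(1,3)]]
      note \<phi>z' = horizontalD(2)[OF dz'(1) trivializationD(1)[OF dz'(1,3)]]
      have "res (?W z) ?V (res (U' z) (?W z) (\<phi>' z)) =
        ?f z \<otimes>\<^bsub>S ?V\<^esub> res (?W z) ?V (res (U z) (?W z) (\<phi> z))"
        unfolding f(2)[OF z]
        by (rule res_mult[OF W[OF z] V Vz unit_closed_functions(2)[OF W[OF z] f(1)[OF z]]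
              res_closed[OF dz(1) W[OF z] Int_lower1 \<phi>z]])
      then show ?thesis
        unfolding res_res[OF dz(1) W[OF z] V Vz Int_lower1 \<phi>z] res_res[OF dz'(1) W[OF z] V Vz Int_lower2 \<phi>z'] .
    qed
    have \<phi>: "?\<phi> \<in> carrier (S ?V)"
      using res_closed[OF y(1) V s(3) horizontalD(2)[OF y(1) trivializationD(1)[OF y(1,3)]]] .
    note cl = unit_closed_functions(2)[OF V]
    have "(?g' \<otimes>\<^bsub>S ?V\<^esub> ?f y) \<otimes>\<^bsub>S ?V\<^esub> ?\<phi> = ?g' \<otimes>\<^bsub>S ?V\<^esub> res (U' y) ?V (\<phi>' y)"
      unfolding f_restr[OF yT Int_lower2] using cl[OF g'] cl[OF fy] \<phi> by (simp add: S.m_assoc)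
    also have "\<dots> = res (U' x) ?V (\<phi>' x)"
      using x'(5)[OF yT V s(2)] by simp
    also have "\<dots> = (?f x \<otimes>\<^bsub>S ?V\<^esub> ?g) \<otimes>\<^bsub>S ?V\<^esub> ?\<phi>"
      unfolding f_restr[OF xT Int_lower1] x(5)[OF yT V s(1)] using cl[OF g] cl[OF fx] \<phi> by (simp add: S.m_assoc)
    finally have "?g' \<otimes>\<^bsub>S ?V\<^esub> ?f y = ?f x \<otimes>\<^bsub>S ?V\<^esub> ?g"
      by (rule trivialization_cancel[OF y(1,3) V s(3) unit_mult_closed[OF V g' fy] unit_mult_closed[OF V fx g]])
    then show "?g' \<otimes>\<^bsub>unit_sheaf ?V\<^esub> ?f y = ?f x \<otimes>\<^bsub>unit_sheaf ?V\<^esub> ?g"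
      by (simp add: even_units_def)
  qed
qed

lemma line_bundle_class_eq:
  assumes d: "transition_data U \<phi> g"
  shows "line_bundle_class Y A M = cech_class T unit_sheaf res U g"
proof -
  interpret F: abelian_presheaf T unit_sheaf "res"
    by (rule unit_presheaf)
  have "line_bundle_class Y A M = (THE c. \<exists>U \<phi> g. transition_data U \<phi> g \<and> c = cech_class T unit_sheaf res U g)"
    unfolding line_bundle_class_def transition_data_def Let_def by (simp add: conj_assoc)
  also have "\<dots> = cech_class T unit_sheaf res U g"
  proof (rule the_equality)
    show "\<exists>U' \<phi> g'. transition_data U' \<phi> g' \<and>
        cech_class T unit_sheaf res U g = cech_class T unit_sheaf res U' g'"
      using d by blast
    fix c assume "\<exists>U \<phi> g. transition_data U \<phi> g \<and> c = cech_class T unit_sheaf res U g"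
    then obtain U' \<phi>' g' where "transition_data U' \<phi>' g'" "c = cech_class T unit_sheaf res U' g'"
      by blast
    then show "c = cech_class T unit_sheaf res U g"
      using F.cech_class_eqI[OF transition_cohomologous[OF d]] by simp
  qed
  finally show ?thesis .
qed

end

section \<open>The class of the transform\<close>

context twisted_supercurve
begin

text \<open>The data that \<^const>\<open>connecting\<close> quantifies over.\<close>

definition primitives :: "('a \<Rightarrow> 'a set) \<Rightarrow> ('a \<Rightarrow> 'l) \<Rightarrow> bool" where
  "primitives U h \<longleftrightarrow> point_cover T U \<and>
     (\<forall>x\<in>topspace T. h x \<in> carrier (even_nilpotents (sec A (U x))) \<and> d (U x) (h x) = w (U x))"

abbreviation difference :: "('a \<Rightarrow> 'a set) \<Rightarrow> ('a \<Rightarrow> 'l) \<Rightarrow> 'a \<Rightarrow> 'a \<Rightarrow> 'l" where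
  "difference U h \<equiv> \<lambda>x y. res (U y) (U x \<inter> U y) (h y) \<ominus>\<^bsub>S (U x \<inter> U y)\<^esub> res (U x) (U x \<inter> U y) (h x)"

lemma primitivesD:
  assumes "primitives U h" "x \<in> topspace T"
  shows "openin T (U x)" "x \<in> U x" "h x \<in> \<O> (U x) 0" "h x \<in> homog (S (U x)) False"
    "h x \<in> nilpotents (S (U x))" "d (U x) (h x) = w (U x)" "h x \<in> carrier (S (U x))"
proof -
  show U: "openin T (U x)" "x \<in> U x"
    using assms by (auto simp: primitives_def point_cover_def)
  have "h x \<in> carrier (even_nilpotents (sub_super (S (U x)) (\<O> (U x) 0)))"
    and "d (U x) (h x) = w (U x)"
    using assms by (simp_all add: primitives_def)
  then show "h x \<in> \<O> (U x) 0" "h x \<in> homog (S (U x)) False"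
    "h x \<in> nilpotents (S (U x))" "d (U x) (h x) = w (U x)" "h x \<in> carrier (S (U x))"
    using degree_closed[OF U(1), of "h x" 0] by (auto simp: even_nilpotents_def nilpotents_def)
qed

lemma restr_primitive:
  assumes h: "openin T U" "openin T V" "V \<subseteq> U"
    and p: "p \<in> \<O> U 0" "p \<in> homog (S U) False" "p \<in> nilpotents (S U)" "d U p = w U"
  shows "res U V p \<in> \<O> V 0" "res U V p \<in> homog (S V) False"
    "res U V p \<in> nilpotents (S V)" "d V (res U V p) = w V"
proof -
  show "res U V p \<in> \<O> V 0" "res U V p \<in> homog (S V) False"
    by (rule res_degree[OF h p(1)], rule res_homog[OF h p(2)])
  interpret U: odd_derivation_over_C "S U" "d U" "scalar U"
    using proj_algebra[OF h(1)] .
  interpret V: odd_derivation_over_C "S V" "d V" "scalar V"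
    using proj_algebra[OF h(2)] .
  show "res U V p \<in> nilpotents (S V)"
    by (rule ring_hom_nexp(1)[OF U.complex_algebra_axioms V.complex_algebra_axioms res_ring_hom[OF h] scalar_restr[OF h] p(3)])
  show "d V (res U V p) = w V"
    using dtilde_restr[OF h degree_closed[OF h(1) p(1)]] p(4) w_restr[OF h] by simp
qed

lemma primitive_difference:
  assumes V: "openin T V"
    and p: "p \<in> \<O> V 0" "p \<in> homog (S V) False" "p \<in> nilpotents (S V)" "d V p = w V"
    and q: "q \<in> \<O> V 0" "q \<in> homog (S V) False" "q \<in> nilpotents (S V)" "d V q = w V"
  shows "p \<ominus>\<^bsub>S V\<^esub> q \<in> carrier (nilpotent_sheaf V)"
proof -
  interpret S: odd_derivation_over_C "S V" "d V" "scalar V"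
    using proj_algebra[OF V] .
  note pq = degree_closed[OF V p(1)] degree_closed[OF V q(1)]
  have "d V (p \<ominus>\<^bsub>S V\<^esub> q) = \<zero>\<^bsub>S V\<^esub>"
    using S.deriv_minus[OF pq] p(4) q(4) w_closed[OF V] by (simp add: S.minus_eq S.r_neg)
  moreover have "p \<ominus>\<^bsub>S V\<^esub> q \<in> nilpotents (S V)"
    unfolding a_minus_def
    by (rule S.nilpotents_add(1)[OF p(3) S.nilpotents_neg[OF q(3)] S.even_central[OF p(2) S.a_inv_closed[OF pq(2)]]])
  ultimately show ?thesis
    using degree_minus[OF V p(1) q(1)] S.homog_minus[OF p(2) q(2)] by (simp add: nilpotent_sheaf_iff[OF V])
qed

lemma difference_restr:
  assumes P: "primitives U h" and x: "x \<in> topspace T" and y: "y \<in> topspace T"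
    and V: "openin T V" "V \<subseteq> U x \<inter> U y"
  shows "res (U x \<inter> U y) V (difference U h x y) = res (U y) V (h y) \<ominus>\<^bsub>S V\<^esub> res (U x) V (h x)"
proof -
  note x = primitivesD[OF P x] and y = primitivesD[OF P y]
  have W: "openin T (U x \<inter> U y)" using x(1) y(1) by auto
  show ?thesis
    using res_minus[OF W V res_closed[OF y(1) W Int_lower2 y(7)] res_closed[OF x(1) W Int_lower1 x(7)]]
    unfolding res_res[OF y(1) W V Int_lower2 y(7)] res_res[OF x(1) W V Int_lower1 x(7)] .
qed

lemma difference_cocycle:
  assumes P: "primitives U h"
  shows "(U, difference U h) \<in> cech_Z1 T nilpotent_sheaf res"
  unfolding cech_Z1_def Let_def mem_Collect_eq case_prod_conv
proof (intro conjI ballI)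
  show "point_cover T U"
    using P by (simp add: primitives_def)
  fix x y assume xT: "x \<in> topspace T" and yT: "y \<in> topspace T"
  note x = primitivesD[OF P xT] and y = primitivesD[OF P yT]
  have W: "openin T (U x \<inter> U y)" using x(1) y(1) by auto
  show "difference U h x y \<in> carrier (nilpotent_sheaf (U x \<inter> U y))"
    by (rule primitive_difference[OF W restr_primitive[OF y(1) W Int_lower2 y(3-6)]
          restr_primitive[OF x(1) W Int_lower1 x(3-6)]])
  fix z assume zT: "z \<in> topspace T"
  note z = primitivesD[OF P zT]
  let ?V = "U x \<inter> U y \<inter> U z"
  have V: "openin T ?V" using W z(1) by auto
  have s: "?V \<subseteq> U x \<inter> U y" "?V \<subseteq> U y \<inter> U z" "?V \<subseteq> U x \<inter> U z" "?V \<subseteq> U x" "?V \<subseteq> U y" "?V \<subseteq> U z"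
    by auto
  interpret S: supercommutative_ring "S ?V"
    using proj_ring[OF V] .
  have "res (U x \<inter> U y) ?V (difference U h x y) \<oplus>\<^bsub>S ?V\<^esub> res (U y \<inter> U z) ?V (difference U h y z)
      = res (U x \<inter> U z) ?V (difference U h x z)"
    unfolding difference_restr[OF P xT yT V s(1)] difference_restr[OF P yT zT V s(2)]
      difference_restr[OF P xT zT V s(3)]
    by (rule S.minus_telescope[OF res_closed[OF x(1) V s(4) x(7)] res_closed[OF y(1) V s(5) y(7)]
          res_closed[OF z(1) V s(6) z(7)]])
  then show "res (U x \<inter> U y) ?V (difference U h x y) \<otimes>\<^bsub>nilpotent_sheaf ?V\<^esub>
      res (U y \<inter> U z) ?V (difference U h y z) = res (U x \<inter> U z) ?V (difference U h x z)"
    by (simp add: even_nilpotents_def)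
qed

text \<open>Two choices of primitives differ by the 0-cochain \<open>h\<^sub>x - h'\<^sub>x\<close>, which consists of closed functions.\<close>

lemma difference_cohomologous:
  assumes P: "primitives U h" and P': "primitives U' h'"
  shows "((U, difference U h), (U', difference U' h')) \<in> cech_rel T nilpotent_sheaf res"
proof -
  interpret F: abelian_presheaf T nilpotent_sheaf "res"
    by (rule nilpotent_presheaf)
  let ?W = "\<lambda>x. U x \<inter> U' x"
  let ?f = "\<lambda>x. res (U x) (?W x) (h x) \<ominus>\<^bsub>S (?W x)\<^esub> res (U' x) (?W x) (h' x)"
  show ?thesis
  proof (rule F.cech_relI[OF difference_cocycle[OF P] difference_cocycle[OF P'], where W = ?W and f = ?f])
    show "point_cover T ?W"
      using P P' by (auto simp: primitives_def point_cover_def)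
    fix x assume xT: "x \<in> topspace T"
    note x = primitivesD[OF P xT] and x' = primitivesD[OF P' xT]
    have Wx: "openin T (?W x)" using x(1) x'(1) by auto
    show "?W x \<subseteq> U x \<inter> U' x" by simp
    show "?f x \<in> carrier (nilpotent_sheaf (?W x))"
      by (rule primitive_difference[OF Wx restr_primitive[OF x(1) Wx Int_lower1 x(3-6)]
            restr_primitive[OF x'(1) Wx Int_lower2 x'(3-6)]])
    fix y assume yT: "y \<in> topspace T"
    note y = primitivesD[OF P yT] and y' = primitivesD[OF P' yT]
    have Wy: "openin T (?W y)" using y(1) y'(1) by auto
    let ?V = "?W x \<inter> ?W y"
    have V: "openin T ?V" using Wx Wy by auto
    interpret S: supercommutative_ring "S ?V"
      using proj_ring[OF V] .
    have s: "?V \<subseteq> U x \<inter> U y" "?V \<subseteq> U' x \<inter> U' y" "?V \<subseteq> U x" "?V \<subseteq> U y" "?V \<subseteq> U' x" "?V \<subseteq> U' y"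
      by auto
    let ?a = "res (U x) ?V (h x)" and ?b = "res (U y) ?V (h y)"
      and ?a' = "res (U' x) ?V (h' x)" and ?b' = "res (U' y) ?V (h' y)"
    have fx: "res (?W x) ?V (?f x) = ?a \<ominus>\<^bsub>S ?V\<^esub> ?a'"
      using res_minus[OF Wx V Int_lower1 res_closed[OF x(1) Wx Int_lower1 x(7)] res_closed[OF x'(1) Wx Int_lower2 x'(7)]]
      unfolding res_res[OF x(1) Wx V Int_lower1 Int_lower1 x(7)] res_res[OF x'(1) Wx V Int_lower1 Int_lower2 x'(7)] .
    have fy: "res (?W y) ?V (?f y) = ?b \<ominus>\<^bsub>S ?V\<^esub> ?b'"
      using res_minus[OF Wy V Int_lower2 res_closed[OF y(1) Wy Int_lower1 y(7)] res_closed[OF y'(1) Wy Int_lower2 y'(7)]]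
      unfolding res_res[OF y(1) Wy V Int_lower2 Int_lower1 y(7)] res_res[OF y'(1) Wy V Int_lower2 Int_lower2 y'(7)] .
    have cl: "?a \<in> carrier (S ?V)" "?b \<in> carrier (S ?V)" "?a' \<in> carrier (S ?V)" "?b' \<in> carrier (S ?V)"
      by (rule res_closed[OF x(1) V s(3) x(7)], rule res_closed[OF y(1) V s(4) y(7)],
          rule res_closed[OF x'(1) V s(5) x'(7)], rule res_closed[OF y'(1) V s(6) y'(7)])
    have "res (U' x \<inter> U' y) ?V (difference U' h' x y) \<oplus>\<^bsub>S ?V\<^esub> res (?W y) ?V (?f y) = ?b \<ominus>\<^bsub>S ?V\<^esub> ?a'"
      unfolding fy difference_restr[OF P' xT yT V s(2)] by (rule S.minus_telescope[OF cl(3,4,2)])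
    also have "\<dots> = res (?W x) ?V (?f x) \<oplus>\<^bsub>S ?V\<^esub> res (U x \<inter> U y) ?V (difference U h x y)"
      unfolding fx difference_restr[OF P xT yT V s(1)] by (rule S.minus_telescope[OF cl(3,1,2), symmetric])
    finally show "res (U' x \<inter> U' y) ?V (difference U' h' x y) \<otimes>\<^bsub>nilpotent_sheaf ?V\<^esub> res (?W y) ?V (?f y) =
        res (?W x) ?V (?f x) \<otimes>\<^bsub>nilpotent_sheaf ?V\<^esub> res (U x \<inter> U y) ?V (difference U h x y)"
      by (simp add: even_nilpotents_def)
  qed
qed

lemma connecting_eq:
  assumes P: "primitives U h"
  shows "connecting X \<Omega> \<Delta> \<omega> = cech_class T nilpotent_sheaf res U (difference U h)"
proof -
  interpret F: abelian_presheaf T nilpotent_sheaf "res"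
    by (rule nilpotent_presheaf)
  have "connecting X \<Omega> \<Delta> \<omega> = (THE c. \<exists>U h. primitives U h \<and> c = cech_class T nilpotent_sheaf res U (difference U h))"
    unfolding connecting_def primitives_def w_def by (simp add: conj_assoc)
  also have "\<dots> = cech_class T nilpotent_sheaf res U (difference U h)"
  proof (rule the_equality)
    show "\<exists>U' h'. primitives U' h' \<and> cech_class T nilpotent_sheaf res U (difference U h) =
        cech_class T nilpotent_sheaf res U' (difference U' h')"
      using P by blast
    fix c assume "\<exists>U h. primitives U h \<and> c = cech_class T nilpotent_sheaf res U (difference U h)"
    then obtain U' h' where P': "primitives U' h'" and c: "c = cech_class T nilpotent_sheaf res U' (difference U' h')"
      by blast
    show "c = cech_class T nilpotent_sheaf res U (difference U h)"
      unfolding c by (rule F.cech_class_eqI[OF difference_cohomologous[OF P' P]])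
  qed
  finally show ?thesis .
qed

text \<open>This is \<open>exp (-p) = exp (q - p) exp (-q)\<close>. In general \<open>p\<close> and \<open>q\<close> are not closed, so \<open>exp (q - p)\<close> is
  computed in the larger ring, where it is the product \<open>exp q exp (-p) = (1 + q) (1 - p)\<close>.\<close>

lemma exp_difference_transition:
  assumes V: "openin T V" and s: "q \<ominus>\<^bsub>S V\<^esub> p \<in> closed_functions V"
    and p: "p \<in> homog (S V) False" "p \<otimes>\<^bsub>S V\<^esub> p = \<zero>\<^bsub>S V\<^esub>"
    and q: "q \<in> homog (S V) False" "q \<otimes>\<^bsub>S V\<^esub> q = \<zero>\<^bsub>S V\<^esub>"
  shows "\<one>\<^bsub>S V\<^esub> \<ominus>\<^bsub>S V\<^esub> p
    = nil_exp \<iota> Y V (q \<ominus>\<^bsub>S V\<^esub> p) \<otimes>\<^bsub>S V\<^esub> (\<one>\<^bsub>S V\<^esub> \<ominus>\<^bsub>S V\<^esub> q)"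
proof -
  interpret S: odd_derivation_over_C "S V" "d V" "scalar V"
    using proj_algebra[OF V] .
  let ?S = "S V" and ?p = "\<ominus>\<^bsub>S V\<^esub> p"
  have p': "?p \<in> carrier ?S" "?p \<otimes>\<^bsub>?S\<^esub> ?p = \<zero>\<^bsub>?S\<^esub>"
    using p by (simp_all add: S.l_minus S.r_minus)
  have q': "q \<in> carrier ?S" using q by simp
  have "nil_exp \<iota> Y V (q \<ominus>\<^bsub>?S\<^esub> p) = S.nexp (q \<oplus>\<^bsub>?S\<^esub> ?p)"
    unfolding nil_exp_eq[OF V] closed_functions_algebra(2)[OF V s] by (simp only: S.minus_eq)
  also have "\<dots> = S.nexp q \<otimes>\<^bsub>?S\<^esub> S.nexp ?p"
    by (rule S.nilpotents_add(2)[OF S.nexp_square_zero(2)[OF q' q(2)] S.nexp_square_zero(2)[OF p']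
          S.even_central[OF q(1) p'(1)]])
  also have "\<dots> = (\<one>\<^bsub>?S\<^esub> \<oplus>\<^bsub>?S\<^esub> q) \<otimes>\<^bsub>?S\<^esub> (\<one>\<^bsub>?S\<^esub> \<ominus>\<^bsub>?S\<^esub> p)"
    unfolding S.nexp_square_zero(1)[OF q' q(2)] S.nexp_square_zero(1)[OF p'] by (simp only: S.minus_eq)
  finally have e: "nil_exp \<iota> Y V (q \<ominus>\<^bsub>?S\<^esub> p) = (\<one>\<^bsub>?S\<^esub> \<oplus>\<^bsub>?S\<^esub> q) \<otimes>\<^bsub>?S\<^esub> (\<one>\<^bsub>?S\<^esub> \<ominus>\<^bsub>?S\<^esub> p)" .
  have pq: "\<one>\<^bsub>?S\<^esub> \<oplus>\<^bsub>?S\<^esub> q \<in> carrier ?S" "\<one>\<^bsub>?S\<^esub> \<ominus>\<^bsub>?S\<^esub> p \<in> homog ?S False" "\<one>\<^bsub>?S\<^esub> \<ominus>\<^bsub>?S\<^esub> p \<in> carrier ?S"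
    "\<one>\<^bsub>?S\<^esub> \<ominus>\<^bsub>?S\<^esub> q \<in> homog ?S False" "\<one>\<^bsub>?S\<^esub> \<ominus>\<^bsub>?S\<^esub> q \<in> carrier ?S"
    using p q by auto
  have "(\<one>\<^bsub>?S\<^esub> \<oplus>\<^bsub>?S\<^esub> q) \<otimes>\<^bsub>?S\<^esub> (\<one>\<^bsub>?S\<^esub> \<ominus>\<^bsub>?S\<^esub> q) = \<one>\<^bsub>?S\<^esub>"
    using q q' by (simp add: S.minus_eq S.l_distr S.r_distr S.r_minus S.a_assoc S.l_neg S.r_neg)
  then have "((\<one>\<^bsub>?S\<^esub> \<ominus>\<^bsub>?S\<^esub> p) \<otimes>\<^bsub>?S\<^esub> (\<one>\<^bsub>?S\<^esub> \<oplus>\<^bsub>?S\<^esub> q)) \<otimes>\<^bsub>?S\<^esub> (\<one>\<^bsub>?S\<^esub> \<ominus>\<^bsub>?S\<^esub> q) = \<one>\<^bsub>?S\<^esub> \<ominus>\<^bsub>?S\<^esub> p"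
    using pq by (simp add: S.m_assoc)
  then show ?thesis
    unfolding e S.even_central[OF pq(2,1)] by (rule sym)
qed

text \<open>The square-zero primitives \<open>h\<^sub>x\<close> of the charts serve twice: as primitives they compute the connecting homomorphism, and
  \<open>1 - h\<^sub>x\<close> are trivializations that compute the class of the transform.\<close>

theorem transform_class: "line_bundle_class Y A M = H1_exp \<iota> Y (connecting X \<Omega> \<Delta> \<omega>)"
proof -
  have "\<forall>x\<in>topspace T. \<exists>Uh. openin T (fst Uh) \<and> x \<in> fst Uh \<and> snd Uh \<in> \<O> (fst Uh) 0 \<and>
      snd Uh \<in> homog (S (fst Uh)) False \<and> d (fst Uh) (snd Uh) = w (fst Uh) \<and>
      snd Uh \<otimes>\<^bsub>S (fst Uh)\<^esub> snd Uh = \<zero>\<^bsub>S (fst Uh)\<^esub>"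
  proof
    fix x assume "x \<in> topspace T"
    then obtain U t u where U: "x \<in> U" "chart U t u"
      using charts_cover[of x] by auto
    obtain h where "h \<in> \<O> U 0" "h \<in> homog (S U) False" "d U h = w U"
      "h \<otimes>\<^bsub>S U\<^esub> h = \<zero>\<^bsub>S U\<^esub>"
      by (rule chart_primitive[OF U(2)])
    with U(1) chartD(1)[OF U(2)] show "\<exists>Uh. openin T (fst Uh) \<and> x \<in> fst Uh \<and> snd Uh \<in> \<O> (fst Uh) 0 \<and>
      snd Uh \<in> homog (S (fst Uh)) False \<and> d (fst Uh) (snd Uh) = w (fst Uh) \<and>
      snd Uh \<otimes>\<^bsub>S (fst Uh)\<^esub> snd Uh = \<zero>\<^bsub>S (fst Uh)\<^esub>"
      by (intro exI[of _ "(U, h)"]) simp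
  qed
  then obtain Uh where Uh: "\<forall>x\<in>topspace T. openin T (fst (Uh x)) \<and> x \<in> fst (Uh x) \<and>
      snd (Uh x) \<in> \<O> (fst (Uh x)) 0 \<and>
      snd (Uh x) \<in> homog (S (fst (Uh x))) False \<and> d (fst (Uh x)) (snd (Uh x)) = w (fst (Uh x)) \<and>
      snd (Uh x) \<otimes>\<^bsub>S (fst (Uh x))\<^esub> snd (Uh x) = \<zero>\<^bsub>S (fst (Uh x))\<^esub>"
    unfolding bchoice_iff by (elim exE)
  define U h where "U x = fst (Uh x)" and "h x = snd (Uh x)" for x
  have U: "openin T (U x)" "x \<in> U x" and h: "h x \<in> \<O> (U x) 0" "h x \<in> homog (S (U x)) False"
      "d (U x) (h x) = w (U x)" and h2: "h x \<otimes>\<^bsub>S (U x)\<^esub> h x = \<zero>\<^bsub>S (U x)\<^esub>"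
      if "x \<in> topspace T" for x
    using bspec[OF Uh that] unfolding U_def h_def by simp_all
  have P: "primitives U h"
    unfolding primitives_def
  proof (intro conjI ballI)
    show "point_cover T U"
      using U by (simp add: point_cover_def)
    fix x assume x: "x \<in> topspace T"
    interpret S: odd_derivation_over_C "S (U x)" "d (U x)" "scalar (U x)"
      using proj_algebra[OF U(1)[OF x]] .
    have "h x \<in> nilpotents (S (U x))"
      by (rule S.nexp_square_zero(2)[OF S.homog_closed[OF h(2)[OF x]] h2[OF x]])
    then show "h x \<in> carrier (even_nilpotents (sec A (U x)))"
      using h(1,2)[OF x] by (simp add: even_nilpotents_def nilpotents_def)
    show "d (U x) (h x) = w (U x)"
      by (rule h(3)[OF x])
  qed
  define \<phi> where "\<phi> x = \<one>\<^bsub>S (U x)\<^esub> \<ominus>\<^bsub>S (U x)\<^esub> h x" for x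
  let ?g = "\<lambda>x y. nil_exp \<iota> Y (U x \<inter> U y) (difference U h x y)"
  interpret E: abelian_presheaf_hom T nilpotent_sheaf "res" unit_sheaf "res" "nil_exp \<iota> Y"
    by (rule exponential)
  have "transition_data U \<phi> ?g"
    unfolding transition_data_def
  proof (intro conjI ballI)
    show "point_cover T U"
      using U by (simp add: point_cover_def)
    fix x assume x: "x \<in> topspace T"
    show "trivialization Y A M (U x) (\<phi> x)"
      unfolding \<phi>_def by (rule primitive_trivialization[OF U(1)[OF x] h[OF x] h2[OF x]])
    fix y assume y: "y \<in> topspace T"
    let ?V = "U x \<inter> U y"
    have V: "openin T ?V" using U(1)[OF x] U(1)[OF y] by auto
    note hx = U(1)[OF x] V Int_lower1 and hy = U(1)[OF y] V Int_lower2
    have d: "difference U h x y \<in> carrier (nilpotent_sheaf ?V)"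
      using E.F.cocycle_closed(4)[OF difference_cocycle[OF P] x y] .
    show "?g x y \<in> carrier (unit_sheaf ?V)"
      by (rule E.map_closed[OF V d])
    have \<phi>: "res (U z) ?V (\<phi> z) = \<one>\<^bsub>S ?V\<^esub> \<ominus>\<^bsub>S ?V\<^esub> res (U z) ?V (h z)"
      and sq: "res (U z) ?V (h z) \<otimes>\<^bsub>S ?V\<^esub> res (U z) ?V (h z) = \<zero>\<^bsub>S ?V\<^esub>"
      if z: "z \<in> topspace T" and Vz: "?V \<subseteq> U z" for z
    proof -
      note hz = U(1)[OF z] V Vz
      interpret S: supercommutative_ring "S (U z)"
        using proj_ring[OF U(1)[OF z]] .
      note c = S.homog_closed[OF h(2)[OF z]]
      show "res (U z) ?V (\<phi> z) = \<one>\<^bsub>S ?V\<^esub> \<ominus>\<^bsub>S ?V\<^esub> res (U z) ?V (h z)"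
        unfolding \<phi>_def using res_minus[OF hz S.one_closed c] res_one[OF hz] by simp
      show "res (U z) ?V (h z) \<otimes>\<^bsub>S ?V\<^esub> res (U z) ?V (h z) = \<zero>\<^bsub>S ?V\<^esub>"
        using res_mult[OF hz c c] h2[OF z] res_zero[OF hz] by simp
    qed
    have dc: "difference U h x y \<in> closed_functions ?V"
      using d nilpotent_sheaf_iff[OF V] by blast
    show "res (U x) ?V (\<phi> x) = ?g x y \<otimes>\<^bsub>S ?V\<^esub> res (U y) ?V (\<phi> y)"
      unfolding \<phi>[OF x Int_lower1] \<phi>[OF y Int_lower2]
      by (rule exp_difference_transition[OF V dc res_homog[OF hx h(2)[OF x]] sq[OF x Int_lower1]
            res_homog[OF hy h(2)[OF y]] sq[OF y Int_lower2]])
  qed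
  then have "line_bundle_class Y A M = cech_class T unit_sheaf res U ?g"
    by (rule line_bundle_class_eq)
  also have "\<dots> = H1_exp \<iota> Y (connecting X \<Omega> \<Delta> \<omega>)"
    unfolding connecting_eq[OF P] H1_exp_class[OF difference_cocycle[OF P]] ..
  finally show ?thesis .
qed

end

theorem theorem19:
  fixes \<tau> :: topology_kind
    and \<Lambda> :: "'k super_ring" and \<iota> :: "complex \<Rightarrow> 'k"
    and X :: "('a, 'f, 'k) superspace"
    and \<Omega> :: "('a, 'f, 'w) forms"
    and \<Delta> :: "('a, 'w, 'l) proj"
    and \<omega> :: 'w
  assumes "nilpotent_extension \<Lambda> \<iota>"
    and "supercurve \<tau> \<Lambda> \<iota> X"
    and "differential_forms \<tau> \<Lambda> \<iota> X \<Omega>"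
    and "is_proj \<tau> \<Lambda> \<iota> X \<Omega> \<Delta>"
    and "\<omega> \<in> degree_part \<Omega> (topspace (topo X)) 1"
    and "\<omega> \<in> homog (sec \<Omega> (topspace (topo X))) True"
    and "ext_d \<Omega> (topspace (topo X)) \<omega> = \<zero>\<^bsub>sec \<Omega> (topspace (topo X))\<^esub>"
  shows "line_bundle (dual_curve X \<Omega> \<Delta>) (O_Delta X \<Omega> \<Delta>) (transform_twisted \<Lambda> X \<Omega> \<Delta> \<omega>) \<and>
     line_bundle_class (dual_curve X \<Omega> \<Delta>) (O_Delta X \<Omega> \<Delta>) (transform_twisted \<Lambda> X \<Omega> \<Delta> \<omega>)
       = H1_exp \<iota> (dual_curve X \<Omega> \<Delta>) (connecting X \<Omega> \<Delta> \<omega>)"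
proof -
  interpret twisted_supercurve \<tau> \<Lambda> \<iota> X \<Omega> \<Delta> \<omega>
    by unfold_locales (fact assms)+
  show ?thesis
    using transform_line_bundle transform_class by (rule conjI)
qed

end
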